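(* Let $E_{IP}:\{0,1\}^n\times\{0,1\}^n\to\{0,1\}$ be $E_{IP}(x,y)=x\cdot y=\sum_jx_jy_j\bmod 2$. (a) (entangled) If $k_1+k_2-2\max(b_1,b_2)\ge n-2+2\log\varepsilon^{-1}$, then $E_{IP}$ is a $(k_1,k_2,\varepsilon)$ superstrong extractor against $(b_1,b_2)$ entangled quantum storage. (b) (non-entangled) If $k_1+k_2-\max(b_1,b_2)\ge n-2+2\log\varepsilon^{-1}$, then $E_{IP}$ is a $(k_1,k_2,\varepsilon)$ superstrong extractor against $(b_1,b_2)$ non-entangled quantum storage.
   Context: Logarithms are base 2. For a matrix $A$, $|A|_{\mathrm{tr}}=\frac12\mathrm{Tr}\sqrt{A^\dagger A}$. $U_m$ is the uniform distribution on $\{0,1\}^m$ (identified with the maximally mixed state). A source $X$ on $\{0,1\}^n$ has min-entropy (at least) $k$ if $\Pr[X=x]\le2^{-k}$ for all $x$. Storage: for independent sources $X,Y$, a $(b_1,b_2)$ entangled storage is a family of states $\rho_{xy}$ generated by two non-communicating parties as follows. Alice and Bob share an arbitrary entangled state; Alice receives $x$, Bob receives $y$; each applies any quantum operation (depending on the own input) to the own qubits; Alice then stores $b_1$ of her qubits and discards the rest, Bob stores $b_2$ of his qubits and discards the rest; $\rho_{xy}$ is the resulting joint state. $\rho^A_{xy}$ denotes the state obtained when Alice stores her entire state while Bob stores only $b_2$ of his qubits; $\rho^B_{xy}$ is defined symmetrically (Bob stores everything, Alice stores $b_1$ qubits). The storage is $(b_1,b_2)$ non-entangled if $\rho_{xy}=\rho_x\otimes\rho_y$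 for all $x,y$, with $\rho_x$ on $b_1$ qubits and $\rho_y$ on $b_2$ qubits. Let $E:\{0,1\}^n\times\{0,1\}^n\to\{0,1\}^m$. $E$ is a $(k_1,k_2,\varepsilon)$ X-superstrong extractor against $(b_1,b_2)$ entangled (resp. non-entangled) storage if for all independent $n$-bit sources $X,Y$ with min-entropies $k_1,k_2$ and every $(b_1,b_2)$ entangled (resp. non-entangled) storage, $$\Big|\sum_{x,y}p(x)p(y)\,|E(x,y)\rangle\langle E(x,y)|\otimes\rho^A_{xy}\otimes|x\rangle\langle x|-U_m\otimes\sum_{x,y}p(x)p(y)\,\rho^A_{xy}\otimes|x\rangle\langle x|\Big|_{\mathrm{tr}}\le\varepsilon ;$$ Y-superstrong is defined symmetrically with $\rho^B_{xy}$ and $|y\rangle\langle y|$. X-strong (Y-strong) is the same with $\rho_{xy}$ in place of $\rho^A_{xy}$ ($\rho^B_{xy}$). $E$ is superstrong (strong) if it is both X- and Y-superstrong (strong). In the non-entangled case, superstrong and strong coincide, since a party's state can be reconstructed from the party's source. *)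

theory Defs
  imports
    "HOL-Probability.Probability_Mass_Function"
    "Jordan_Normal_Form.Schur_Decomposition"
begin

section \<open>Operators on finite-dimensional complex spaces\<close>

text \<open>The tensor product of spaces of dimensions \<open>d\<close> and \<open>e\<close> has dimension \<open>d * e\<close>; the basis
  vector \<open>i \<otimes> j\<close> is number \<open>i * e + j\<close>. With this numbering the tensor product of matrices is
  associative on the nose. A system of \<open>b\<close> qubits has dimension \<open>2 ^ b\<close>.\<close>

definition tensor_mat :: "complex mat \<Rightarrow> complex mat \<Rightarrow> complex mat"  (infixl "\<otimes>\<^sub>m" 70) where
  "A \<otimes>\<^sub>m B = mat (dim_row A * dim_row B) (dim_col A * dim_col B)
     (\<lambda>(i, j). A $$ (i div dim_row B, j div dim_col B) * B $$ (i mod dim_row B, j mod dim_col B))"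

definition mat_sum :: "nat \<Rightarrow> ('i \<Rightarrow> complex mat) \<Rightarrow> 'i set \<Rightarrow> complex mat" where
  "mat_sum d f I = mat d d (\<lambda>ij. \<Sum>s\<in>I. f s $$ ij)"

definition mat_trace :: "complex mat \<Rightarrow> complex" where
  "mat_trace A = (\<Sum>i<dim_row A. A $$ (i, i))"

text \<open>Partial trace over the middle factor of a tripartite system of dimensions
  \<open>d1\<close>, \<open>d2\<close>, \<open>d3\<close>.\<close>

definition partial_trace :: "nat \<Rightarrow> nat \<Rightarrow> nat \<Rightarrow> complex mat \<Rightarrow> complex mat" where
  "partial_trace d1 d2 d3 A = mat (d1 * d3) (d1 * d3)
     (\<lambda>(i, j). \<Sum>k<d2. A $$ ((i div d3 * d2 + k) * d3 + i mod d3, (j div d3 * d2 + k) * d3 + j mod d3))"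

text \<open>The order on \<^typ>\<open>complex\<close> used here makes \<open>0 \<le> z\<close> say that \<open>z\<close> is real and nonnegative, so
  the condition also forces \<open>A\<close> to be Hermitian.\<close>

definition psd_mat :: "nat \<Rightarrow> complex mat \<Rightarrow> bool" where
  "psd_mat d A \<longleftrightarrow> A \<in> carrier_mat d d \<and> (\<forall>v\<in>carrier_vec d. 0 \<le> (A *\<^sub>v v) \<bullet>c v)"

definition mat_sqrt :: "complex mat \<Rightarrow> complex mat" where
  "mat_sqrt A = (THE B. psd_mat (dim_row A) B \<and> B * B = A)"

definition tr_norm :: "complex mat \<Rightarrow> real" where
  "tr_norm A = 1 / 2 * Re (mat_trace (mat_sqrt (mat_adjoint A * A)))"

definition density_mat :: "nat \<Rightarrow> complex mat \<Rightarrow> bool" where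
  "density_mat d \<rho> \<longleftrightarrow> psd_mat d \<rho> \<and> mat_trace \<rho> = 1"

text \<open>A quantum operation from a \<open>d\<close>-dimensional to a \<open>d'\<close>-dimensional system is given by a list of
  Kraus operators.\<close>

definition quantum_operation :: "nat \<Rightarrow> nat \<Rightarrow> complex mat list \<Rightarrow> bool" where
  "quantum_operation d d' Ks \<longleftrightarrow> set Ks \<subseteq> carrier_mat d' d \<and>
     mat_sum d (\<lambda>k. mat_adjoint (Ks ! k) * Ks ! k) {..<length Ks} = 1\<^sub>m d"

text \<open>Two quantum operations with output dimensions \<open>dA\<close> and \<open>dB\<close>, applied to the two halves of a
  bipartite state.\<close>

definition apply_local ::
  "nat \<Rightarrow> nat \<Rightarrow> complex mat list \<Rightarrow> complex mat list \<Rightarrow> complex mat \<Rightarrow> complex mat" where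
  "apply_local dA dB Ks Ls \<sigma> = mat_sum (dA * dB)
     (\<lambda>(k, l). (Ks ! k \<otimes>\<^sub>m Ls ! l) * \<sigma> * mat_adjoint (Ks ! k \<otimes>\<^sub>m Ls ! l))
     ({..<length Ks} \<times> {..<length Ls})"

section \<open>Bit strings and sources\<close>

definition bitstrings :: "nat \<Rightarrow> bool list set" where
  "bitstrings n = {x. length x = n}"

text \<open>\<open>ket_bra x\<close> is the projector $|x\rangle\langle x|$; the string \<open>x\<close> labels the basis vector whose
  number has binary digits \<open>x\<close>, least significant digit first.\<close>

definition ket_bra :: "bool list \<Rightarrow> complex mat" where
  "ket_bra x = mat (2 ^ length x) (2 ^ length x)
     (\<lambda>(i, j). of_bool (i = horner_sum of_bool 2 x \<and> j = horner_sum of_bool 2 x))"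

definition maximally_mixed :: "nat \<Rightarrow> complex mat" where
  "maximally_mixed m = (1 / 2 ^ m) \<cdot>\<^sub>m 1\<^sub>m (2 ^ m)"

definition min_entropy_source :: "nat \<Rightarrow> real \<Rightarrow> bool list pmf \<Rightarrow> bool" where
  "min_entropy_source n k p \<longleftrightarrow>
     set_pmf p \<subseteq> bitstrings n \<and> (\<forall>x\<in>bitstrings n. pmf p x \<le> 2 powr (- k))"

section \<open>Storage\<close>

text \<open>A storage is described by the family \<open>\<tau> x y\<close> of complete joint states of the two parties before
  anything is discarded. Alice holds \<open>b1\<close> qubits that she may store and \<open>r1\<close> further ones, Bob holds
  \<open>b2\<close> and \<open>r2\<close>; the systems appear in the order \<open>b1, r1, b2, r2\<close>.\<close>

type_synonym state_family = "bool list \<Rightarrow> bool list \<Rightarrow> complex mat"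

text \<open>Here \<open>\<sigma>\<close> is the shared state, on \<open>a\<close> qubits of Alice and \<open>c\<close> qubits of Bob.\<close>

definition entangled_storage :: "nat \<Rightarrow> nat \<Rightarrow> nat \<Rightarrow> nat \<Rightarrow> nat \<Rightarrow> state_family \<Rightarrow> bool" where
  "entangled_storage n b1 b2 r1 r2 \<tau> \<longleftrightarrow>
     (\<exists>a c \<sigma> KA KB. density_mat (2 ^ (a + c)) \<sigma> \<and>
        (\<forall>x\<in>bitstrings n. quantum_operation (2 ^ a) (2 ^ (b1 + r1)) (KA x)) \<and>
        (\<forall>y\<in>bitstrings n. quantum_operation (2 ^ c) (2 ^ (b2 + r2)) (KB y)) \<and>
        (\<forall>x\<in>bitstrings n. \<forall>y\<in>bitstrings n.
           \<tau> x y = apply_local (2 ^ (b1 + r1)) (2 ^ (b2 + r2)) (KA x) (KB y) \<sigma>))"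

text \<open>Without entanglement the parties prepare their complete states separately. Requiring a product
  only of the stored qubits would be too weak: the discarded qubits of one party could still be
  entangled with the stored qubits of the other.\<close>

definition nonentangled_storage :: "nat \<Rightarrow> nat \<Rightarrow> nat \<Rightarrow> nat \<Rightarrow> nat \<Rightarrow> state_family \<Rightarrow> bool" where
  "nonentangled_storage n b1 b2 r1 r2 \<tau> \<longleftrightarrow>
     (\<exists>\<rho>A \<rho>B. (\<forall>x\<in>bitstrings n. density_mat (2 ^ (b1 + r1)) (\<rho>A x)) \<and>
        (\<forall>y\<in>bitstrings n. density_mat (2 ^ (b2 + r2)) (\<rho>B y)) \<and>
        (\<forall>x\<in>bitstrings n. \<forall>y\<in>bitstrings n. \<tau> x y = \<rho>A x \<otimes>\<^sub>m \<rho>B y))"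

text \<open>\<open>alice_keeps_all\<close> and \<open>bob_keeps_all\<close> yield the states written $\rho^A_{xy}$ and $\rho^B_{xy}$.\<close>

definition alice_keeps_all :: "nat \<Rightarrow> nat \<Rightarrow> nat \<Rightarrow> nat \<Rightarrow> complex mat \<Rightarrow> complex mat" where
  "alice_keeps_all b1 b2 r1 r2 = partial_trace (2 ^ (b1 + r1 + b2)) (2 ^ r2) 1"

definition bob_keeps_all :: "nat \<Rightarrow> nat \<Rightarrow> nat \<Rightarrow> nat \<Rightarrow> complex mat \<Rightarrow> complex mat" where
  "bob_keeps_all b1 b2 r1 r2 = partial_trace (2 ^ b1) (2 ^ r1) (2 ^ (b2 + r2))"

section \<open>Superstrong extractors\<close>

text \<open>Independent sources are given by their marginals \<open>p\<close> and \<open>q\<close>; the probability of \<open>(x, y)\<close> is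
  \<open>pmf p x * pmf q y\<close>. The argument \<open>St\<close> is the class of admissible storages.\<close>

definition X_superstrong_extractor ::
  "(nat \<Rightarrow> nat \<Rightarrow> nat \<Rightarrow> nat \<Rightarrow> nat \<Rightarrow> state_family \<Rightarrow> bool) \<Rightarrow> nat \<Rightarrow> nat \<Rightarrow> nat \<Rightarrow> nat \<Rightarrow>
    real \<Rightarrow> real \<Rightarrow> real \<Rightarrow> (bool list \<Rightarrow> bool list \<Rightarrow> bool list) \<Rightarrow> bool" where
  "X_superstrong_extractor St b1 b2 n m k1 k2 \<epsilon> E \<longleftrightarrow>
     (\<forall>x\<in>bitstrings n. \<forall>y\<in>bitstrings n. E x y \<in> bitstrings m) \<and>
     (\<forall>p q r1 r2 \<tau>. min_entropy_source n k1 p \<longrightarrow> min_entropy_source n k2 q \<longrightarrow> St n b1 b2 r1 r2 \<tau> \<longrightarrow>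
        (let \<rho>A = (\<lambda>x y. alice_keeps_all b1 b2 r1 r2 (\<tau> x y)) in
         tr_norm
          (mat_sum (2 ^ (m + (b1 + r1 + b2) + n))
             (\<lambda>(x, y). complex_of_real (pmf p x * pmf q y) \<cdot>\<^sub>m (ket_bra (E x y) \<otimes>\<^sub>m \<rho>A x y \<otimes>\<^sub>m ket_bra x))
             (bitstrings n \<times> bitstrings n)
           - maximally_mixed m \<otimes>\<^sub>m
             mat_sum (2 ^ ((b1 + r1 + b2) + n))
               (\<lambda>(x, y). complex_of_real (pmf p x * pmf q y) \<cdot>\<^sub>m (\<rho>A x y \<otimes>\<^sub>m ket_bra x))
               (bitstrings n \<times> bitstrings n)) \<le> \<epsilon>))"

definition Y_superstrong_extractor ::
  "(nat \<Rightarrow> nat \<Rightarrow> nat \<Rightarrow> nat \<Rightarrow> nat \<Rightarrow> state_family \<Rightarrow> bool) \<Rightarrow> nat \<Rightarrow> nat \<Rightarrow> nat \<Rightarrow> nat \<Rightarrow>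
    real \<Rightarrow> real \<Rightarrow> real \<Rightarrow> (bool list \<Rightarrow> bool list \<Rightarrow> bool list) \<Rightarrow> bool" where
  "Y_superstrong_extractor St b1 b2 n m k1 k2 \<epsilon> E \<longleftrightarrow>
     (\<forall>x\<in>bitstrings n. \<forall>y\<in>bitstrings n. E x y \<in> bitstrings m) \<and>
     (\<forall>p q r1 r2 \<tau>. min_entropy_source n k1 p \<longrightarrow> min_entropy_source n k2 q \<longrightarrow> St n b1 b2 r1 r2 \<tau> \<longrightarrow>
        (let \<rho>B = (\<lambda>x y. bob_keeps_all b1 b2 r1 r2 (\<tau> x y)) in
         tr_norm
          (mat_sum (2 ^ (m + (b1 + b2 + r2) + n))
             (\<lambda>(x, y). complex_of_real (pmf p x * pmf q y) \<cdot>\<^sub>m (ket_bra (E x y) \<otimes>\<^sub>m \<rho>B x y \<otimes>\<^sub>m ket_bra y))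
             (bitstrings n \<times> bitstrings n)
           - maximally_mixed m \<otimes>\<^sub>m
             mat_sum (2 ^ ((b1 + b2 + r2) + n))
               (\<lambda>(x, y). complex_of_real (pmf p x * pmf q y) \<cdot>\<^sub>m (\<rho>B x y \<otimes>\<^sub>m ket_bra y))
               (bitstrings n \<times> bitstrings n)) \<le> \<epsilon>))"

definition superstrong_extractor ::
  "(nat \<Rightarrow> nat \<Rightarrow> nat \<Rightarrow> nat \<Rightarrow> nat \<Rightarrow> state_family \<Rightarrow> bool) \<Rightarrow> nat \<Rightarrow> nat \<Rightarrow> nat \<Rightarrow> nat \<Rightarrow>
    real \<Rightarrow> real \<Rightarrow> real \<Rightarrow> (bool list \<Rightarrow> bool list \<Rightarrow> bool list) \<Rightarrow> bool" where
  "superstrong_extractor St b1 b2 n m k1 k2 \<epsilon> E \<longleftrightarrow>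
     X_superstrong_extractor St b1 b2 n m k1 k2 \<epsilon> E \<and> Y_superstrong_extractor St b1 b2 n m k1 k2 \<epsilon> E"

definition inner_product_ext :: "nat \<Rightarrow> bool list \<Rightarrow> bool list \<Rightarrow> bool list" where
  "inner_product_ext n x y = [odd (\<Sum>j<n. of_bool (x ! j) * of_bool (y ! j) :: nat)]"

end

theory Submission
  imports Defs "HOL-Analysis.Convex" "Jordan_Normal_Form.Spectral_Radius"
begin

text \<open>By duality the trace distance is a sum of terms
  \<open>\<Sum>x y. p x * q y * (-1) ^ (x \<bullet> y) * tr (\<rho> x y * W x)\<close> with contractions \<open>W x\<close>. If this trace can be
  written as an inner product of a vector depending on \<open>x\<close> only and one depending on \<open>y\<close> only,
  Lindsey's lemma applies. Let the party that stores \<open>d\<close> dimensions apply the channel \<open>\<Phi> y\<close>, and let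
  the other party apply \<open>\<Psi> x\<close>, to a shared state \<open>\<sigma>\<close>. Expanding \<open>W x\<close> in matrix units \<open>e i j\<close> of the stored
  system and passing to the adjoint channels gives the sum over \<open>i, j\<close> of
  \<open>tr (\<sigma> * (\<Psi>* (W i j) \<otimes> \<Phi>* (e i j)))\<close>, an inner product in the semi-inner product space defined by
  \<open>\<sigma>\<close>. Both vectors have squared norm at most \<open>d\<close>, the second one even at most \<open>1\<close> if its channel has
  a trivial input, which is the non-entangled case.\<close>

unbundle no vec_syntax

section \<open>Contractions and Lindsey's lemma\<close>

text \<open>The source kept as a register makes the difference operator block diagonal, so the
  optimal test is seen only through blocks labelled by that source. This is why \<open>W\<close>
  depends on \<open>x\<close> alone and can be absorbed by the party that knows \<open>x\<close>.
  The obstacle is that the shared state, the keeper's memory and the discarded qubits have unbounded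
  dimension, so no step may count these dimensions. They enter only through norms: Kraus families
  are isometries, tests are contractions, and the shared state is a factor \<open>R\<close> of total
  squared norm 1. Only the stored dimension \<open>d\<close> is counted. Although the matrix units
  run over \<open>d * d\<close> pairs, for a fixed first index all second indices together are
  controlled by contractions, so each vector costs \<open>d\<close> and not \<open>d * d\<close>.
  The offset \<open>-2\<close> in the entropy condition comes from the single output bit: its
  deviation from uniform is half a signed Pauli matrix, and with the factor 1/2 of
  \<open>tr_norm\<close> a bound \<open>M\<close> on the signed sum becomes \<open>M / 2\<close>,
  which is squared in the end.\<close>

lemma cmod_sum_mult_le:
  fixes f g :: "'i \<Rightarrow> complex"
  shows "(cmod (\<Sum>i\<in>I. f i * g i))\<^sup>2 \<le> (\<Sum>i\<in>I. (cmod (f i))\<^sup>2) * (\<Sum>i\<in>I. (cmod (g i))\<^sup>2)"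
proof -
  have "cmod (\<Sum>i\<in>I. f i * g i) \<le> (\<Sum>i\<in>I. cmod (f i) * cmod (g i))"
    by (rule order_trans[OF norm_sum]) (simp add: norm_mult)
  then have "(cmod (\<Sum>i\<in>I. f i * g i))\<^sup>2 \<le> (\<Sum>i\<in>I. cmod (f i) * cmod (g i))\<^sup>2"
    by (rule power_mono) simp
  also have "\<dots> \<le> (\<Sum>i\<in>I. (cmod (f i))\<^sup>2) * (\<Sum>i\<in>I. (cmod (g i))\<^sup>2)"
    by (rule Cauchy_Schwarz_ineq_sum)
  finally show ?thesis .
qed

lemma cmod_sq_eq: "complex_of_real ((cmod z)\<^sup>2) = cnj z * z"
  by (metis complex_norm_square mult.commute of_real_power)

text \<open>Orthogonal columns of equal squared norm \<open>c\<close> make the kernel a multiple of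
  an isometry; in the expanded square only the diagonal terms survive. The two uses are isometries,
  with \<open>c = 1\<close>, and the sign matrix of the inner product, with
  \<open>c = 2 ^ n\<close>.\<close>

lemma orthogonal_kernel_norm:
  fixes M :: "'i \<Rightarrow> 'j \<Rightarrow> complex"
  assumes J: "finite J"
    and M: "\<And>a b. a \<in> J \<Longrightarrow> b \<in> J \<Longrightarrow> (\<Sum>i\<in>I. cnj (M i a) * M i b) = (if a = b then of_real c else 0)"
  shows "(\<Sum>i\<in>I. (cmod (\<Sum>a\<in>J. M i a * v a))\<^sup>2) = c * (\<Sum>a\<in>J. (cmod (v a))\<^sup>2)"
proof -
  have "complex_of_real (\<Sum>i\<in>I. (cmod (\<Sum>a\<in>J. M i a * v a))\<^sup>2) =
      (\<Sum>i\<in>I. cnj (\<Sum>a\<in>J. M i a * v a) * (\<Sum>a\<in>J. M i a * v a))"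
    unfolding of_real_sum cmod_sq_eq ..
  also have "\<dots> = (\<Sum>i\<in>I. \<Sum>a\<in>J. \<Sum>b\<in>J. (cnj (M i a) * M i b) * (cnj (v a) * v b))"
    unfolding cnj_sum sum_product by (simp add: mult_ac)
  also have "\<dots> = (\<Sum>a\<in>J. \<Sum>b\<in>J. (\<Sum>i\<in>I. cnj (M i a) * M i b) * (cnj (v a) * v b))"
    unfolding sum_distrib_right
    by (subst sum.swap, rule sum.cong[OF refl], subst sum.swap, rule refl)
  also have "\<dots> = (\<Sum>a\<in>J. \<Sum>b\<in>J. (if a = b then of_real c * (cnj (v a) * v b) else 0))"
    by (intro sum.cong refl) (simp add: M)
  also have "\<dots> = (\<Sum>a\<in>J. of_real c * (cnj (v a) * v a))"
    using J by (intro sum.cong refl) (simp add: sum.delta)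
  also have "\<dots> = complex_of_real (c * (\<Sum>a\<in>J. (cmod (v a))\<^sup>2))"
    by (simp only: of_real_mult of_real_sum cmod_sq_eq sum_distrib_left)
  finally show ?thesis by (simp only: of_real_eq_iff)
qed

text \<open>Operator norm at most 1, for kernels over arbitrary index sets: composite indices such
  as a Kraus label paired with an output index then need no numbering.\<close>

definition contraction_on :: "'i set \<Rightarrow> 'j set \<Rightarrow> ('i \<Rightarrow> 'j \<Rightarrow> complex) \<Rightarrow> bool" where
  "contraction_on I J M \<longleftrightarrow>
     (\<forall>v. (\<Sum>i\<in>I. (cmod (\<Sum>j\<in>J. M i j * v j))\<^sup>2) \<le> (\<Sum>j\<in>J. (cmod (v j))\<^sup>2))"

lemma contraction_onD:
  "contraction_on I J M \<Longrightarrow> (\<Sum>i\<in>I. (cmod (\<Sum>j\<in>J. M i j * v j))\<^sup>2) \<le> (\<Sum>j\<in>J. (cmod (v j))\<^sup>2)"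
  by (simp add: contraction_on_def)

lemma isometry_contraction_on:
  assumes "finite J"
    and "\<And>a b. a \<in> J \<Longrightarrow> b \<in> J \<Longrightarrow> (\<Sum>i\<in>I. cnj (M i a) * M i b) = (if a = b then 1 else 0)"
  shows "contraction_on I J M"
  using orthogonal_kernel_norm[of J M I 1] assms by (simp add: contraction_on_def)

text \<open>With \<open>w = M\<dagger> v\<close>, the squared norm of \<open>w\<close> is the inner
  product of \<open>v\<close> with \<open>M w\<close>, hence by Cauchy-Schwarz at most
  \<open>|v| |w|\<close>. Dividing by the norm of \<open>w\<close> is what forces the separate case
  \<open>N = 0\<close>.\<close>

lemma contraction_on_adjoint:
  assumes M: "contraction_on I J M"
  shows "contraction_on J I (\<lambda>j i. cnj (M i j))"
  unfolding contraction_on_def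
proof
  fix v :: "'a \<Rightarrow> complex"
  define w where "w j = (\<Sum>i\<in>I. cnj (M i j) * v i)" for j
  define N where "N = (\<Sum>j\<in>J. (cmod (w j))\<^sup>2)"
  define V where "V = (\<Sum>i\<in>I. (cmod (v i))\<^sup>2)"
  have N0: "0 \<le> N" unfolding N_def by (intro sum_nonneg) simp
  have "complex_of_real N = (\<Sum>j\<in>J. cnj (w j) * w j)"
    unfolding N_def of_real_sum cmod_sq_eq ..
  also have "\<dots> = (\<Sum>i\<in>I. cnj (v i) * (\<Sum>j\<in>J. M i j * w j))"
  proof -
    have "cnj (w j) * w j = (\<Sum>i\<in>I. cnj (v i) * (M i j * w j))" for j
    proof -
      have "cnj (w j) = (\<Sum>i\<in>I. M i j * cnj (v i))" by (simp add: w_def)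
      then show ?thesis by (simp add: sum_distrib_left sum_distrib_right mult_ac)
    qed
    then show ?thesis by (simp add: sum_distrib_left sum.swap[of _ I J])
  qed
  finally have "N\<^sup>2 = (cmod (\<Sum>i\<in>I. cnj (v i) * (\<Sum>j\<in>J. M i j * w j)))\<^sup>2"
    by (metis norm_of_real power2_abs)
  also have "\<dots> \<le> (\<Sum>i\<in>I. (cmod (cnj (v i)))\<^sup>2) * (\<Sum>i\<in>I. (cmod (\<Sum>j\<in>J. M i j * w j))\<^sup>2)"
    by (rule cmod_sum_mult_le)
  also have "\<dots> \<le> V * N"
    unfolding V_def N_def complex_mod_cnj
    by (intro mult_left_mono contraction_onD[OF M] sum_nonneg) simp
  finally have "N * N \<le> V * N" by (simp add: power2_eq_square)
  moreover have "0 \<le> V" unfolding V_def by (intro sum_nonneg) simp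
  ultimately have "N \<le> V" using N0 by (cases "N = 0") auto
  then show "(\<Sum>j\<in>J. (cmod (\<Sum>i\<in>I. cnj (M i j) * v i))\<^sup>2) \<le> (\<Sum>i\<in>I. (cmod (v i))\<^sup>2)"
    by (simp add: N_def V_def w_def)
qed

text \<open>A vector-valued form of Lindsey's lemma. Cauchy-Schwarz over the pairs
  \<open>(x, i)\<close> separates the \<open>x\<close>-side from the rest; then, for each coordinate
  \<open>i\<close>, the orthogonal kernel \<open>s\<close> multiplies the squared norm in
  \<open>y\<close> by exactly \<open>N\<close>. The index set \<open>I\<close> may be as large as
  desired, because only the norms \<open>Cu\<close> and \<open>Cv\<close> enter. \<open>P\<close>
  and \<open>Q\<close> bound the collision probabilities of the sources.\<close>

lemma Lindsey:
  fixes s :: "'x \<Rightarrow> 'y \<Rightarrow> complex" and u :: "'x \<Rightarrow> 'i \<Rightarrow> complex" and v :: "'y \<Rightarrow> 'i \<Rightarrow> complex"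
  assumes fin: "finite Y" and N: "0 \<le> N"
    and s: "\<And>y z. y \<in> Y \<Longrightarrow> z \<in> Y \<Longrightarrow> (\<Sum>x\<in>X. cnj (s x y) * s x z) = (if y = z then of_real N else 0)"
    and u: "\<And>x. x \<in> X \<Longrightarrow> (\<Sum>i\<in>I. (cmod (u x i))\<^sup>2) \<le> Cu"
    and v: "\<And>y. y \<in> Y \<Longrightarrow> (\<Sum>i\<in>I. (cmod (v y i))\<^sup>2) \<le> Cv"
    and p: "(\<Sum>x\<in>X. (p x)\<^sup>2) \<le> P" and q: "(\<Sum>y\<in>Y. (q y)\<^sup>2) \<le> Q"
    and C: "0 \<le> Cu" "0 \<le> Cv"
  shows "(cmod (\<Sum>x\<in>X. \<Sum>y\<in>Y. of_real (p x * q y) * s x y * (\<Sum>i\<in>I. cnj (u x i) * v y i)))\<^sup>2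
    \<le> N * (P * Cu) * (Q * Cv)"
proof -
  have "(\<Sum>x\<in>X. \<Sum>y\<in>Y. of_real (p x * q y) * s x y * (\<Sum>i\<in>I. cnj (u x i) * v y i)) =
     (\<Sum>x\<in>X. \<Sum>i\<in>I. (of_real (p x) * cnj (u x i)) * (\<Sum>y\<in>Y. s x y * (of_real (q y) * v y i)))"
    unfolding sum_distrib_left
    by (rule sum.cong[OF refl], subst sum.swap) (simp add: mult_ac)
  also have "(cmod \<dots>)\<^sup>2 = (cmod (\<Sum>(x, i)\<in>X \<times> I. (of_real (p x) * cnj (u x i)) * (\<Sum>y\<in>Y. s x y * (of_real (q y) * v y i))))\<^sup>2"
    by (simp add: sum.cartesian_product)
  also have "\<dots> \<le> (\<Sum>(x, i)\<in>X \<times> I. (cmod (of_real (p x) * cnj (u x i)))\<^sup>2) *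
      (\<Sum>(x, i)\<in>X \<times> I. (cmod (\<Sum>y\<in>Y. s x y * (of_real (q y) * v y i)))\<^sup>2)"
    using cmod_sum_mult_le[of "\<lambda>(x, i). of_real (p x) * cnj (u x i)"
        "\<lambda>(x, i). \<Sum>y\<in>Y. s x y * (of_real (q y) * v y i)" "X \<times> I"]
    by (simp add: split_def)
  also have "\<dots> \<le> (P * Cu) * (N * (Q * Cv))"
  proof (rule mult_mono)
    have "(\<Sum>(x, i)\<in>X \<times> I. (cmod (of_real (p x) * cnj (u x i)))\<^sup>2) =
        (\<Sum>x\<in>X. (p x)\<^sup>2 * (\<Sum>i\<in>I. (cmod (u x i))\<^sup>2))"
      by (simp add: sum.cartesian_product[symmetric] norm_mult power_mult_distrib sum_distrib_left)
    also have "\<dots> \<le> (\<Sum>x\<in>X. (p x)\<^sup>2 * Cu)"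
      by (intro sum_mono mult_left_mono u) auto
    also have "\<dots> \<le> P * Cu"
      unfolding sum_distrib_right[symmetric] by (rule mult_right_mono[OF p C(1)])
    finally show "(\<Sum>(x, i)\<in>X \<times> I. (cmod (of_real (p x) * cnj (u x i)))\<^sup>2) \<le> P * Cu" .
    have "(\<Sum>(x, i)\<in>X \<times> I. (cmod (\<Sum>y\<in>Y. s x y * (of_real (q y) * v y i)))\<^sup>2) =
       (\<Sum>i\<in>I. \<Sum>x\<in>X. (cmod (\<Sum>y\<in>Y. s x y * (of_real (q y) * v y i)))\<^sup>2)"
      by (simp add: sum.cartesian_product[symmetric] sum.swap[of _ I X])
    also have "\<dots> = (\<Sum>i\<in>I. N * (\<Sum>y\<in>Y. (cmod (of_real (q y) * v y i))\<^sup>2))"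
      by (rule sum.cong[OF refl]) (rule orthogonal_kernel_norm[OF fin s])
    also have "\<dots> = N * (\<Sum>y\<in>Y. (q y)\<^sup>2 * (\<Sum>i\<in>I. (cmod (v y i))\<^sup>2))"
      by (simp add: norm_mult power_mult_distrib sum_distrib_left sum.swap[of _ I Y])
    also have "\<dots> \<le> N * (\<Sum>y\<in>Y. (q y)\<^sup>2 * Cv)"
      by (intro sum_mono mult_left_mono v N) auto
    also have "\<dots> \<le> N * (Q * Cv)"
      unfolding sum_distrib_right[symmetric] by (intro mult_left_mono mult_right_mono q C N)
    finally show "(\<Sum>(x, i)\<in>X \<times> I. (cmod (\<Sum>y\<in>Y. s x y * (of_real (q y) * v y i)))\<^sup>2) \<le> N * (Q * Cv)" .
    have "0 \<le> P" using p sum_nonneg[of X "\<lambda>x. (p x)\<^sup>2"] by force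
    then show "0 \<le> P * Cu" using C by simp
    show "0 \<le> (\<Sum>(x, i)\<in>X \<times> I. (cmod (\<Sum>y\<in>Y. s x y * (of_real (q y) * v y i)))\<^sup>2)"
      by (intro sum_nonneg) auto
  qed
  finally show ?thesis by (simp add: mult_ac)
qed

section \<open>Factorization of bipartite expectation values\<close>

text \<open>A shared state \<open>R R\<^sup>\<dagger>\<close> has the index pair \<open>(a, c)\<close>. The Kraus operators \<open>K\<close> of the party that
  keeps everything map \<open>a\<close> to \<open>\<alpha>\<close>; those of the other party, \<open>L\<close>, map \<open>c\<close> to the stored index \<open>\<beta>\<close>,
  and their label \<open>l\<close> also contains the discarded index. The keeper and storer factors below are
  the two vectors whose inner product is the expectation value of \<open>W\<close>.\<close>

definition keeper_vec where
  "keeper_vec A K R e c k \<alpha> = (\<Sum>a\<in>A. K (k, \<alpha>) a * R a c e)"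

definition storer_vec where
  "storer_vec C L R e a l \<beta> = (\<Sum>c\<in>C. L (l, \<beta>) c * R a c e)"

definition joint_vec where
  "joint_vec A C K L R e k \<alpha> l \<beta> = (\<Sum>a\<in>A. \<Sum>c\<in>C. K (k, \<alpha>) a * L (l, \<beta>) c * R a c e)"

definition keeper_factor where
  "keeper_factor A I\<alpha> Ik K R W \<equiv> \<lambda>(\<beta>', \<beta>, e, a, c).
     (\<Sum>(k, \<alpha>)\<in>Ik \<times> I\<alpha>. cnj (K (k, \<alpha>) a) *
        (\<Sum>\<alpha>'\<in>I\<alpha>. cnj (W (\<alpha>', \<beta>') (\<alpha>, \<beta>)) * keeper_vec A K R e c k \<alpha>'))"

definition storer_factor where
  "storer_factor C Il L R \<equiv> \<lambda>(\<beta>', \<beta>, e, a, c). (\<Sum>l\<in>Il. cnj (L (l, \<beta>') c) * storer_vec C L R e a l \<beta>)"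

text \<open>The two occurrences of the joint vector are expanded in opposite ways: the plain one
  keeps \<open>K\<close> outside and absorbs \<open>L\<close> into \<open>storer_vec\<close>, the
  conjugated one keeps \<open>L\<close> outside and absorbs \<open>K\<close> into
  \<open>keeper_vec\<close>. Then every factor that mentions \<open>k\<close>,
  \<open>\<alpha>\<close> or \<open>\<alpha>'\<close> belongs to the keeper and every factor that
  mentions \<open>l\<close> to the storer. Only \<open>(\<beta>', \<beta>, e, a, c)\<close> is
  shared, and it becomes the coordinate of the inner product. In coordinates this is the passage to
  adjoint channels.\<close>

lemma expectation_factorization:
  fixes K :: "'k \<times> 'r \<Rightarrow> 'a \<Rightarrow> complex" and L :: "'l \<times> 'b \<Rightarrow> 'c \<Rightarrow> complex"
    and R :: "'a \<Rightarrow> 'c \<Rightarrow> 'e \<Rightarrow> complex"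
  shows "(\<Sum>k\<in>Ik. \<Sum>l\<in>Il. \<Sum>e\<in>E. \<Sum>\<alpha>\<in>I\<alpha>. \<Sum>\<beta>\<in>B. \<Sum>\<alpha>'\<in>I\<alpha>. \<Sum>\<beta>'\<in>B.
       joint_vec A C K L R e k \<alpha> l \<beta> * cnj (joint_vec A C K L R e k \<alpha>' l \<beta>') * W (\<alpha>', \<beta>') (\<alpha>, \<beta>)) =
    (\<Sum>i\<in>B \<times> B \<times> E \<times> A \<times> C. cnj (keeper_factor A I\<alpha> Ik K R W i) * storer_factor C Il L R i)"
    (is "?l = ?r")
proof -
  define g where "g \<beta>' \<beta> e a c k \<alpha> \<alpha>' l =
      K (k, \<alpha>) a * W (\<alpha>', \<beta>') (\<alpha>, \<beta>) * cnj (keeper_vec A K R e c k \<alpha>') *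
      (cnj (L (l, \<beta>') c) * storer_vec C L R e a l \<beta>)" for \<beta>' \<beta> e a c k \<alpha> \<alpha>' l
  have j1: "joint_vec A C K L R e k \<alpha> l \<beta> = (\<Sum>a\<in>A. K (k, \<alpha>) a * storer_vec C L R e a l \<beta>)" for e k \<alpha> l \<beta>
    by (simp add: joint_vec_def storer_vec_def sum_distrib_left mult_ac)
  have j2: "cnj (joint_vec A C K L R e k \<alpha> l \<beta>) = (\<Sum>c\<in>C. cnj (L (l, \<beta>) c) * cnj (keeper_vec A K R e c k \<alpha>))" for e k \<alpha> l \<beta>
    unfolding joint_vec_def keeper_vec_def
    by (subst sum.swap) (simp add: sum_distrib_left mult_ac)
  have "?l = (\<Sum>k\<in>Ik. \<Sum>l\<in>Il. \<Sum>e\<in>E. \<Sum>\<alpha>\<in>I\<alpha>. \<Sum>\<beta>\<in>B. \<Sum>\<alpha>'\<in>I\<alpha>. \<Sum>\<beta>'\<in>B. \<Sum>a\<in>A. \<Sum>c\<in>C.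
      g \<beta>' \<beta> e a c k \<alpha> \<alpha>' l)"
    unfolding j2 unfolding j1 sum_product unfolding sum_distrib_right
    by (simp add: g_def mult_ac)
  also have "\<dots> = (\<Sum>(k,l,e,\<alpha>,\<beta>,\<alpha>',\<beta>',a,c)\<in>Ik\<times>Il\<times>E\<times>I\<alpha>\<times>B\<times>I\<alpha>\<times>B\<times>A\<times>C. g \<beta>' \<beta> e a c k \<alpha> \<alpha>' l)"
    by (simp add: sum.cartesian_product split_def)
  also have "\<dots> = (\<Sum>(\<beta>',\<beta>,e,a,c,k,\<alpha>,\<alpha>',l)\<in>B\<times>B\<times>E\<times>A\<times>C\<times>Ik\<times>I\<alpha>\<times>I\<alpha>\<times>Il. g \<beta>' \<beta> e a c k \<alpha> \<alpha>' l)"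
    by (rule sum.reindex_bij_witness[where
        i = "\<lambda>(\<beta>',\<beta>,e,a,c,k,\<alpha>,\<alpha>',l). (k,l,e,\<alpha>,\<beta>,\<alpha>',\<beta>',a,c)" and
        j = "\<lambda>(k,l,e,\<alpha>,\<beta>,\<alpha>',\<beta>',a,c). (\<beta>',\<beta>,e,a,c,k,\<alpha>,\<alpha>',l)"]) auto
  also have "\<dots> = (\<Sum>\<beta>'\<in>B. \<Sum>\<beta>\<in>B. \<Sum>e\<in>E. \<Sum>a\<in>A. \<Sum>c\<in>C. \<Sum>k\<in>Ik. \<Sum>\<alpha>\<in>I\<alpha>. \<Sum>\<alpha>'\<in>I\<alpha>. \<Sum>l\<in>Il. g \<beta>' \<beta> e a c k \<alpha> \<alpha>' l)"
    by (simp add: sum.cartesian_product split_def)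
  also have "\<dots> = (\<Sum>\<beta>'\<in>B. \<Sum>\<beta>\<in>B. \<Sum>e\<in>E. \<Sum>a\<in>A. \<Sum>c\<in>C.
      cnj (keeper_factor A I\<alpha> Ik K R W (\<beta>', \<beta>, e, a, c)) * storer_factor C Il L R (\<beta>', \<beta>, e, a, c))"
    unfolding keeper_factor_def storer_factor_def prod.case sum.cartesian_product[symmetric]
    by (simp add: sum_distrib_left sum_distrib_right g_def mult_ac)
  also have "\<dots> = ?r"
    by (simp add: sum.cartesian_product split_def)
  finally show ?thesis .
qed

lemma sum_reverse3:
  "(\<Sum>a\<in>A. \<Sum>b\<in>B. \<Sum>c\<in>C. f a b c) = (\<Sum>c\<in>C. \<Sum>b\<in>B. \<Sum>a\<in>A. f a b c)"
proof -
  have "(\<Sum>a\<in>A. \<Sum>b\<in>B. \<Sum>c\<in>C. f a b c) = (\<Sum>a\<in>A. \<Sum>c\<in>C. \<Sum>b\<in>B. f a b c)"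
    by (intro sum.cong refl sum.swap)
  also have "\<dots> = (\<Sum>c\<in>C. \<Sum>a\<in>A. \<Sum>b\<in>B. f a b c)"
    by (rule sum.swap)
  also have "\<dots> = (\<Sum>c\<in>C. \<Sum>b\<in>B. \<Sum>a\<in>A. f a b c)"
    by (intro sum.cong refl sum.swap)
  finally show ?thesis .
qed

text \<open>For fixed \<open>\<beta>'\<close>, \<open>e\<close> and \<open>c\<close> the factor
  arises from a column of \<open>R\<close> by \<open>K\<close>, then the adjoint of
  \<open>W\<close>, then the adjoint of \<open>K\<close>, all contractions. The sum over
  \<open>\<beta>\<close> is part of the output of the adjoint of \<open>W\<close> and costs nothing;
  only the outer sum over \<open>\<beta>'\<close> produces \<open>card B\<close>.\<close>

lemma keeper_factor_norm:
  assumes fin: "finite B"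
    and K: "contraction_on (Ik \<times> I\<alpha>) A K"
    and W: "contraction_on (I\<alpha> \<times> B) (I\<alpha> \<times> B) W"
  shows "(\<Sum>i\<in>B \<times> B \<times> E \<times> A \<times> C. (cmod (keeper_factor A I\<alpha> Ik K R W i))\<^sup>2) \<le>
     card B * (\<Sum>a\<in>A. \<Sum>c\<in>C. \<Sum>e\<in>E. (cmod (R a c e))\<^sup>2)"
proof -
  let ?u = "keeper_factor A I\<alpha> Ik K R W"
  let ?y = "keeper_vec A K R"
  have 1: "(\<Sum>\<beta>\<in>B. \<Sum>a\<in>A. (cmod (?u (\<beta>', \<beta>, e, a, c)))\<^sup>2) \<le> (\<Sum>a\<in>A. (cmod (R a c e))\<^sup>2)"
    if \<beta>': "\<beta>' \<in> B" for \<beta>' e c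
  proof -
    define t where "t \<beta> k\<alpha> = (\<Sum>\<alpha>'\<in>I\<alpha>. cnj (W (\<alpha>', \<beta>') (snd k\<alpha>, \<beta>)) * ?y e c (fst k\<alpha>) \<alpha>')" for \<beta> k\<alpha>
    have "(\<Sum>a\<in>A. (cmod (?u (\<beta>', \<beta>, e, a, c)))\<^sup>2) \<le> (\<Sum>k\<alpha>\<in>Ik \<times> I\<alpha>. (cmod (t \<beta> k\<alpha>))\<^sup>2)" for \<beta>
      using contraction_onD[OF contraction_on_adjoint[OF K], of "t \<beta>"]
      by (simp add: keeper_factor_def t_def split_def)
    then have "(\<Sum>\<beta>\<in>B. \<Sum>a\<in>A. (cmod (?u (\<beta>', \<beta>, e, a, c)))\<^sup>2) \<le> (\<Sum>\<beta>\<in>B. \<Sum>k\<alpha>\<in>Ik \<times> I\<alpha>. (cmod (t \<beta> k\<alpha>))\<^sup>2)"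
      by (rule sum_mono)
    also have "\<dots> = (\<Sum>k\<in>Ik. \<Sum>\<alpha>\<in>I\<alpha>. \<Sum>\<beta>\<in>B. (cmod (t \<beta> (k, \<alpha>)))\<^sup>2)"
      by (subst sum.swap) (simp only: sum.cartesian_product')
    also have "\<dots> \<le> (\<Sum>k\<in>Ik. \<Sum>\<alpha>'\<in>I\<alpha>. (cmod (?y e c k \<alpha>'))\<^sup>2)"
    proof (rule sum_mono)
      fix k
      \<comment> \<open>Supporting the input on the single slot \<open>\<beta>'\<close> allows the
        contraction property of the full \<open>W\<close> to bound all output slots
        \<open>\<beta>\<close> at once.\<close>
      define z where "z = (\<lambda>(\<alpha>', b). if b = \<beta>' then ?y e c k \<alpha>' else 0)"
      have "(\<Sum>\<alpha>\<in>I\<alpha>. \<Sum>\<beta>\<in>B. (cmod (t \<beta> (k, \<alpha>)))\<^sup>2) =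
        (\<Sum>i\<in>I\<alpha> \<times> B. (cmod (\<Sum>j\<in>I\<alpha> \<times> B. cnj (W j i) * z j))\<^sup>2)"
        unfolding sum.cartesian_product[symmetric] t_def z_def
          sum.cartesian_product'
        using fin \<beta>' by (simp add: if_distrib sum.delta cong: if_cong)
      also have "\<dots> \<le> (\<Sum>j\<in>I\<alpha> \<times> B. (cmod (z j))\<^sup>2)"
        by (rule contraction_onD[OF contraction_on_adjoint[OF W]])
      also have "\<dots> = (\<Sum>\<alpha>'\<in>I\<alpha>. \<Sum>b\<in>B. if b = \<beta>' then (cmod (?y e c k \<alpha>'))\<^sup>2 else 0)"
        unfolding sum.cartesian_product z_def
        by (rule sum.cong) auto
      also have "\<dots> = (\<Sum>\<alpha>'\<in>I\<alpha>. (cmod (?y e c k \<alpha>'))\<^sup>2)"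
        using fin \<beta>' by simp
      finally show "(\<Sum>\<alpha>\<in>I\<alpha>. \<Sum>\<beta>\<in>B. (cmod (t \<beta> (k, \<alpha>)))\<^sup>2) \<le> (\<Sum>\<alpha>'\<in>I\<alpha>. (cmod (?y e c k \<alpha>'))\<^sup>2)" .
    qed
    also have "\<dots> = (\<Sum>i\<in>Ik \<times> I\<alpha>. (cmod (\<Sum>a\<in>A. K i a * R a c e))\<^sup>2)"
      by (simp add: sum.cartesian_product keeper_vec_def split_def)
    also have "\<dots> \<le> (\<Sum>a\<in>A. (cmod (R a c e))\<^sup>2)"
      by (rule contraction_onD[OF K])
    finally show ?thesis .
  qed
  have "(\<Sum>i\<in>B \<times> B \<times> E \<times> A \<times> C. (cmod (?u i))\<^sup>2) =
     (\<Sum>(\<beta>',\<beta>,e,a,c)\<in>B \<times> B \<times> E \<times> A \<times> C. (cmod (?u (\<beta>',\<beta>,e,a,c)))\<^sup>2)"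
    by (simp add: split_def)
  also have "\<dots> = (\<Sum>(\<beta>',e,c,\<beta>,a)\<in>B \<times> E \<times> C \<times> B \<times> A. (cmod (?u (\<beta>',\<beta>,e,a,c)))\<^sup>2)"
    by (rule sum.reindex_bij_witness[where
        i = "\<lambda>(\<beta>',e,c,\<beta>,a). (\<beta>',\<beta>,e,a,c)" and j = "\<lambda>(\<beta>',\<beta>,e,a,c). (\<beta>',e,c,\<beta>,a)"]) auto
  also have "\<dots> = (\<Sum>\<beta>'\<in>B. \<Sum>e\<in>E. \<Sum>c\<in>C. \<Sum>\<beta>\<in>B. \<Sum>a\<in>A. (cmod (?u (\<beta>',\<beta>,e,a,c)))\<^sup>2)"
    by (simp add: sum.cartesian_product split_def)
  also have "\<dots> \<le> (\<Sum>\<beta>'\<in>B. \<Sum>e\<in>E. \<Sum>c\<in>C. \<Sum>a\<in>A. (cmod (R a c e))\<^sup>2)"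
    by (intro sum_mono 1)
  also have "(\<Sum>e\<in>E. \<Sum>c\<in>C. \<Sum>a\<in>A. (cmod (R a c e))\<^sup>2) = (\<Sum>a\<in>A. \<Sum>c\<in>C. \<Sum>e\<in>E. (cmod (R a c e))\<^sup>2)"
    by (rule sum_reverse3)
  finally show ?thesis by simp
qed

lemma storer_vec_norm:
  assumes L: "contraction_on (Il \<times> B) C L"
  shows "(\<Sum>e\<in>E. \<Sum>a\<in>A. \<Sum>\<beta>\<in>B. \<Sum>l\<in>Il. (cmod (storer_vec C L R e a l \<beta>))\<^sup>2) \<le>
     (\<Sum>a\<in>A. \<Sum>c\<in>C. \<Sum>e\<in>E. (cmod (R a c e))\<^sup>2)"
proof -
  have "(\<Sum>\<beta>\<in>B. \<Sum>l\<in>Il. (cmod (storer_vec C L R e a l \<beta>))\<^sup>2) \<le> (\<Sum>c\<in>C. (cmod (R a c e))\<^sup>2)" for e a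
  proof -
    have "(\<Sum>\<beta>\<in>B. \<Sum>l\<in>Il. (cmod (storer_vec C L R e a l \<beta>))\<^sup>2) =
        (\<Sum>i\<in>Il \<times> B. (cmod (\<Sum>c\<in>C. L i c * R a c e))\<^sup>2)"
      by (subst sum.swap) (simp add: sum.cartesian_product storer_vec_def split_def)
    also have "\<dots> \<le> (\<Sum>c\<in>C. (cmod (R a c e))\<^sup>2)"
      by (rule contraction_onD[OF L])
    finally show ?thesis .
  qed
  then have "(\<Sum>e\<in>E. \<Sum>a\<in>A. \<Sum>\<beta>\<in>B. \<Sum>l\<in>Il. (cmod (storer_vec C L R e a l \<beta>))\<^sup>2) \<le>
     (\<Sum>e\<in>E. \<Sum>a\<in>A. \<Sum>c\<in>C. (cmod (R a c e))\<^sup>2)"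
    by (intro sum_mono)
  also have "\<dots> = (\<Sum>a\<in>A. \<Sum>c\<in>C. \<Sum>e\<in>E. (cmod (R a c e))\<^sup>2)"
    by (subst sum.swap, rule sum.cong[OF refl], rule sum.swap)
  finally show ?thesis .
qed

text \<open>For fixed \<open>\<beta>'\<close> the adjoint of \<open>L\<close>, applied to a vector
  supported on that slot, does not increase the norm, and the sum over \<open>\<beta>\<close> is
  already contained in the norm of \<open>storer_vec\<close>. Again only \<open>\<beta>'\<close> is
  counted.\<close>

lemma storer_factor_norm:
  assumes fin: "finite B" and L: "contraction_on (Il \<times> B) C L"
  shows "(\<Sum>i\<in>B \<times> B \<times> E \<times> A \<times> C. (cmod (storer_factor C Il L R i))\<^sup>2) \<le>
     card B * (\<Sum>a\<in>A. \<Sum>c\<in>C. \<Sum>e\<in>E. (cmod (R a c e))\<^sup>2)"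
proof -
  let ?v = "storer_factor C Il L R"
  have 1: "(\<Sum>c\<in>C. (cmod (?v (\<beta>', \<beta>, e, a, c)))\<^sup>2) \<le> (\<Sum>l\<in>Il. (cmod (storer_vec C L R e a l \<beta>))\<^sup>2)"
    if \<beta>': "\<beta>' \<in> B" for \<beta>' \<beta> e a
  proof -
    define z where "z = (\<lambda>(l, b). if b = \<beta>' then storer_vec C L R e a l \<beta> else 0)"
    have "(\<Sum>c\<in>C. (cmod (?v (\<beta>', \<beta>, e, a, c)))\<^sup>2) = (\<Sum>c\<in>C. (cmod (\<Sum>j\<in>Il \<times> B. cnj (L j c) * z j))\<^sup>2)"
      unfolding z_def sum.cartesian_product' storer_factor_def
      using fin \<beta>' by (simp add: if_distrib sum.delta cong: if_cong)
    also have "\<dots> \<le> (\<Sum>j\<in>Il \<times> B. (cmod (z j))\<^sup>2)"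
      by (rule contraction_onD[OF contraction_on_adjoint[OF L]])
    also have "\<dots> = (\<Sum>l\<in>Il. \<Sum>b\<in>B. if b = \<beta>' then (cmod (storer_vec C L R e a l \<beta>))\<^sup>2 else 0)"
      unfolding sum.cartesian_product z_def by (rule sum.cong) auto
    also have "\<dots> = (\<Sum>l\<in>Il. (cmod (storer_vec C L R e a l \<beta>))\<^sup>2)"
      using fin \<beta>' by simp
    finally show ?thesis .
  qed
  have "(\<Sum>i\<in>B \<times> B \<times> E \<times> A \<times> C. (cmod (?v i))\<^sup>2) =
     (\<Sum>(\<beta>',\<beta>,e,a,c)\<in>B \<times> B \<times> E \<times> A \<times> C. (cmod (?v (\<beta>',\<beta>,e,a,c)))\<^sup>2)"
    by (simp add: split_def)
  also have "\<dots> = (\<Sum>(\<beta>',e,a,\<beta>,c)\<in>B \<times> E \<times> A \<times> B \<times> C. (cmod (?v (\<beta>',\<beta>,e,a,c)))\<^sup>2)"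
    by (rule sum.reindex_bij_witness[where
        i = "\<lambda>(\<beta>',e,a,\<beta>,c). (\<beta>',\<beta>,e,a,c)" and j = "\<lambda>(\<beta>',\<beta>,e,a,c). (\<beta>',e,a,\<beta>,c)"]) auto
  also have "\<dots> = (\<Sum>\<beta>'\<in>B. \<Sum>e\<in>E. \<Sum>a\<in>A. \<Sum>\<beta>\<in>B. \<Sum>c\<in>C. (cmod (?v (\<beta>',\<beta>,e,a,c)))\<^sup>2)"
    by (simp add: sum.cartesian_product split_def)
  also have "\<dots> \<le> (\<Sum>\<beta>'\<in>B. \<Sum>e\<in>E. \<Sum>a\<in>A. \<Sum>\<beta>\<in>B. \<Sum>l\<in>Il. (cmod (storer_vec C L R e a l \<beta>))\<^sup>2)"
    by (intro sum_mono 1)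
  also have "\<dots> \<le> (\<Sum>\<beta>'\<in>B. \<Sum>a\<in>A. \<Sum>c\<in>C. \<Sum>e\<in>E. (cmod (R a c e))\<^sup>2)"
    by (intro sum_mono storer_vec_norm L)
  finally show ?thesis by simp
qed

text \<open>With a single input index, \<open>L\<close> is one column of squared norm at most 1.
  Cauchy-Schwarz over \<open>l\<close> leaves the weight of that column in slot
  \<open>\<beta>'\<close>, and these weights sum to at most 1, so the sum over
  \<open>\<beta>'\<close> no longer costs \<open>card B\<close>.\<close>

lemma storer_factor_norm_trivial_input:
  assumes L: "contraction_on (Il \<times> B) {c0} L"
  shows "(\<Sum>i\<in>B \<times> B \<times> E \<times> A \<times> {c0}. (cmod (storer_factor {c0} Il L R i))\<^sup>2) \<le>
     (\<Sum>a\<in>A. \<Sum>c\<in>{c0}. \<Sum>e\<in>E. (cmod (R a c e))\<^sup>2)"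
proof -
  let ?v = "storer_factor {c0} Il L R"
  let ?N = "\<lambda>e a \<beta>. \<Sum>l\<in>Il. (cmod (storer_vec {c0} L R e a l \<beta>))\<^sup>2"
  have 1: "(\<Sum>\<beta>'\<in>B. (cmod (?v (\<beta>', \<beta>, e, a, c0)))\<^sup>2) \<le> ?N e a \<beta>" for \<beta> e a
  proof -
    have "(\<Sum>\<beta>'\<in>B. (cmod (?v (\<beta>', \<beta>, e, a, c0)))\<^sup>2) \<le>
        (\<Sum>\<beta>'\<in>B. (\<Sum>l\<in>Il. (cmod (L (l, \<beta>') c0))\<^sup>2) * ?N e a \<beta>)"
      unfolding storer_factor_def prod.case
      using cmod_sum_mult_le[of "\<lambda>l. cnj (L (l, _) c0)" _ Il] by (intro sum_mono) simp
    also have "\<dots> = (\<Sum>\<beta>'\<in>B. \<Sum>l\<in>Il. (cmod (L (l, \<beta>') c0))\<^sup>2) * ?N e a \<beta>"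
      by (simp add: sum_distrib_right)
    also have "\<dots> \<le> 1 * ?N e a \<beta>"
    proof (rule mult_right_mono)
      show "(\<Sum>\<beta>'\<in>B. \<Sum>l\<in>Il. (cmod (L (l, \<beta>') c0))\<^sup>2) \<le> 1"
        using contraction_onD[OF L, of "\<lambda>_. 1"]
        by (subst sum.swap) (simp add: sum.cartesian_product split_def)
    qed (auto intro: sum_nonneg)
    finally show ?thesis by simp
  qed
  have "(\<Sum>i\<in>B \<times> B \<times> E \<times> A \<times> {c0}. (cmod (?v i))\<^sup>2) =
     (\<Sum>(\<beta>',\<beta>,e,a,c)\<in>B \<times> B \<times> E \<times> A \<times> {c0}. (cmod (?v (\<beta>',\<beta>,e,a,c)))\<^sup>2)"
    by (simp add: split_def)
  also have "\<dots> = (\<Sum>(e,a,\<beta>,\<beta>')\<in>E \<times> A \<times> B \<times> B. (cmod (?v (\<beta>',\<beta>,e,a,c0)))\<^sup>2)"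
    by (rule sum.reindex_bij_witness[where
        i = "\<lambda>(e,a,\<beta>,\<beta>'). (\<beta>',\<beta>,e,a,c0)" and j = "\<lambda>(\<beta>',\<beta>,e,a,c). (e,a,\<beta>,\<beta>')"]) auto
  also have "\<dots> = (\<Sum>e\<in>E. \<Sum>a\<in>A. \<Sum>\<beta>\<in>B. \<Sum>\<beta>'\<in>B. (cmod (?v (\<beta>',\<beta>,e,a,c0)))\<^sup>2)"
    by (simp add: sum.cartesian_product split_def)
  also have "\<dots> \<le> (\<Sum>e\<in>E. \<Sum>a\<in>A. \<Sum>\<beta>\<in>B. ?N e a \<beta>)"
    by (intro sum_mono 1)
  also have "\<dots> \<le> (\<Sum>a\<in>A. \<Sum>c\<in>{c0}. \<Sum>e\<in>E. (cmod (R a c e))\<^sup>2)"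
    by (rule storer_vec_norm[OF L])
  finally show ?thesis .
qed

section \<open>Spectral decomposition and the trace norm\<close>

lemma mat_adjoint_carrier [simp]: "A \<in> carrier_mat n m \<Longrightarrow> mat_adjoint A \<in> carrier_mat m n"
  by (auto simp: mat_adjoint_def mat_of_rows_def)

lemma dim_mat_adjoint [simp]: "dim_row (mat_adjoint A) = dim_col A" "dim_col (mat_adjoint A) = dim_row A"
  by (auto simp: mat_adjoint_def mat_of_rows_def)

lemma mat_adjoint_index [simp]:
  "i < dim_col A \<Longrightarrow> j < dim_row A \<Longrightarrow> mat_adjoint A $$ (i, j) = cnj (A $$ (j, i))"
  for A :: "complex mat"
  by (simp add: mat_adjoint_def mat_of_rows_def)

lemma index_mult_mat_sum:
  "A \<in> carrier_mat n m \<Longrightarrow> B \<in> carrier_mat m k \<Longrightarrow> i < n \<Longrightarrow> j < k \<Longrightarrow>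
    (A * B) $$ (i, j) = (\<Sum>l<m. A $$ (i, l) * B $$ (l, j))"
  by (auto simp: scalar_prod_def lessThan_atLeast0)

lemma mat_adjoint_mult:
  fixes A B :: "complex mat"
  assumes "A \<in> carrier_mat n m" "B \<in> carrier_mat m k"
  shows "mat_adjoint (A * B) = mat_adjoint B * mat_adjoint A"
proof (rule eq_matI)
  fix i j assume "i < dim_row (mat_adjoint B * mat_adjoint A)" "j < dim_col (mat_adjoint B * mat_adjoint A)"
  then have ij: "i < k" "j < n" using assms by auto
  then show "mat_adjoint (A * B) $$ (i, j) = (mat_adjoint B * mat_adjoint A) $$ (i, j)"
    using assms
    by (subst index_mult_mat_sum[of _ k m _ n])
      (auto simp: index_mult_mat_sum[of _ n m _ k] mult.commute simp del: index_mult_mat(1))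
qed (use assms in auto)

lemma cscalar_prod_adjoint:
  fixes A :: "complex mat"
  assumes "A \<in> carrier_mat n m" "v \<in> carrier_vec m" "w \<in> carrier_vec n"
  shows "(A *\<^sub>v v) \<bullet>c w = v \<bullet>c (mat_adjoint A *\<^sub>v w)"
proof -
  have "(A *\<^sub>v v) \<bullet>c w = (\<Sum>i<n. \<Sum>j<m. A $$ (i, j) * v $ j * cnj (w $ i))"
    using assms by (auto simp: scalar_prod_def lessThan_atLeast0 sum_distrib_right)
  also have "\<dots> = (\<Sum>j<m. \<Sum>i<n. A $$ (i, j) * v $ j * cnj (w $ i))"
    by (rule sum.swap)
  also have "\<dots> = v \<bullet>c (mat_adjoint A *\<^sub>v w)"
    using assms by (auto simp: scalar_prod_def lessThan_atLeast0 sum_distrib_left mult_ac intro!: sum.cong)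
  finally show ?thesis .
qed

section \<open>Diagonalization of Hermitian matrices by deflation\<close>

definition real_diag :: "nat \<Rightarrow> (nat \<Rightarrow> real) \<Rightarrow> complex mat" where
  "real_diag n d = mat n n (\<lambda>(i, j). if i = j then of_real (d i) else 0)"

lemma real_diag_carrier [simp]: "real_diag n d \<in> carrier_mat n n"
  by (simp add: real_diag_def)

text \<open>The Householder reflection exchanging \<open>v\<close> and the \<open>n\<close>-th basis vector; it needs the \<open>n\<close>-th
  entry of \<open>v\<close> to be real, and \<open>r \<le> 0\<close> keeps the two vectors distinct.\<close>

lemma reflection_onto:
  assumes v: "v \<in> carrier_vec m" and n: "n < m"
    and norm: "(\<Sum>i<m. cnj (v $ i) * v $ i) = 1" and vn: "v $ n = of_real r" "r \<le> 0"
  shows "\<exists>W :: complex mat. W \<in> carrier_mat m m \<and> mat_adjoint W = W \<and> W * W = 1\<^sub>m m \<and> col W n = v"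
proof -
  define u where "u i = v $ i - (if i = n then 1 else 0)" for i
  \<comment> \<open>The squared norm of \<open>u\<close> is \<open>2 - 2 * r\<close>, so
    \<open>c\<close> is the usual reflection coefficient 2 divided by that squared norm.\<close>
  define c :: complex where "c = of_real (1 / (1 - r))"
  define W where "W = mat m m (\<lambda>(i, j). (if i = j then 1 else 0) - c * u i * cnj (u j))"
  have W: "W \<in> carrier_mat m m" by (simp add: W_def)
  have r: "of_real (1 - r) \<noteq> (0 :: complex)" using vn(2) by (subst of_real_eq_0_iff) simp
  have S: "c * (\<Sum>j<m. cnj (u j) * u j) = 2"
  proof -
    have "(\<Sum>j<m. cnj (u j) * u j) = (\<Sum>j<m. cnj (v $ j) * v $ j
        - (if j = n then cnj (v $ j) + v $ j - 1 else 0))"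
      by (intro sum.cong refl) (simp add: u_def algebra_simps)
    also have "\<dots> = 2 * of_real (1 - r)"
      using n by (simp add: sum_subtractf norm vn)
    finally show ?thesis using r by (simp add: c_def del: of_real_diff)
  qed
  have "mat_adjoint W = W"
    by (rule eq_matI) (auto simp: W_def c_def)
  moreover have "W * W = 1\<^sub>m m"
  proof (rule eq_matI)
    fix i k assume "i < dim_row (1\<^sub>m m :: complex mat)" "k < dim_col (1\<^sub>m m :: complex mat)"
    then have ik: "i < m" "k < m" by auto
    have "(W * W) $$ (i, k) = (\<Sum>j<m. ((if i = j then 1 else 0) - c * u i * cnj (u j)) *
        ((if j = k then 1 else 0) - c * u j * cnj (u k)))"
      using ik W by (subst index_mult_mat_sum[OF W W]) (auto simp: W_def)
    also have "\<dots> = (\<Sum>j<m. (if i = j then (if j = k then 1 else 0) - c * u j * cnj (u k) else 0)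
        - (if j = k then c * u i * cnj (u j) else 0) + (c * u i * cnj (u k)) * (c * (cnj (u j) * u j)))"
      by (intro sum.cong refl) (auto simp: algebra_simps)
    also have "\<dots> = (if i = k then 1 else 0) - c * u i * cnj (u k) - c * u i * cnj (u k)
        + (c * u i * cnj (u k)) * (c * (\<Sum>j<m. cnj (u j) * u j))"
      unfolding sum.distrib sum_subtractf sum_distrib_left[symmetric]
      using ik by (simp add: sum.delta sum.delta')
    also have "\<dots> = (1\<^sub>m m) $$ (i, k)" unfolding S using ik by simp
    finally show "(W * W) $$ (i, k) = (1\<^sub>m m) $$ (i, k)" .
  qed (simp_all add: W_def)
  moreover have "col W n = v"
  proof (rule eq_vecI)
    fix i assume "i < dim_vec v"
    then have i: "i < m" using v by simp
    have "c * of_real (r - 1) = -1"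
      using r by (simp add: c_def field_simps)
    then have "c * u i * of_real (r - 1) = - u i"
      by (metis mult.commute mult.left_commute mult_minus1)
    moreover have "cnj (u n) = of_real (r - 1)" by (simp add: u_def vn)
    ultimately show "col W n $ i = v $ i"
      using i n by (simp add: W_def u_def)
  qed (use v W in auto)
  ultimately show ?thesis using W by blast
qed

lemma unit_eigenvector:
  fixes A :: "complex mat"
  assumes A: "A \<in> carrier_mat m m" and n: "n < m"
  shows "\<exists>v e r. v \<in> carrier_vec m \<and> A *\<^sub>v v = e \<cdot>\<^sub>v v \<and> (\<Sum>i<m. cnj (v $ i) * v $ i) = 1 \<and>
     v $ n = of_real r \<and> r \<le> 0"
proof -
  from spectrum_non_empty[OF A] n obtain e where "eigenvalue A e" by (auto simp: spectrum_def)
  then obtain w where w: "w \<in> carrier_vec m" "w \<noteq> 0\<^sub>v m" "A *\<^sub>v w = e \<cdot>\<^sub>v w"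
    using A by (auto simp: eigenvalue_def eigenvector_def)
  define N where "N = (\<Sum>i<m. (cmod (w $ i))\<^sup>2)"
  have "N \<noteq> 0"
  proof
    assume "N = 0"
    then have "\<forall>i<m. w $ i = 0" unfolding N_def by (subst (asm) sum_nonneg_eq_0_iff) auto
    then show False using w by (metis carrier_vecD eq_vecI index_zero_vec(1) index_zero_vec(2))
  qed
  moreover have "0 \<le> N" unfolding N_def by (intro sum_nonneg) simp
  ultimately have N: "0 < N" by simp
  \<comment> \<open>The phase turns \<open>w $ n\<close> onto the nonpositive real axis, as the
    reflection requires. A zero entry lies there already, hence the default 1.\<close>
  define ph where "ph = (if w $ n = 0 then 1 else - cnj (w $ n) / of_real (cmod (w $ n)))"
  have ph: "cmod ph = 1" by (simp add: ph_def norm_divide)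
  define c where "c = ph / of_real (sqrt N)"
  have c: "(cmod c)\<^sup>2 = 1 / N" using N by (simp add: c_def norm_divide ph power_divide)
  define v where "v = c \<cdot>\<^sub>v w"
  have "v \<in> carrier_vec m" using w by (simp add: v_def)
  moreover have "A *\<^sub>v v = e \<cdot>\<^sub>v v"
    using A w by (simp add: v_def mult_mat_vec smult_smult_assoc mult.commute)
  moreover have "(\<Sum>i<m. cnj (v $ i) * v $ i) = 1"
  proof -
    have "(\<Sum>i<m. cnj (v $ i) * v $ i) = complex_of_real (\<Sum>i<m. (cmod (c * w $ i))\<^sup>2)"
      unfolding of_real_sum cmod_sq_eq using w by (simp add: v_def)
    also have "(\<Sum>i<m. (cmod (c * w $ i))\<^sup>2) = 1"
      using N by (simp add: norm_mult power_mult_distrib c sum_divide_distrib[symmetric] N_def[symmetric])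
    finally show ?thesis by simp
  qed
  moreover have "v $ n = of_real (- cmod (w $ n) / sqrt N)"
  proof (cases "w $ n = 0")
    case False
    have "cnj (w $ n) * w $ n = of_real (cmod (w $ n)) * of_real (cmod (w $ n))"
      using cmod_sq_eq[of "w $ n"] by (simp add: power2_eq_square)
    then show ?thesis using False w n by (simp add: v_def c_def ph_def field_simps)
  qed (use w n in \<open>simp add: v_def\<close>)
  moreover have "- cmod (w $ n) / sqrt N \<le> 0" using N by simp
  ultimately show ?thesis by blast
qed

text \<open>The reflection \<open>W\<close> moves a unit eigenvector to the last basis vector. In
  \<open>W * A * W\<close> the last column is then zero off the diagonal, and Hermitian symmetry
  clears the last row as well, so the induction continues on the upper left block. The form
  \<open>A * V = V * D\<close> is convenient because it passes through the product
  \<open>W * Z\<close> by associativity alone.\<close>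

lemma hermitian_diagonalization:
  fixes A :: "complex mat"
  assumes "A \<in> carrier_mat n n" "mat_adjoint A = A"
  shows "\<exists>V d. V \<in> carrier_mat n n \<and> mat_adjoint V * V = 1\<^sub>m n \<and> A * V = V * real_diag n d"
  using assms
proof (induction n arbitrary: A)
  case 0
  show ?case by (rule exI[of _ "1\<^sub>m 0"], rule exI[of _ "\<lambda>_. 0"]) (use 0 in \<open>simp add: mat_eq_iff real_diag_def\<close>)
next
  case (Suc n)
  let ?m = "Suc n"
  note A = Suc.prems
  obtain v e r where v: "v \<in> carrier_vec ?m" "A *\<^sub>v v = e \<cdot>\<^sub>v v" "(\<Sum>i<?m. cnj (v $ i) * v $ i) = 1"
     "v $ n = of_real r" "r \<le> 0"
    using unit_eigenvector[OF A(1), of n] by blast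
  obtain W :: "complex mat" where W: "W \<in> carrier_mat ?m ?m" "mat_adjoint W = W" "W * W = 1\<^sub>m ?m" "col W n = v"
    using reflection_onto[OF v(1) _ v(3-5)] by blast
  define B where "B = W * A * W"
  note carr = mult_carrier_mat[of _ ?m ?m _ ?m]
  note assoc = assoc_mult_mat[of _ ?m ?m _ ?m _ ?m] carr
  have WA: "W * A \<in> carrier_mat ?m ?m" by (rule carr[OF W(1) A(1)])
  have B: "B \<in> carrier_mat ?m ?m" unfolding B_def by (rule carr[OF WA W(1)])
  have "W * B = (W * W) * (A * W)"
    unfolding B_def using W(1) A(1) by (simp only: assoc)
  then have AW: "A * W = W * B"
    unfolding W(3) using left_mult_one_mat[OF carr[OF A(1) W(1)]] by simp
  have Bh: "mat_adjoint B = B"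
    unfolding B_def mat_adjoint_mult[OF WA W(1)] mat_adjoint_mult[OF W(1) A(1)] W(2) A(2)
    using W(1) A(1) by (simp only: assoc)
  have colB: "col B n = e \<cdot>\<^sub>v unit_vec ?m n"
  proof -
    have "col B n = W *\<^sub>v (A *\<^sub>v v)"
      unfolding B_def col_mult2[OF WA W(1) lessI] using W(1,4) A(1) v(1)
      by (simp add: assoc_mult_mat_vec[of _ ?m ?m _ ?m])
    also have "\<dots> = e \<cdot>\<^sub>v (W *\<^sub>v v)"
      unfolding v(2) by (rule mult_mat_vec[OF W(1) v(1)])
    also have "W *\<^sub>v v = col (W * W) n"
      unfolding W(4)[symmetric] by (rule col_mult2[OF W(1) W(1) lessI, symmetric])
    also have "\<dots> = unit_vec ?m n" unfolding W(3) by simp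
    finally show ?thesis .
  qed
  have Bin: "B $$ (i, n) = (if i = n then e else 0)" if "i < ?m" for i
  proof -
    have "B $$ (i, n) = col B n $ i" using B that by simp
    then show ?thesis unfolding colB using that by simp
  qed
  have Bni: "B $$ (n, i) = (if i = n then cnj e else 0)" if "i < ?m" for i
  proof -
    have "B $$ (n, i) = mat_adjoint B $$ (n, i)" by (simp add: Bh)
    also have "\<dots> = cnj (B $$ (i, n))" using B that by (subst mat_adjoint_index) auto
    finally show ?thesis using that by (simp add: Bin)
  qed
  \<comment> \<open>The corner entry is read once as part of the last column and once as part of the
    last row; this makes the eigenvalue real, so that \<open>Re e\<close> can extend
    \<open>d\<close>.\<close>
  have "cnj e = e" using Bin[of n] Bni[of n] by simp
  then have e: "e = of_real (Re e)" by (metis Reals_cnj_iff of_real_Re)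
  define B' where "B' = mat n n (\<lambda>ij. B $$ ij)"
  have B': "B' \<in> carrier_mat n n" by (simp add: B'_def)
  have "mat_adjoint B' = B'"
  proof (rule eq_matI)
    fix i j assume "i < dim_row B'" "j < dim_col B'"
    then have ij: "i < n" "j < n" by (auto simp: B'_def)
    have "B $$ (i, j) = mat_adjoint B $$ (i, j)" by (simp add: Bh)
    also have "\<dots> = cnj (B $$ (j, i))" using B ij by (subst mat_adjoint_index) auto
    finally show "mat_adjoint B' $$ (i, j) = B' $$ (i, j)" using ij by (simp add: B'_def)
  qed (simp_all add: B'_def)
  from Suc.IH[OF B' this] obtain V d where V: "V \<in> carrier_mat n n" "mat_adjoint V * V = 1\<^sub>m n"
    and BV: "B' * V = V * real_diag n d" by blast
  define Z where "Z = four_block_mat V (0\<^sub>m n 1) (0\<^sub>m 1 n) (1\<^sub>m 1)"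
  define d' where "d' = d(n := Re e)"
  have Z: "Z \<in> carrier_mat ?m ?m" unfolding Z_def using V(1) by (intro carrier_matI) auto
  have B4: "B = four_block_mat B' (0\<^sub>m n 1) (0\<^sub>m 1 n) (of_real (Re e) \<cdot>\<^sub>m 1\<^sub>m 1)"
    by (rule eq_matI) (use B Bin Bni in \<open>auto simp: B'_def e[symmetric] \<open>cnj e = e\<close> less_Suc_eq\<close>)
  have D4: "real_diag ?m d' = four_block_mat (real_diag n d) (0\<^sub>m n 1) (0\<^sub>m 1 n) (of_real (Re e) \<cdot>\<^sub>m 1\<^sub>m 1)"
    by (rule eq_matI) (auto simp: real_diag_def d'_def less_Suc_eq)
  have "B * Z = four_block_mat (B' * V) (0\<^sub>m n 1) (0\<^sub>m 1 n) (of_real (Re e) \<cdot>\<^sub>m 1\<^sub>m 1)"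
    unfolding B4 Z_def using V B'
    by (subst mult_four_block_mat[of _ n n _ 1 _ 1 _ _ n _ 1]) auto
  moreover have "Z * real_diag ?m d' = four_block_mat (V * real_diag n d) (0\<^sub>m n 1) (0\<^sub>m 1 n) (of_real (Re e) \<cdot>\<^sub>m 1\<^sub>m 1)"
    unfolding D4 Z_def using V left_mult_zero_mat[OF real_diag_carrier, of 1 n d]
    by (subst mult_four_block_mat[of _ n n _ 1 _ 1 _ _ n _ 1]) auto
  ultimately have BZ: "B * Z = Z * real_diag ?m d'" by (simp add: BV)
  have aZ: "mat_adjoint Z = four_block_mat (mat_adjoint V) (0\<^sub>m n 1) (0\<^sub>m 1 n) (1\<^sub>m 1)"
    by (rule eq_matI) (use V in \<open>auto simp: Z_def less_Suc_eq\<close>)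
  have ZZ: "mat_adjoint Z * Z = 1\<^sub>m ?m"
    unfolding aZ unfolding Z_def using V
    by (subst mult_four_block_mat[of _ n n _ 1 _ 1 _ _ n _ 1]) (auto intro!: eq_matI)
  have WZ: "W * Z \<in> carrier_mat ?m ?m" by (rule carr[OF W(1) Z])
  have "mat_adjoint (W * Z) * (W * Z) = mat_adjoint Z * (W * W) * Z"
    unfolding mat_adjoint_mult[OF W(1) Z] W(2) using W(1) Z mat_adjoint_carrier[OF Z] by (simp only: assoc)
  then have "mat_adjoint (W * Z) * (W * Z) = 1\<^sub>m ?m"
    unfolding W(3) using right_mult_one_mat[OF mat_adjoint_carrier[OF Z]] by (simp add: ZZ)
  moreover have "A * (W * Z) = W * Z * real_diag ?m d'"
  proof -
    have "A * (W * Z) = (A * W) * Z" using A(1) W(1) Z by (simp only: assoc)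
    also have "\<dots> = W * (B * Z)" unfolding AW using B W(1) Z by (simp only: assoc)
    also have "\<dots> = W * Z * real_diag ?m d'" unfolding BZ using W(1) Z real_diag_carrier[of ?m d']
      by (simp only: assoc)
    finally show ?thesis .
  qed
  ultimately show ?case using WZ by blast
qed

text \<open>Functional calculus in the eigenbasis \<open>V\<close>: sign, absolute value and
  identity of a matrix are obtained by changing \<open>f\<close>, and products become
  pointwise.\<close>

definition spectral_mat :: "nat \<Rightarrow> complex mat \<Rightarrow> (nat \<Rightarrow> real) \<Rightarrow> complex mat" where
  "spectral_mat n V f = V * real_diag n f * mat_adjoint V"

lemma spectral_mat_carrier [simp]: "V \<in> carrier_mat n n \<Longrightarrow> spectral_mat n V f \<in> carrier_mat n n"
  by (auto simp: spectral_mat_def intro!: mult_carrier_mat[of _ n n])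

lemma spectral_mat_index:
  assumes V: "V \<in> carrier_mat n n" and ij: "i < n" "j < n"
  shows "spectral_mat n V f $$ (i, j) = (\<Sum>e<n. V $$ (i, e) * of_real (f e) * cnj (V $$ (j, e)))"
proof -
  have 1: "(V * real_diag n f) $$ (i, e) = V $$ (i, e) * of_real (f e)" if "e < n" for e
    using that ij V
    by (subst index_mult_mat_sum[OF V real_diag_carrier]) (auto simp: real_diag_def if_distrib sum.delta cong: if_cong)
  show ?thesis
    unfolding spectral_mat_def using V ij 1
    by (subst index_mult_mat_sum[of _ n n _ n]) (auto simp del: index_mult_mat(1) intro!: sum.cong)
qed

lemma mat_adjoint_spectral_mat:
  assumes V: "V \<in> carrier_mat n n"
  shows "mat_adjoint (spectral_mat n V f) = spectral_mat n V f"
  by (rule eq_matI) (use carrier_matD[OF spectral_mat_carrier[OF V]] in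
      \<open>auto simp: spectral_mat_index[OF V] mult_ac\<close>)

lemma spectral_mat_mult:
  assumes V: "V \<in> carrier_mat n n" "mat_adjoint V * V = 1\<^sub>m n"
  shows "spectral_mat n V f * spectral_mat n V g = spectral_mat n V (\<lambda>i. f i * g i)"
proof -
  have aV: "mat_adjoint V \<in> carrier_mat n n" using V by simp
  have D: "real_diag n f * real_diag n g = real_diag n (\<lambda>i. f i * g i)"
    by (rule eq_matI)
      (auto simp: index_mult_mat_sum[of _ n n _ n] real_diag_def if_distrib sum.delta cong: if_cong
        simp del: index_mult_mat(1))
  have "spectral_mat n V f * spectral_mat n V g =
      V * (real_diag n f * ((mat_adjoint V * V) * (real_diag n g * mat_adjoint V)))"
    unfolding spectral_mat_def using V(1) aV
    by (simp only: assoc_mult_mat[of _ n n _ n _ n] mult_carrier_mat[of _ n n _ n] real_diag_carrier)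
  also have "\<dots> = V * (real_diag n f * (real_diag n g * mat_adjoint V))"
    unfolding V(2) using aV by (simp add: left_mult_one_mat[of _ n n] mult_carrier_mat[of _ n n _ n])
  also have "\<dots> = spectral_mat n V (\<lambda>i. f i * g i)"
    unfolding spectral_mat_def D[symmetric] using V aV
    by (simp only: assoc_mult_mat[of _ n n _ n _ n] mult_carrier_mat[of _ n n _ n] real_diag_carrier)
  finally show ?thesis .
qed

lemma unitary_right_inverse:
  fixes V :: "complex mat"
  assumes "V \<in> carrier_mat n n" "mat_adjoint V * V = 1\<^sub>m n"
  shows "V * mat_adjoint V = 1\<^sub>m n"
  using assms mat_mult_left_right_inverse[of "mat_adjoint V" n V] by simp

lemma spectral_mat_one:
  assumes V: "V \<in> carrier_mat n n" "mat_adjoint V * V = 1\<^sub>m n"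
  shows "spectral_mat n V (\<lambda>_. 1) = 1\<^sub>m n"
proof -
  have "real_diag n (\<lambda>_. 1) = 1\<^sub>m n" by (rule eq_matI) (auto simp: real_diag_def)
  then show ?thesis using V unitary_right_inverse[OF V] by (simp add: spectral_mat_def)
qed

lemma hermitian_spectral_mat:
  fixes A :: "complex mat"
  assumes A: "A \<in> carrier_mat n n" "mat_adjoint A = A"
  obtains V d where "V \<in> carrier_mat n n" "mat_adjoint V * V = 1\<^sub>m n" "A * V = V * real_diag n d"
    "A = spectral_mat n V d"
proof -
  from hermitian_diagonalization[OF A] obtain V d where
    V: "V \<in> carrier_mat n n" "mat_adjoint V * V = 1\<^sub>m n" "A * V = V * real_diag n d" by blast
  have "spectral_mat n V d = A * (V * mat_adjoint V)"
    unfolding spectral_mat_def V(3)[symmetric] using A V(1) by (simp add: assoc_mult_mat[of _ n n _ n _ n])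
  also have "\<dots> = A" using A unitary_right_inverse[OF V(1,2)] by simp
  finally show ?thesis using that V by metis
qed

section \<open>Positive semidefinite matrices\<close>

lemma cscalar_prod_sum:
  fixes A :: "complex mat"
  assumes "A \<in> carrier_mat n n" "v \<in> carrier_vec n"
  shows "(A *\<^sub>v v) \<bullet>c v = (\<Sum>i<n. \<Sum>j<n. A $$ (i, j) * v $ j * cnj (v $ i))"
  using assms by (auto simp: scalar_prod_def lessThan_atLeast0 sum_distrib_right)

text \<open>Polarization: the quadratic form is real on all combinations of two basis vectors with
  coefficients 1 and \<open>z\<close>. The choice \<open>z = 1\<close> compares the imaginary parts
  of the entries \<open>(i, j)\<close> and \<open>(j, i)\<close>, the imaginary unit their real
  parts.\<close>

lemma psd_mat_adjoint:
  assumes "psd_mat n A"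
  shows "mat_adjoint A = A"
proof -
  have A: "A \<in> carrier_mat n n" and pos: "\<And>v. v \<in> carrier_vec n \<Longrightarrow> 0 \<le> (A *\<^sub>v v) \<bullet>c v"
    using assms by (auto simp: psd_mat_def)
  have form: "Im (A $$ (i, i) + A $$ (i, j) * z + A $$ (j, i) * cnj z + A $$ (j, j) * (z * cnj z)) = 0"
    if ij: "i < n" "j < n" for i j z
  proof -
    \<comment> \<open>Adding the two cases instead of nesting them gives the entry
      \<open>1 + z\<close> when \<open>i = j\<close>, so the expansion also holds on the
      diagonal.\<close>
    define v where "v = vec n (\<lambda>k. (if k = i then 1 else 0) + (if k = j then z else 0))"
    have v: "v \<in> carrier_vec n" by (simp add: v_def)
    have "(A *\<^sub>v v) \<bullet>c v = (\<Sum>k<n. \<Sum>l<n. A $$ (k, l) * v $ l * cnj (v $ k))"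
      by (rule cscalar_prod_sum[OF A v])
    also have "\<dots> = (\<Sum>k<n. (A $$ (k, i) + A $$ (k, j) * z) * cnj (v $ k))"
    proof (rule sum.cong[OF refl])
      fix k
      have "(\<Sum>l<n. A $$ (k, l) * v $ l) = (\<Sum>l<n. (if l = i then A $$ (k, l) else 0) + (if l = j then A $$ (k, l) * z else 0))"
        by (rule sum.cong[OF refl]) (simp add: v_def distrib_left)
      then show "(\<Sum>l<n. A $$ (k, l) * v $ l * cnj (v $ k)) = (A $$ (k, i) + A $$ (k, j) * z) * cnj (v $ k)"
        using ij by (simp add: sum.distrib sum_distrib_right[symmetric])
    qed
    also have "\<dots> = (\<Sum>k<n. (if k = i then A $$ (k, i) + A $$ (k, j) * z else 0)
        + (if k = j then (A $$ (k, i) + A $$ (k, j) * z) * cnj z else 0))"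
      by (rule sum.cong[OF refl]) (simp add: v_def distrib_left)
    also have "\<dots> = A $$ (i, i) + A $$ (i, j) * z + A $$ (j, i) * cnj z + A $$ (j, j) * (z * cnj z)"
      using ij by (simp add: sum.distrib algebra_simps)
    finally show ?thesis using pos[OF v] by (simp add: less_eq_complex_def)
  qed
  have diag: "Im (A $$ (i, i)) = 0" if "i < n" for i using form[OF that that, of 0] by simp
  show ?thesis
  proof (rule eq_matI)
    fix i j assume "i < dim_row A" "j < dim_col A"
    then have ij: "i < n" "j < n" using A by auto
    show "mat_adjoint A $$ (i, j) = A $$ (i, j)"
      using form[OF ij, of 1] form[OF ij, of \<i>] ij A diag[OF ij(1)] diag[OF ij(2)]
      by (simp add: complex_eq_iff)
  qed (use A in auto)
qed

lemma psd_matI_factor: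
  assumes A: "A \<in> carrier_mat n n"
    and R: "\<And>i j. i < n \<Longrightarrow> j < n \<Longrightarrow> A $$ (i, j) = (\<Sum>e\<in>E. R i e * cnj (R j e))"
  shows "psd_mat n A"
  unfolding psd_mat_def
proof (intro conjI A ballI)
  fix v :: "complex vec" assume v: "v \<in> carrier_vec n"
  have "(A *\<^sub>v v) \<bullet>c v = (\<Sum>i<n. \<Sum>j<n. \<Sum>e\<in>E. R i e * cnj (R j e) * v $ j * cnj (v $ i))"
    unfolding cscalar_prod_sum[OF A v] by (intro sum.cong refl) (simp add: R sum_distrib_right)
  also have "\<dots> = (\<Sum>e\<in>E. \<Sum>i<n. \<Sum>j<n. R i e * cnj (R j e) * v $ j * cnj (v $ i))"
    by (simp only: sum.swap[of _ E "{..<n}"])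
  also have "\<dots> = (\<Sum>e\<in>E. cnj (\<Sum>i<n. cnj (R i e) * v $ i) * (\<Sum>j<n. cnj (R j e) * v $ j))"
    unfolding cnj_sum sum_product by (simp add: mult_ac)
  also have "\<dots> = complex_of_real (\<Sum>e\<in>E. (cmod (\<Sum>j<n. cnj (R j e) * v $ j))\<^sup>2)"
    unfolding of_real_sum cmod_sq_eq ..
  also have "0 \<le> \<dots>"
    by (simp add: less_eq_complex_def sum_nonneg)
  finally show "0 \<le> (A *\<^sub>v v) \<bullet>c v" .
qed

lemma psd_spectral_mat:
  assumes V: "V \<in> carrier_mat n n" and f: "\<And>i. i < n \<Longrightarrow> 0 \<le> f i"
  shows "psd_mat n (spectral_mat n V f)"
proof (rule psd_matI_factor[where E = "{..<n}" and R = "\<lambda>i e. V $$ (i, e) * of_real (sqrt (f e))"])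
  fix i j assume ij: "i < n" "j < n"
  show "spectral_mat n V f $$ (i, j) = (\<Sum>e<n. V $$ (i, e) * of_real (sqrt (f e)) * cnj (V $$ (j, e) * of_real (sqrt (f e))))"
    unfolding spectral_mat_index[OF V ij]
  proof (rule sum.cong[OF refl])
    fix e assume "e \<in> {..<n}"
    then have "complex_of_real (f e) = of_real (sqrt (f e)) * of_real (sqrt (f e))"
      using f[of e] by (simp flip: of_real_mult)
    then show "V $$ (i, e) * of_real (f e) * cnj (V $$ (j, e)) = V $$ (i, e) * of_real (sqrt (f e)) * cnj (V $$ (j, e) * of_real (sqrt (f e)))"
      by simp
  qed
qed (use V in simp)

lemma col_eigen:
  fixes A :: "complex mat"
  assumes A: "A \<in> carrier_mat n n" and V: "V \<in> carrier_mat n n" "mat_adjoint V * V = 1\<^sub>m n" "A * V = V * real_diag n d"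
    and i: "i < n"
  shows "A *\<^sub>v col V i = of_real (d i) \<cdot>\<^sub>v col V i" "col V i \<bullet>c col V i = 1"
proof -
  have "A *\<^sub>v col V i = col (V * real_diag n d) i"
    unfolding V(3)[symmetric] by (rule col_mult2[OF A V(1) i, symmetric])
  also have "\<dots> = of_real (d i) \<cdot>\<^sub>v col V i"
  proof (rule eq_vecI)
    fix j assume "j < dim_vec (of_real (d i) \<cdot>\<^sub>v col V i)"
    then have j: "j < n" using V by simp
    have "col (V * real_diag n d) i $ j = (V * real_diag n d) $$ (j, i)"
      using V i j by (simp add: real_diag_def)
    also have "\<dots> = (\<Sum>l<n. V $$ (j, l) * real_diag n d $$ (l, i))"
      using V i j by (subst index_mult_mat_sum[of _ n n _ n]) auto
    also have "\<dots> = of_real (d i) * V $$ (j, i)"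
      using i by (simp add: real_diag_def if_distrib cong: if_cong)
    finally show "col (V * real_diag n d) i $ j = (of_real (d i) \<cdot>\<^sub>v col V i) $ j"
      using V i j by simp
  qed (use V in \<open>simp add: real_diag_def\<close>)
  finally show "A *\<^sub>v col V i = of_real (d i) \<cdot>\<^sub>v col V i" .
  have "col V i \<bullet>c col V i = (mat_adjoint V * V) $$ (i, i)"
    using V(1) i by (subst index_mult_mat_sum[of _ n n _ n]) (auto simp: scalar_prod_def lessThan_atLeast0 mult.commute)
  then show "col V i \<bullet>c col V i = 1" using V(2) i by simp
qed

text \<open>The factor is \<open>V\<close> with its columns scaled by the square roots of the
  eigenvalues. For a density matrix, reading \<open>e\<close> as the index of an additional system
  turns \<open>R\<close> into a purification; this is the role of \<open>e\<close> in all later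
  sums.\<close>

lemma psd_mat_factor:
  assumes A: "psd_mat n A"
  obtains R :: "nat \<Rightarrow> nat \<Rightarrow> complex" where "\<And>i j. i < n \<Longrightarrow> j < n \<Longrightarrow> A $$ (i, j) = (\<Sum>e<n. R i e * cnj (R j e))"
proof -
  have Ac: "A \<in> carrier_mat n n" using A by (simp add: psd_mat_def)
  obtain V d where V: "V \<in> carrier_mat n n" "mat_adjoint V * V = 1\<^sub>m n" "A * V = V * real_diag n d"
    and eq: "A = spectral_mat n V d"
    using hermitian_spectral_mat[OF Ac psd_mat_adjoint[OF A]] by blast
  have d: "0 \<le> d e" if "e < n" for e
  proof -
    have "0 \<le> (A *\<^sub>v col V e) \<bullet>c col V e" using A V that by (simp add: psd_mat_def)
    also have "\<dots> = of_real (d e) * (col V e \<bullet>c col V e)"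
      unfolding col_eigen(1)[OF Ac V that] using V by simp
    finally show ?thesis unfolding col_eigen(2)[OF Ac V that] by (simp add: less_eq_complex_def)
  qed
  show ?thesis
  proof (rule that[of "\<lambda>i e. V $$ (i, e) * of_real (sqrt (d e))"])
    fix i j assume ij: "i < n" "j < n"
    show "A $$ (i, j) = (\<Sum>e<n. V $$ (i, e) * of_real (sqrt (d e)) * cnj (V $$ (j, e) * of_real (sqrt (d e))))"
      unfolding eq spectral_mat_index[OF V(1) ij]
    proof (rule sum.cong[OF refl])
      fix e assume "e \<in> {..<n}"
      then have "complex_of_real (d e) = of_real (sqrt (d e)) * of_real (sqrt (d e))"
        using d[of e] by (simp flip: of_real_mult)
      then show "V $$ (i, e) * of_real (d e) * cnj (V $$ (j, e)) = V $$ (i, e) * of_real (sqrt (d e)) * cnj (V $$ (j, e) * of_real (sqrt (d e)))"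
        by simp
    qed
  qed
qed

lemma psd_sqrt_unique:
  assumes B: "psd_mat n B" and C: "psd_mat n C" and eq: "B * B = C * C"
  shows "B = C"
proof -
  have Bc: "B \<in> carrier_mat n n" "mat_adjoint B = B" and Cc: "C \<in> carrier_mat n n" "mat_adjoint C = C"
    using B C by (auto simp: psd_mat_def psd_mat_adjoint)
  have D: "B - C \<in> carrier_mat n n" using Cc(1) by (rule minus_carrier_mat)
  have "mat_adjoint (B - C) = B - C"
  proof (rule eq_matI)
    fix i j assume "i < dim_row (B - C)" "j < dim_col (B - C)"
    then have ij: "i < n" "j < n" using Cc by auto
    have "mat_adjoint B $$ (i, j) = B $$ (i, j)" "mat_adjoint C $$ (i, j) = C $$ (i, j)"
      using Bc Cc by auto
    then show "mat_adjoint (B - C) $$ (i, j) = (B - C) $$ (i, j)"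
      using ij Bc(1) Cc(1) by simp
  qed (use Bc(1) Cc(1) in auto)
  from hermitian_spectral_mat[OF D this] obtain V d where
    V: "V \<in> carrier_mat n n" "mat_adjoint V * V = 1\<^sub>m n" "(B - C) * V = V * real_diag n d"
    and sp: "B - C = spectral_mat n V d" by blast
  \<comment> \<open>For an eigenvector \<open>v\<close> of \<open>B - C\<close>, expand \<open>Re \<langle>B v + C v, B v - C v\<rangle> = |B v|\<^sup>2 - |C v|\<^sup>2 = 0\<close>.\<close>
  have d0: "d e = 0" if e: "e < n" for e
  proof (rule ccontr)
    assume de: "d e \<noteq> 0"
    define v where "v = col V e"
    define a where "a = B *\<^sub>v v"
    define b where "b = C *\<^sub>v v"
    have v: "v \<in> carrier_vec n" using V(1) by (auto simp: v_def intro!: carrier_vecI)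
    have ab: "a \<in> carrier_vec n" "b \<in> carrier_vec n" using Bc Cc v by (auto simp: a_def b_def)
    have diff: "a - b = of_real (d e) \<cdot>\<^sub>v v"
      using col_eigen(1)[OF D V e] Bc Cc v by (simp add: a_def b_def v_def minus_mult_distrib_mat_vec[of _ n n])
    have "a \<bullet>c a = (B * B *\<^sub>v v) \<bullet>c v"
      using cscalar_prod_adjoint[OF Bc(1) ab(1) v] Bc v by (simp add: a_def assoc_mult_mat_vec[of _ n n _ n])
    moreover have "b \<bullet>c b = (C * C *\<^sub>v v) \<bullet>c v"
      using cscalar_prod_adjoint[OF Cc(1) ab(2) v] Cc v by (simp add: b_def assoc_mult_mat_vec[of _ n n _ n])
    ultimately have aabb: "a \<bullet>c a = b \<bullet>c b" by (simp add: eq)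
    have pa: "0 \<le> a \<bullet>c v" using B v by (simp add: psd_mat_def a_def)
    have pb: "0 \<le> b \<bullet>c v" using C v by (simp add: psd_mat_def b_def)
    have ev: "a $ i - b $ i = of_real (d e) * v $ i" if "i < n" for i
      using arg_cong[OF diff, of "\<lambda>x. x $ i"] that v ab by simp
    have ip: "x \<bullet>c y = (\<Sum>i<n. x $ i * cnj (y $ i))" if "y \<in> carrier_vec n" for x y :: "complex vec"
      using that by (auto simp: scalar_prod_def lessThan_atLeast0)
    have "of_real (d e) * (a \<bullet>c v + b \<bullet>c v) = (\<Sum>i<n. (a $ i + b $ i) * cnj (of_real (d e) * v $ i))"
      unfolding ip[OF v] sum.distrib[symmetric] sum_distrib_left
      by (intro sum.cong refl) (simp add: algebra_simps)
    also have "\<dots> = (\<Sum>i<n. (a $ i + b $ i) * cnj (a $ i - b $ i))"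
      by (intro sum.cong refl) (simp add: ev)
    also have "\<dots> = a \<bullet>c a - b \<bullet>c b + (\<Sum>i<n. b $ i * cnj (a $ i) - a $ i * cnj (b $ i))"
      unfolding ip[OF ab(1)] ip[OF ab(2)] sum_subtractf[symmetric] sum.distrib[symmetric]
      by (intro sum.cong refl) (simp add: algebra_simps)
    finally have "of_real (d e) * (a \<bullet>c v + b \<bullet>c v) = (\<Sum>i<n. b $ i * cnj (a $ i) - a $ i * cnj (b $ i))"
      unfolding aabb by simp
    moreover have "Re (\<Sum>i<n. b $ i * cnj (a $ i) - a $ i * cnj (b $ i)) = 0"
      unfolding Re_sum by (intro sum.neutral ballI) simp
    ultimately have "Re (of_real (d e) * (a \<bullet>c v + b \<bullet>c v)) = 0" by (simp only:)
    \<comment> \<open>Both summands are nonnegative and hence vanish, whereas their difference is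
      the eigenvalue \<open>d e\<close>, because \<open>v\<close> is a unit vector.\<close>
    then have "Re (a \<bullet>c v) + Re (b \<bullet>c v) = 0" using de by simp
    then have ab0: "Re (a \<bullet>c v) = 0" "Re (b \<bullet>c v) = 0"
      using pa pb by (auto simp: less_eq_complex_def add_nonneg_eq_0_iff)
    have "a \<bullet>c v - b \<bullet>c v = of_real (d e) * (v \<bullet>c v)"
      unfolding ip[OF v] sum_subtractf[symmetric] sum_distrib_left
      by (intro sum.cong refl) (simp add: left_diff_distrib[symmetric] ev)
    moreover have "v \<bullet>c v = 1" unfolding v_def by (rule col_eigen(2)[OF D V e])
    ultimately have "a \<bullet>c v - b \<bullet>c v = of_real (d e)" by simp
    then have "Re (a \<bullet>c v) - Re (b \<bullet>c v) = d e" by (metis Re_complex_of_real minus_complex.simps(1))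
    then show False using ab0 de by simp
  qed
  have "(B - C) $$ (i, j) = 0" if "i < n" "j < n" for i j
    unfolding sp spectral_mat_index[OF V(1) that] by (simp add: d0)
  then show ?thesis using Bc(1) Cc(1) by (intro eq_matI) auto
qed

section \<open>Square roots and duality for the trace norm\<close>

text \<open>Uniqueness resolves the definite description, so evaluating a trace norm only requires
  exhibiting a positive root; for a Hermitian matrix this is its absolute value in an
  eigenbasis.\<close>

lemma mat_sqrt_eqI:
  assumes "psd_mat n B"
  shows "mat_sqrt (B * B) = B"
proof -
  have "dim_row (B * B) = n" using assms by (auto simp: psd_mat_def)
  then show ?thesis unfolding mat_sqrt_def
    using assms psd_sqrt_unique by (intro the_equality) auto
qed

text \<open>The sign of a Hermitian matrix attains the supremum in the dual characterization of the trace norm.\<close>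

lemma tr_norm_dual:
  assumes H: "H \<in> carrier_mat n n" "mat_adjoint H = H"
  obtains U where "U \<in> carrier_mat n n" "contraction_on {..<n} {..<n} (\<lambda>i j. U $$ (i, j))"
    "tr_norm H = 1 / 2 * Re (mat_trace (H * U))"
proof -
  obtain V d where V: "V \<in> carrier_mat n n" "mat_adjoint V * V = 1\<^sub>m n" and eq: "H = spectral_mat n V d"
    using hermitian_spectral_mat[OF H] by blast
  \<comment> \<open>The sign of 0 is taken to be 1 and not 0: then \<open>U * U\<close> is the
    identity and \<open>U\<close> an isometry even if \<open>H\<close> is singular.\<close>
  define s where "s i = (if 0 \<le> d i then 1 else - 1 :: real)" for i
  define U where "U = spectral_mat n V s"
  have U: "U \<in> carrier_mat n n" using V by (simp add: U_def)
  have "U * U = spectral_mat n V (\<lambda>_. 1)"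
    unfolding U_def spectral_mat_mult[OF V] by (rule arg_cong[of _ _ "spectral_mat n V"]) (auto simp: s_def)
  then have UU: "U * U = 1\<^sub>m n" unfolding spectral_mat_one[OF V] .
  have "contraction_on {..<n} {..<n} (\<lambda>i j. U $$ (i, j))"
  proof (rule isometry_contraction_on)
    fix a b assume ab: "a \<in> {..<n}" "b \<in> {..<n}"
    have "(\<Sum>i<n. cnj (U $$ (i, a)) * U $$ (i, b)) = (\<Sum>i<n. mat_adjoint U $$ (a, i) * U $$ (i, b))"
      using U ab by (intro sum.cong refl) simp
    also have "\<dots> = (U * U) $$ (a, b)"
      using U ab by (subst index_mult_mat_sum[OF U U]) (auto simp: U_def mat_adjoint_spectral_mat[OF V(1)])
    finally show "(\<Sum>i<n. cnj (U $$ (i, a)) * U $$ (i, b)) = (if a = b then 1 else 0)"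
      using ab by (simp add: UU)
  qed simp
  moreover have "tr_norm H = 1 / 2 * Re (mat_trace (H * U))"
  proof -
    have HU: "H * U = spectral_mat n V (\<lambda>i. \<bar>d i\<bar>)"
      unfolding eq U_def spectral_mat_mult[OF V] by (rule arg_cong[of _ _ "spectral_mat n V"]) (auto simp: s_def)
    have "mat_adjoint H * H = spectral_mat n V (\<lambda>i. \<bar>d i\<bar>) * spectral_mat n V (\<lambda>i. \<bar>d i\<bar>)"
      unfolding H(2) unfolding eq spectral_mat_mult[OF V] by simp
    then have "mat_sqrt (mat_adjoint H * H) = H * U"
      unfolding HU using mat_sqrt_eqI[OF psd_spectral_mat[OF V(1), of "\<lambda>i. \<bar>d i\<bar>"]] by simp
    then show ?thesis by (simp add: tr_norm_def)
  qed
  ultimately show ?thesis using that U by blast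
qed

section \<open>Local operations\<close>

lemma sum_lessThan_mult:
  fixes f :: "nat \<Rightarrow> 'a :: comm_monoid_add"
  shows "(\<Sum>i<m * n. f i) = (\<Sum>a<m. \<Sum>b<n. f (a * n + b))"
proof -
  have "(\<Sum>i<m * n. f i) = (\<Sum>a<m. sum f {a * n..<a * n + n})"
    by (rule sum.nat_group[symmetric])
  also have "\<dots> = (\<Sum>a<m. \<Sum>b<n. f (a * n + b))"
    by (rule sum.cong[OF refl], subst sum.atLeastLessThan_shift_0) (simp add: lessThan_atLeast0 comp_def)
  finally show ?thesis .
qed

lemma mult_add_less: "a < m \<Longrightarrow> b < n \<Longrightarrow> a * n + b < m * (n :: nat)"
  using mult_le_mono1[of "Suc a" m n] by simp

lemma mult_add_eq_iff:
  "b < n \<Longrightarrow> b' < n \<Longrightarrow> a * n + b = a' * n + b' \<longleftrightarrow> a = a' \<and> b = (b' :: nat)"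
  by (metis add.commute div_mult_self1_is_m add_cancel_right_left div_less div_mult_self3 less_nat_zero_code mod_less mod_mult_self3)

lemma tensor_mat_index:
  assumes "A \<in> carrier_mat m n" "B \<in> carrier_mat p q" "a < m" "b < p" "a' < n" "b' < q"
  shows "(A \<otimes>\<^sub>m B) $$ (a * p + b, a' * q + b') = A $$ (a, a') * B $$ (b, b')"
  using assms by (simp add: tensor_mat_def mult_add_less)

lemma tensor_mat_carrier [simp]:
  "A \<in> carrier_mat m n \<Longrightarrow> B \<in> carrier_mat p q \<Longrightarrow> A \<otimes>\<^sub>m B \<in> carrier_mat (m * p) (n * q)"
  by (simp add: tensor_mat_def)

text \<open>Extend the input by zero outside the image of \<open>g\<close> and discard the output
  rows outside the image of \<open>h\<close>. Bijective maps give a mere renumbering of tensor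
  indices, injective ones the extraction of a block.\<close>

lemma contraction_on_subblock:
  assumes M: "contraction_on I J M" and fin: "finite I" "finite J"
    and h: "inj_on h I'" "h ` I' \<subseteq> I" and g: "inj_on g J'" "g ` J' \<subseteq> J"
  shows "contraction_on I' J' (\<lambda>i j. M (h i) (g j))"
  unfolding contraction_on_def
proof
  fix v :: "'d \<Rightarrow> complex"
  define w where "w j = (if j \<in> g ` J' then v (inv_into J' g j) else 0)" for j
  have wg: "w (g j) = v j" if "j \<in> J'" for j using that g by (simp add: w_def)
  have sum_w: "(\<Sum>j\<in>J. M i j * w j) = (\<Sum>j\<in>J'. M i (g j) * v j)" for i
  proof -
    have "(\<Sum>j\<in>J. M i j * w j) = (\<Sum>j\<in>g ` J'. M i j * w j)"
      using fin g by (intro sum.mono_neutral_right) (auto simp: w_def)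
    also have "\<dots> = (\<Sum>j\<in>J'. M i (g j) * v j)"
      using g by (simp add: sum.reindex wg)
    finally show ?thesis .
  qed
  have "(\<Sum>i\<in>I'. (cmod (\<Sum>j\<in>J'. M (h i) (g j) * v j))\<^sup>2) = (\<Sum>i\<in>h ` I'. (cmod (\<Sum>j\<in>J. M i j * w j))\<^sup>2)"
    using h by (simp add: sum.reindex sum_w)
  also have "\<dots> \<le> (\<Sum>i\<in>I. (cmod (\<Sum>j\<in>J. M i j * w j))\<^sup>2)"
    using h fin by (intro sum_mono2) auto
  also have "\<dots> \<le> (\<Sum>j\<in>J. (cmod (w j))\<^sup>2)"
    by (rule contraction_onD[OF M])
  also have "\<dots> = (\<Sum>j\<in>g ` J'. (cmod (w j))\<^sup>2)"
    using fin g by (intro sum.mono_neutral_right) (auto simp: w_def)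
  also have "\<dots> = (\<Sum>j\<in>J'. (cmod (v j))\<^sup>2)"
    using g by (simp add: sum.reindex wg)
  finally show "(\<Sum>i\<in>I'. (cmod (\<Sum>j\<in>J'. M (h i) (g j) * v j))\<^sup>2) \<le> (\<Sum>j\<in>J'. (cmod (v j))\<^sup>2)" .
qed

text \<open>Stacking the Kraus operators gives a Stinespring isometry; the completeness relation
  says that its columns are orthonormal.\<close>

lemma quantum_operation_contraction:
  assumes "quantum_operation d d' Ks"
  shows "contraction_on ({..<length Ks} \<times> {..<d'}) {..<d} (\<lambda>(k, \<alpha>) a. Ks ! k $$ (\<alpha>, a))"
proof (rule isometry_contraction_on)
  fix a b assume ab: "a \<in> {..<d}" "b \<in> {..<d}"
  let ?M = "\<lambda>(k, \<alpha>) a. Ks ! k $$ (\<alpha>, a)"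
  have K: "Ks ! k \<in> carrier_mat d' d" if "k < length Ks" for k
    using assms that by (auto simp: quantum_operation_def)
  have "(\<Sum>i\<in>{..<length Ks} \<times> {..<d'}. cnj (?M i a) * ?M i b)
    = (\<Sum>k<length Ks. \<Sum>\<alpha><d'. cnj (Ks ! k $$ (\<alpha>, a)) * Ks ! k $$ (\<alpha>, b))"
    by (simp add: sum.cartesian_product split_def)
  also have "\<dots> = (\<Sum>k<length Ks. (mat_adjoint (Ks ! k) * Ks ! k) $$ (a, b))"
  proof (rule sum.cong[OF refl])
    fix k assume "k \<in> {..<length Ks}"
    then have k: "Ks ! k \<in> carrier_mat d' d" using K by simp
    show "(\<Sum>\<alpha><d'. cnj (Ks ! k $$ (\<alpha>, a)) * Ks ! k $$ (\<alpha>, b)) = (mat_adjoint (Ks ! k) * Ks ! k) $$ (a, b)"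
      using ab k by (subst index_mult_mat_sum[of _ d d' _ d]) (auto intro!: sum.cong)
  qed
  also have "\<dots> = mat_sum d (\<lambda>k. mat_adjoint (Ks ! k) * Ks ! k) {..<length Ks} $$ (a, b)"
    using ab by (simp add: mat_sum_def)
  also have "\<dots> = (if a = b then 1 else 0)"
    using assms ab by (simp add: quantum_operation_def)
  finally show "(\<Sum>i\<in>{..<length Ks} \<times> {..<d'}. cnj (?M i a) * ?M i b)
    = (if a = b then 1 else 0)" .
qed simp

text \<open>If \<open>\<sigma> = R R\<^sup>\<dagger>\<close>, these are the (unnormalized) pure components of the output of two local operations.\<close>

definition local_output ::
  "nat \<Rightarrow> nat \<Rightarrow> complex mat list \<Rightarrow> complex mat list \<Rightarrow> (nat \<Rightarrow> 'e \<Rightarrow> complex) \<Rightarrow>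
    'e \<Rightarrow> nat \<Rightarrow> nat \<Rightarrow> nat \<Rightarrow> nat \<Rightarrow> complex" where
  "local_output da dc Ks Ls R e k \<alpha> l \<mu> =
     (\<Sum>a<da. \<Sum>c<dc. Ks ! k $$ (\<alpha>, a) * Ls ! l $$ (\<mu>, c) * R (a * dc + c) e)"

lemma apply_local_index:
  assumes K: "set Ks \<subseteq> carrier_mat dA da" and L: "set Ls \<subseteq> carrier_mat dB dc"
    and \<sigma>: "\<sigma> \<in> carrier_mat (da * dc) (da * dc)"
    and R: "\<And>i j. i < da * dc \<Longrightarrow> j < da * dc \<Longrightarrow> \<sigma> $$ (i, j) = (\<Sum>e\<in>E. R i e * cnj (R j e))"
    and idx: "\<alpha> < dA" "\<mu> < dB" "\<alpha>' < dA" "\<mu>' < dB"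
  shows "apply_local dA dB Ks Ls \<sigma> $$ (\<alpha> * dB + \<mu>, \<alpha>' * dB + \<mu>') =
    (\<Sum>k<length Ks. \<Sum>l<length Ls. \<Sum>e\<in>E.
      local_output da dc Ks Ls R e k \<alpha> l \<mu> * cnj (local_output da dc Ks Ls R e k \<alpha>' l \<mu>'))"
proof -
  have summand: "((Ks ! k \<otimes>\<^sub>m Ls ! l) * \<sigma> * mat_adjoint (Ks ! k \<otimes>\<^sub>m Ls ! l)) $$ (\<alpha> * dB + \<mu>, \<alpha>' * dB + \<mu>') =
    (\<Sum>e\<in>E. local_output da dc Ks Ls R e k \<alpha> l \<mu> * cnj (local_output da dc Ks Ls R e k \<alpha>' l \<mu>'))"
    if kl: "k < length Ks" "l < length Ls" for k l
  proof -
    let ?M = "Ks ! k \<otimes>\<^sub>m Ls ! l"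
    have Kk: "Ks ! k \<in> carrier_mat dA da" and Ll: "Ls ! l \<in> carrier_mat dB dc" using K L kl by auto
    have M: "?M \<in> carrier_mat (dA * dB) (da * dc)" using Kk Ll by simp
    have out: "(\<Sum>p<da * dc. ?M $$ (\<alpha> * dB + \<mu>, p) * R p e) = local_output da dc Ks Ls R e k \<alpha> l \<mu>"
      if "\<alpha> < dA" "\<mu> < dB" for \<alpha> \<mu> e
      unfolding sum_lessThan_mult local_output_def
      by (intro sum.cong refl) (use that in \<open>simp add: tensor_mat_index[OF Kk Ll]\<close>)
    have i: "\<alpha> * dB + \<mu> < dA * dB" "\<alpha>' * dB + \<mu>' < dA * dB" using idx by (auto intro: mult_add_less)
    have "(?M * \<sigma> * mat_adjoint ?M) $$ (\<alpha> * dB + \<mu>, \<alpha>' * dB + \<mu>') =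
        (\<Sum>q<da * dc. (\<Sum>p<da * dc. ?M $$ (\<alpha> * dB + \<mu>, p) * \<sigma> $$ (p, q)) * cnj (?M $$ (\<alpha>' * dB + \<mu>', q)))"
      using i M
      by (subst index_mult_mat_sum[OF mult_carrier_mat[OF M \<sigma>] mat_adjoint_carrier[OF M] i])
        (auto simp: index_mult_mat_sum[OF M \<sigma>] simp del: index_mult_mat(1) intro!: sum.cong)
    also have "\<dots> = (\<Sum>q<da * dc. \<Sum>p<da * dc. \<Sum>e\<in>E. (?M $$ (\<alpha> * dB + \<mu>, p) * R p e) * cnj (?M $$ (\<alpha>' * dB + \<mu>', q) * R q e))"
      by (intro sum.cong refl) (simp add: R sum_distrib_left sum_distrib_right mult_ac)
    also have "\<dots> = (\<Sum>e\<in>E. \<Sum>p<da * dc. \<Sum>q<da * dc. (?M $$ (\<alpha> * dB + \<mu>, p) * R p e) * cnj (?M $$ (\<alpha>' * dB + \<mu>', q) * R q e))"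
      by (rule sum_reverse3)
    also have "\<dots> = (\<Sum>e\<in>E. (\<Sum>p<da * dc. ?M $$ (\<alpha> * dB + \<mu>, p) * R p e) * cnj (\<Sum>q<da * dc. ?M $$ (\<alpha>' * dB + \<mu>', q) * R q e))"
      unfolding cnj_sum sum_product ..
    finally show ?thesis using idx by (simp only: out)
  qed
  have "apply_local dA dB Ks Ls \<sigma> $$ (\<alpha> * dB + \<mu>, \<alpha>' * dB + \<mu>') =
     (\<Sum>(k, l)\<in>{..<length Ks} \<times> {..<length Ls}.
        ((Ks ! k \<otimes>\<^sub>m Ls ! l) * \<sigma> * mat_adjoint (Ks ! k \<otimes>\<^sub>m Ls ! l)) $$ (\<alpha> * dB + \<mu>, \<alpha>' * dB + \<mu>'))"
    using idx by (auto simp: apply_local_def mat_sum_def mult_add_less intro!: sum.cong)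
  also have "\<dots> = (\<Sum>k<length Ks. \<Sum>l<length Ls. \<Sum>e\<in>E.
      local_output da dc Ks Ls R e k \<alpha> l \<mu> * cnj (local_output da dc Ks Ls R e k \<alpha>' l \<mu>'))"
    unfolding sum.cartesian_product[symmetric] by (intro sum.cong refl summand) auto
  finally show ?thesis .
qed

lemma apply_local_carrier [simp]: "apply_local dA dB Ks Ls \<sigma> \<in> carrier_mat (dA * dB) (dA * dB)"
  by (simp add: apply_local_def mat_sum_def)

section \<open>Expectation values as inner products of local vectors\<close>

text \<open>Tracing out Bob's discarded register amounts to treating its index \<open>t\<close> as
  part of his Kraus label, which brings the expectation value into the form of
  \<open>expectation_factorization\<close>. The left-hand side is the trace of the state times
  \<open>W\<close>, hence the reversed arguments of \<open>W\<close>.\<close>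

lemma local_expectation_Alice:
  assumes K: "set Ks \<subseteq> carrier_mat dA da" and L: "set Ls \<subseteq> carrier_mat (d * r) dc"
    and \<sigma>: "\<sigma> \<in> carrier_mat (da * dc) (da * dc)"
    and R: "\<And>i j. i < da * dc \<Longrightarrow> j < da * dc \<Longrightarrow> \<sigma> $$ (i, j) = (\<Sum>e\<in>E. R i e * cnj (R j e))"
  shows "(\<Sum>\<gamma><dA * d. \<Sum>\<gamma>'<dA * d. partial_trace (dA * d) r 1 (apply_local dA (d * r) Ks Ls \<sigma>) $$ (\<gamma>, \<gamma>') * W \<gamma>' \<gamma>) =
    (\<Sum>i\<in>{..<d} \<times> {..<d} \<times> E \<times> {..<da} \<times> {..<dc}.
       cnj (keeper_factor {..<da} {..<dA} {..<length Ks} (\<lambda>(k, \<alpha>) a. Ks ! k $$ (\<alpha>, a)) (\<lambda>a c. R (a * dc + c))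
          (\<lambda>(\<alpha>', \<beta>') (\<alpha>, \<beta>). W (\<alpha>' * d + \<beta>') (\<alpha> * d + \<beta>)) i) *
       storer_factor {..<dc} ({..<length Ls} \<times> {..<r}) (\<lambda>((l, t), \<beta>) c. Ls ! l $$ (\<beta> * r + t, c)) (\<lambda>a c. R (a * dc + c)) i)"
proof -
  define \<psi> where "\<psi> e k \<alpha> l t \<beta> = local_output da dc Ks Ls R e k \<alpha> l (\<beta> * r + t)" for e k \<alpha> l t \<beta>
  let ?K = "\<lambda>(k, \<alpha>) a. Ks ! k $$ (\<alpha>, a)"
  let ?L = "\<lambda>((l, t), \<beta>) c. Ls ! l $$ (\<beta> * r + t, c)"
  let ?R = "\<lambda>a c. R (a * dc + c)"
  have \<psi>: "joint_vec {..<da} {..<dc} ?K ?L ?R e k \<alpha> (l, t) \<beta> = \<psi> e k \<alpha> l t \<beta>" for e k \<alpha> l t \<beta>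
    by (simp add: joint_vec_def \<psi>_def local_output_def)
  have entry: "partial_trace (dA * d) r 1 (apply_local dA (d * r) Ks Ls \<sigma>) $$ (\<alpha> * d + \<beta>, \<alpha>' * d + \<beta>') =
      (\<Sum>t<r. \<Sum>k<length Ks. \<Sum>l<length Ls. \<Sum>e\<in>E. \<psi> e k \<alpha> l t \<beta> * cnj (\<psi> e k \<alpha>' l t \<beta>'))"
    if "\<alpha> < dA" "\<beta> < d" "\<alpha>' < dA" "\<beta>' < d" for \<alpha> \<beta> \<alpha>' \<beta>'
  proof -
    have "partial_trace (dA * d) r 1 (apply_local dA (d * r) Ks Ls \<sigma>) $$ (\<alpha> * d + \<beta>, \<alpha>' * d + \<beta>') =
        (\<Sum>t<r. apply_local dA (d * r) Ks Ls \<sigma> $$ (\<alpha> * (d * r) + (\<beta> * r + t), \<alpha>' * (d * r) + (\<beta>' * r + t)))"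
      using that by (simp add: partial_trace_def mult_add_less add_mult_distrib mult.assoc add.assoc)
    also have "\<dots> = (\<Sum>t<r. \<Sum>k<length Ks. \<Sum>l<length Ls. \<Sum>e\<in>E. \<psi> e k \<alpha> l t \<beta> * cnj (\<psi> e k \<alpha>' l t \<beta>'))"
      unfolding \<psi>_def by (intro sum.cong refl apply_local_index[OF K L \<sigma> R]) (use that in \<open>auto intro: mult_add_less\<close>)
    finally show ?thesis .
  qed
  have "(\<Sum>\<gamma><dA * d. \<Sum>\<gamma>'<dA * d. partial_trace (dA * d) r 1 (apply_local dA (d * r) Ks Ls \<sigma>) $$ (\<gamma>, \<gamma>') * W \<gamma>' \<gamma>) =
    (\<Sum>\<alpha><dA. \<Sum>\<beta><d. \<Sum>\<alpha>'<dA. \<Sum>\<beta>'<d. \<Sum>t<r. \<Sum>k<length Ks. \<Sum>l<length Ls. \<Sum>e\<in>E.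
       \<psi> e k \<alpha> l t \<beta> * cnj (\<psi> e k \<alpha>' l t \<beta>') * W (\<alpha>' * d + \<beta>') (\<alpha> * d + \<beta>))"
    unfolding sum_lessThan_mult[of _ dA d]
    by (intro sum.cong refl) (simp only: entry lessThan_iff sum_distrib_right)
  also have "\<dots> = (\<Sum>(\<alpha>,\<beta>,\<alpha>',\<beta>',t,k,l,e)\<in>{..<dA}\<times>{..<d}\<times>{..<dA}\<times>{..<d}\<times>{..<r}\<times>{..<length Ks}\<times>{..<length Ls}\<times>E.
       \<psi> e k \<alpha> l t \<beta> * cnj (\<psi> e k \<alpha>' l t \<beta>') * W (\<alpha>' * d + \<beta>') (\<alpha> * d + \<beta>))"
    by (simp add: sum.cartesian_product split_def)
  also have "\<dots> = (\<Sum>(k,(l,t),e,\<alpha>,\<beta>,\<alpha>',\<beta>')\<in>{..<length Ks}\<times>({..<length Ls}\<times>{..<r})\<times>E\<times>{..<dA}\<times>{..<d}\<times>{..<dA}\<times>{..<d}.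
       \<psi> e k \<alpha> l t \<beta> * cnj (\<psi> e k \<alpha>' l t \<beta>') * W (\<alpha>' * d + \<beta>') (\<alpha> * d + \<beta>))"
    by (rule sum.reindex_bij_witness[where
        i = "\<lambda>(k,(l,t),e,\<alpha>,\<beta>,\<alpha>',\<beta>'). (\<alpha>,\<beta>,\<alpha>',\<beta>',t,k,l,e)" and
        j = "\<lambda>(\<alpha>,\<beta>,\<alpha>',\<beta>',t,k,l,e). (k,(l,t),e,\<alpha>,\<beta>,\<alpha>',\<beta>')"]) auto
  also have "\<dots> = (\<Sum>k<length Ks. \<Sum>l\<in>{..<length Ls}\<times>{..<r}. \<Sum>e\<in>E. \<Sum>\<alpha><dA. \<Sum>\<beta><d. \<Sum>\<alpha>'<dA. \<Sum>\<beta>'<d.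
       joint_vec {..<da} {..<dc} ?K ?L ?R e k \<alpha> l \<beta> * cnj (joint_vec {..<da} {..<dc} ?K ?L ?R e k \<alpha>' l \<beta>') *
       (\<lambda>(\<alpha>', \<beta>') (\<alpha>, \<beta>). W (\<alpha>' * d + \<beta>') (\<alpha> * d + \<beta>)) (\<alpha>', \<beta>') (\<alpha>, \<beta>))"
    by (simp add: sum.cartesian_product split_def \<psi>[symmetric])
  finally show ?thesis unfolding expectation_factorization .
qed

text \<open>The mirror image with Bob as keeper. The tensor order is unchanged, so the stored index
  is now the leading digit: \<open>W\<close> is read at \<open>\<beta> * dB + \<mu>\<close>, and the
  traced register lies in the middle.\<close>

lemma local_expectation_Bob:
  assumes K: "set Ks \<subseteq> carrier_mat (d * r) da" and L: "set Ls \<subseteq> carrier_mat dB dc"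
    and \<sigma>: "\<sigma> \<in> carrier_mat (da * dc) (da * dc)"
    and R: "\<And>i j. i < da * dc \<Longrightarrow> j < da * dc \<Longrightarrow> \<sigma> $$ (i, j) = (\<Sum>e\<in>E. R i e * cnj (R j e))"
  shows "(\<Sum>\<gamma><d * dB. \<Sum>\<gamma>'<d * dB. partial_trace d r dB (apply_local (d * r) dB Ks Ls \<sigma>) $$ (\<gamma>, \<gamma>') * W \<gamma>' \<gamma>) =
    (\<Sum>i\<in>{..<d} \<times> {..<d} \<times> E \<times> {..<dc} \<times> {..<da}.
       cnj (keeper_factor {..<dc} {..<dB} {..<length Ls} (\<lambda>(l, \<mu>) c. Ls ! l $$ (\<mu>, c)) (\<lambda>c a. R (a * dc + c))
          (\<lambda>(\<mu>', \<beta>') (\<mu>, \<beta>). W (\<beta>' * dB + \<mu>') (\<beta> * dB + \<mu>)) i) *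
       storer_factor {..<da} ({..<length Ks} \<times> {..<r}) (\<lambda>((k, t), \<beta>) a. Ks ! k $$ (\<beta> * r + t, a)) (\<lambda>c a. R (a * dc + c)) i)"
proof -
  define \<psi> where "\<psi> e l \<mu> k t \<beta> = local_output da dc Ks Ls R e k (\<beta> * r + t) l \<mu>" for e k \<mu> l t \<beta>
  let ?L = "\<lambda>(l, \<mu>) c. Ls ! l $$ (\<mu>, c)"
  let ?K = "\<lambda>((k, t), \<beta>) a. Ks ! k $$ (\<beta> * r + t, a)"
  let ?R = "\<lambda>c a. R (a * dc + c)"
  have \<psi>: "joint_vec {..<dc} {..<da} ?L ?K ?R e l \<mu> (k, t) \<beta> = \<psi> e l \<mu> k t \<beta>" for e k \<mu> l t \<beta>
    unfolding joint_vec_def \<psi>_def local_output_def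
    by (subst sum.swap) (simp add: mult_ac)
  have entry: "partial_trace d r dB (apply_local (d * r) dB Ks Ls \<sigma>) $$ (\<beta> * dB + \<mu>, \<beta>' * dB + \<mu>') =
      (\<Sum>t<r. \<Sum>k<length Ks. \<Sum>l<length Ls. \<Sum>e\<in>E. \<psi> e l \<mu> k t \<beta> * cnj (\<psi> e l \<mu>' k t \<beta>'))"
    if "\<mu> < dB" "\<beta> < d" "\<mu>' < dB" "\<beta>' < d" for \<mu> \<beta> \<mu>' \<beta>'
    using that
    by (simp add: partial_trace_def mult_add_less \<psi>_def apply_local_index[OF K L \<sigma> R])
  have "(\<Sum>\<gamma><d * dB. \<Sum>\<gamma>'<d * dB. partial_trace d r dB (apply_local (d * r) dB Ks Ls \<sigma>) $$ (\<gamma>, \<gamma>') * W \<gamma>' \<gamma>) =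
    (\<Sum>\<beta><d. \<Sum>\<mu><dB. \<Sum>\<beta>'<d. \<Sum>\<mu>'<dB. \<Sum>t<r. \<Sum>k<length Ks. \<Sum>l<length Ls. \<Sum>e\<in>E.
       \<psi> e l \<mu> k t \<beta> * cnj (\<psi> e l \<mu>' k t \<beta>') * W (\<beta>' * dB + \<mu>') (\<beta> * dB + \<mu>))"
    unfolding sum_lessThan_mult[of _ d dB]
    by (intro sum.cong refl) (simp only: entry lessThan_iff sum_distrib_right)
  also have "\<dots> = (\<Sum>(\<beta>,\<mu>,\<beta>',\<mu>',t,k,l,e)\<in>{..<d}\<times>{..<dB}\<times>{..<d}\<times>{..<dB}\<times>{..<r}\<times>{..<length Ks}\<times>{..<length Ls}\<times>E.
       \<psi> e l \<mu> k t \<beta> * cnj (\<psi> e l \<mu>' k t \<beta>') * W (\<beta>' * dB + \<mu>') (\<beta> * dB + \<mu>))"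
    by (simp add: sum.cartesian_product split_def)
  also have "\<dots> = (\<Sum>(l,(k,t),e,\<mu>,\<beta>,\<mu>',\<beta>')\<in>{..<length Ls}\<times>({..<length Ks}\<times>{..<r})\<times>E\<times>{..<dB}\<times>{..<d}\<times>{..<dB}\<times>{..<d}.
       \<psi> e l \<mu> k t \<beta> * cnj (\<psi> e l \<mu>' k t \<beta>') * W (\<beta>' * dB + \<mu>') (\<beta> * dB + \<mu>))"
    by (rule sum.reindex_bij_witness[where
        i = "\<lambda>(l,(k,t),e,\<mu>,\<beta>,\<mu>',\<beta>'). (\<beta>,\<mu>,\<beta>',\<mu>',t,k,l,e)" and
        j = "\<lambda>(\<beta>,\<mu>,\<beta>',\<mu>',t,k,l,e). (l,(k,t),e,\<mu>,\<beta>,\<mu>',\<beta>')"]) auto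
  also have "\<dots> = (\<Sum>l<length Ls. \<Sum>k\<in>{..<length Ks}\<times>{..<r}. \<Sum>e\<in>E. \<Sum>\<mu><dB. \<Sum>\<beta><d. \<Sum>\<mu>'<dB. \<Sum>\<beta>'<d.
       joint_vec {..<dc} {..<da} ?L ?K ?R e l \<mu> k \<beta> * cnj (joint_vec {..<dc} {..<da} ?L ?K ?R e l \<mu>' k \<beta>') *
       (\<lambda>(\<mu>', \<beta>') (\<mu>, \<beta>). W (\<beta>' * dB + \<mu>') (\<beta> * dB + \<mu>)) (\<mu>', \<beta>') (\<mu>, \<beta>))"
    by (simp add: sum.cartesian_product split_def \<psi>[symmetric])
  finally show ?thesis unfolding expectation_factorization .
qed

section \<open>Sums over the two sources\<close>

lemma finite_bitstrings [simp]: "finite (bitstrings n)"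
  using finite_lists_length_eq[of "UNIV :: bool set" n] by (simp add: bitstrings_def)

text \<open>The collision probability is at most the largest probability. The bound on the point
  probabilities enters the estimate only here.\<close>

lemma sum_pmf_square_le:
  assumes p: "min_entropy_source n k p"
  shows "(\<Sum>x\<in>bitstrings n. (pmf p x)\<^sup>2) \<le> 2 powr (- k)"
proof -
  have "(\<Sum>x\<in>bitstrings n. (pmf p x)\<^sup>2) \<le> (\<Sum>x\<in>bitstrings n. 2 powr (- k) * pmf p x)"
    using p unfolding power2_eq_square min_entropy_source_def by (intro sum_mono mult_right_mono) auto
  also have "\<dots> = 2 powr (- k) * (\<Sum>x\<in>bitstrings n. pmf p x)"
    by (simp add: sum_distrib_left)
  also have "(\<Sum>x\<in>bitstrings n. pmf p x) = 1"
    using p by (intro sum_pmf_eq_1) (auto simp: min_entropy_source_def)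
  finally show ?thesis by simp
qed

section \<open>The sign matrix of the inner product\<close>

definition ip_sign :: "nat \<Rightarrow> bool list \<Rightarrow> bool list \<Rightarrow> complex" where
  "ip_sign n x y = (if odd (\<Sum>j<n. of_bool (x ! j) * of_bool (y ! j) :: nat) then - 1 else 1)"

lemma ip_sign_commute: "ip_sign n x y = ip_sign n y x"
  by (simp add: ip_sign_def mult.commute)

lemma ip_sign_Cons: "ip_sign (Suc n) (a # x) (b # y) = (if a \<and> b then - 1 else 1) * ip_sign n x y"
  unfolding ip_sign_def sum.lessThan_Suc_shift by simp

lemma sum_bitstrings_Suc:
  "(\<Sum>x\<in>bitstrings (Suc n). f x) = (\<Sum>x\<in>bitstrings n. f (False # x) + f (True # x))"
proof -
  have "bitstrings (Suc n) = (#) False ` bitstrings n \<union> (#) True ` bitstrings n"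
    by (auto simp: bitstrings_def length_Suc_conv)
  then have "(\<Sum>x\<in>bitstrings (Suc n). f x) = (\<Sum>x\<in>(#) False ` bitstrings n. f x) + (\<Sum>x\<in>(#) True ` bitstrings n. f x)"
    by (simp, subst sum.union_disjoint) auto
  then show ?thesis by (simp add: sum.reindex sum.distrib)
qed

text \<open>The sign matrix is the \<open>n\<close>-fold tensor power of the unnormalized 2 by 2
  Hadamard matrix. Removing the first bit contributes a factor 2 if the bits of \<open>y\<close> and
  \<open>z\<close> agree and 0 otherwise.\<close>

lemma ip_sign_orthogonal:
  assumes "y \<in> bitstrings n" "z \<in> bitstrings n"
  shows "(\<Sum>x\<in>bitstrings n. cnj (ip_sign n x y) * ip_sign n x z) = (if y = z then of_real (2 ^ n) else 0)"
  using assms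
proof (induction n arbitrary: y z)
  case 0
  then show ?case by (simp add: bitstrings_def ip_sign_def)
next
  case (Suc n)
  obtain b y' where y: "y = b # y'" "y' \<in> bitstrings n"
    using Suc.prems by (auto simp: bitstrings_def length_Suc_conv)
  obtain c z' where z: "z = c # z'" "z' \<in> bitstrings n"
    using Suc.prems by (auto simp: bitstrings_def length_Suc_conv)
  have "(\<Sum>x\<in>bitstrings (Suc n). cnj (ip_sign (Suc n) x y) * ip_sign (Suc n) x z) =
      (\<Sum>x\<in>bitstrings n. (if b = c then 2 else 0) * (cnj (ip_sign n x y') * ip_sign n x z'))"
    unfolding sum_bitstrings_Suc y z ip_sign_Cons by (intro sum.cong refl) simp
  also have "\<dots> = (if b = c then 2 else 0) * (if y' = z' then of_real (2 ^ n) else 0)"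
    unfolding sum_distrib_left[symmetric] Suc.IH[OF y(2) z(2)] ..
  finally show ?case by (simp add: y z)
qed

section \<open>Bounds on the signed sums\<close>

lemma density_mat_factor:
  assumes "density_mat n \<sigma>"
  obtains R :: "nat \<Rightarrow> nat \<Rightarrow> complex"
  where "\<And>i j. i < n \<Longrightarrow> j < n \<Longrightarrow> \<sigma> $$ (i, j) = (\<Sum>e<n. R i e * cnj (R j e))"
    and "(\<Sum>i<n. \<Sum>e<n. (cmod (R i e))\<^sup>2) = 1"
proof -
  have psd: "psd_mat n \<sigma>" and tr: "mat_trace \<sigma> = 1" using assms by (auto simp: density_mat_def)
  then have c: "\<sigma> \<in> carrier_mat n n" by (simp add: psd_mat_def)
  obtain R where R: "\<And>i j. i < n \<Longrightarrow> j < n \<Longrightarrow> \<sigma> $$ (i, j) = (\<Sum>e<n. R i e * cnj (R j e))"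
    using psd_mat_factor[OF psd] by blast
  have "complex_of_real (\<Sum>i<n. \<Sum>e<n. (cmod (R i e))\<^sup>2) = (\<Sum>i<n. \<sigma> $$ (i, i))"
    unfolding of_real_sum cmod_sq_eq by (intro sum.cong refl) (simp add: R mult.commute)
  also have "\<dots> = 1" using tr c by (simp add: mat_trace_def)
  finally have "(\<Sum>i<n. \<Sum>e<n. (cmod (R i e))\<^sup>2) = 1" by (simp only: of_real_eq_1_iff)
  with R that show ?thesis by blast
qed

text \<open>The Stinespring isometry again, with the output index split into digits and the
  discarded digit \<open>t\<close> moved into the label.\<close>

lemma partial_isometry_contraction:
  assumes "quantum_operation d' (d * r) Ks"
  shows "contraction_on (({..<length Ks} \<times> {..<r}) \<times> {..<d}) {..<d'} (\<lambda>((k, t), \<beta>) a. Ks ! k $$ (\<beta> * r + t, a))"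
proof -
  let ?h = "\<lambda>((k, t), \<beta>). (k, \<beta> * r + t)"
  have "contraction_on (({..<length Ks} \<times> {..<r}) \<times> {..<d}) {..<d'}
      (\<lambda>i j. (\<lambda>(k, \<alpha>) a. Ks ! k $$ (\<alpha>, a)) (?h i) (id j))"
    by (rule contraction_on_subblock[OF quantum_operation_contraction[OF assms]])
      (auto simp: inj_on_def mult_add_eq_iff mult_add_less)
  then show ?thesis by (simp add: split_def)
qed

text \<open>\<open>W\<close> may depend on \<open>x\<close> because the keeper's vector does anyway;
  dependence on both sources would destroy the factorization. One factor \<open>d\<close> comes from
  the keeper, the other from the storer unless Bob's share of the state is trivial. The dimensions
  \<open>da\<close>, \<open>dA\<close> and \<open>r\<close> do not appear in the bound.\<close>

lemma Alice_sum_bound: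
  fixes W :: "bool list \<Rightarrow> nat \<Rightarrow> nat \<Rightarrow> complex"
  assumes \<sigma>: "density_mat (da * dc) \<sigma>"
    and KA: "\<And>x. x \<in> bitstrings n \<Longrightarrow> quantum_operation da dA (KA x)"
    and KB: "\<And>y. y \<in> bitstrings n \<Longrightarrow> quantum_operation dc (d * r) (KB y)"
    and W: "\<And>x. x \<in> bitstrings n \<Longrightarrow> contraction_on {..<dA * d} {..<dA * d} (W x)"
    and p: "min_entropy_source n k1 p" and q: "min_entropy_source n k2 q"
  shows "(cmod (\<Sum>x\<in>bitstrings n. \<Sum>y\<in>bitstrings n. of_real (pmf p x * pmf q y) * ip_sign n x y *
      (\<Sum>\<gamma><dA * d. \<Sum>\<gamma>'<dA * d.
         partial_trace (dA * d) r 1 (apply_local dA (d * r) (KA x) (KB y) \<sigma>) $$ (\<gamma>, \<gamma>') * W x \<gamma>' \<gamma>)))\<^sup>2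
    \<le> 2 ^ n * (2 powr - k1 * real d) * (2 powr - k2 * (if dc = 1 then 1 else real d))"
proof -
  have \<sigma>c: "\<sigma> \<in> carrier_mat (da * dc) (da * dc)" using \<sigma> by (simp add: density_mat_def psd_mat_def)
  obtain R where R: "\<And>i j. i < da * dc \<Longrightarrow> j < da * dc \<Longrightarrow> \<sigma> $$ (i, j) = (\<Sum>e<da * dc. R i e * cnj (R j e))"
    and tr: "(\<Sum>i<da * dc. \<Sum>e<da * dc. (cmod (R i e))\<^sup>2) = 1"
    using density_mat_factor[OF \<sigma>] by blast
  let ?E = "{..<da * dc}"
  have tr': "(\<Sum>a<da. \<Sum>c<dc. \<Sum>e\<in>?E. (cmod (R (a * dc + c) e))\<^sup>2) = 1"
    using tr unfolding sum_lessThan_mult[of "\<lambda>i. \<Sum>e\<in>?E. (cmod (R i e))\<^sup>2"] .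
  define u where "u x = keeper_factor {..<da} {..<dA} {..<length (KA x)} (\<lambda>(k, \<alpha>) a. KA x ! k $$ (\<alpha>, a))
      (\<lambda>a c. R (a * dc + c)) (\<lambda>(\<alpha>', \<beta>') (\<alpha>, \<beta>). W x (\<alpha>' * d + \<beta>') (\<alpha> * d + \<beta>))" for x
  define v where "v y = storer_factor {..<dc} ({..<length (KB y)} \<times> {..<r})
      (\<lambda>((l, t), \<beta>) c. KB y ! l $$ (\<beta> * r + t, c)) (\<lambda>a c. R (a * dc + c))" for y
  let ?I = "{..<d} \<times> {..<d} \<times> ?E \<times> {..<da} \<times> {..<dc}"
  have f: "(\<Sum>\<gamma><dA * d. \<Sum>\<gamma>'<dA * d.
         partial_trace (dA * d) r 1 (apply_local dA (d * r) (KA x) (KB y) \<sigma>) $$ (\<gamma>, \<gamma>') * W x \<gamma>' \<gamma>)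
      = (\<Sum>i\<in>?I. cnj (u x i) * v y i)" if "x \<in> bitstrings n" "y \<in> bitstrings n" for x y
    unfolding u_def v_def
    by (rule local_expectation_Alice[OF _ _ \<sigma>c R]) (use KA KB that in \<open>auto simp: quantum_operation_def\<close>)
  have u: "(\<Sum>i\<in>?I. (cmod (u x i))\<^sup>2) \<le> real d" if x: "x \<in> bitstrings n" for x
  proof -
    let ?h = "\<lambda>(\<alpha>, \<beta>). \<alpha> * d + \<beta>"
    have "contraction_on ({..<dA} \<times> {..<d}) ({..<dA} \<times> {..<d}) (\<lambda>i j. W x (?h i) (?h j))"
      by (rule contraction_on_subblock[OF W[OF x]]) (auto simp: inj_on_def mult_add_eq_iff mult_add_less)
    then have Wc: "contraction_on ({..<dA} \<times> {..<d}) ({..<dA} \<times> {..<d})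
        (\<lambda>(\<alpha>', \<beta>') (\<alpha>, \<beta>). W x (\<alpha>' * d + \<beta>') (\<alpha> * d + \<beta>))"
      by (simp add: split_def)
    show ?thesis
      using keeper_factor_norm[OF finite_lessThan quantum_operation_contraction[OF KA[OF x]] Wc,
          where E = ?E and C = "{..<dc}" and R = "\<lambda>a c. R (a * dc + c)"]
      by (simp add: u_def tr')
  qed
  have v: "(\<Sum>i\<in>?I. (cmod (v y i))\<^sup>2) \<le> (if dc = 1 then 1 else real d)" if y: "y \<in> bitstrings n" for y
  proof (cases "dc = 1")
    case True
    then have dc: "{..<dc} = {0}" by auto
    from storer_factor_norm_trivial_input[OF partial_isometry_contraction[OF KB[OF y], unfolded dc],
        where E = ?E and A = "{..<da}" and R = "\<lambda>a c. R (a * dc + c)"]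
    show ?thesis using tr' True unfolding dc by (simp add: v_def dc lessThan_Suc)
  next
    case False
    from storer_factor_norm[OF finite_lessThan partial_isometry_contraction[OF KB[OF y]],
        where E = ?E and A = "{..<da}" and R = "\<lambda>a c. R (a * dc + c)"]
    show ?thesis using tr' False by (simp add: v_def)
  qed
  have "(\<Sum>x\<in>bitstrings n. \<Sum>y\<in>bitstrings n. of_real (pmf p x * pmf q y) * ip_sign n x y *
      (\<Sum>\<gamma><dA * d. \<Sum>\<gamma>'<dA * d.
         partial_trace (dA * d) r 1 (apply_local dA (d * r) (KA x) (KB y) \<sigma>) $$ (\<gamma>, \<gamma>') * W x \<gamma>' \<gamma>)) =
      (\<Sum>x\<in>bitstrings n. \<Sum>y\<in>bitstrings n. of_real (pmf p x * pmf q y) * ip_sign n x y *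
      (\<Sum>i\<in>?I. cnj (u x i) * v y i))"
    by (intro sum.cong refl) (simp only: f)
  also have "(cmod \<dots>)\<^sup>2 \<le> 2 ^ n * (2 powr - k1 * real d) * (2 powr - k2 * (if dc = 1 then 1 else real d))"
    by (rule Lindsey[OF finite_bitstrings _ ip_sign_orthogonal u v sum_pmf_square_le[OF p] sum_pmf_square_le[OF q]])
      auto
  finally show ?thesis .
qed

lemma Bob_sum_bound:
  fixes W :: "bool list \<Rightarrow> nat \<Rightarrow> nat \<Rightarrow> complex"
  assumes \<sigma>: "density_mat (da * dc) \<sigma>"
    and KA: "\<And>x. x \<in> bitstrings n \<Longrightarrow> quantum_operation da (d * r) (KA x)"
    and KB: "\<And>y. y \<in> bitstrings n \<Longrightarrow> quantum_operation dc dB (KB y)"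
    and W: "\<And>y. y \<in> bitstrings n \<Longrightarrow> contraction_on {..<d * dB} {..<d * dB} (W y)"
    and p: "min_entropy_source n k1 p" and q: "min_entropy_source n k2 q"
  shows "(cmod (\<Sum>x\<in>bitstrings n. \<Sum>y\<in>bitstrings n. of_real (pmf p x * pmf q y) * ip_sign n x y *
      (\<Sum>\<gamma><d * dB. \<Sum>\<gamma>'<d * dB.
         partial_trace d r dB (apply_local (d * r) dB (KA x) (KB y) \<sigma>) $$ (\<gamma>, \<gamma>') * W y \<gamma>' \<gamma>)))\<^sup>2
    \<le> 2 ^ n * (2 powr - k2 * real d) * (2 powr - k1 * (if da = 1 then 1 else real d))"
proof -
  have \<sigma>c: "\<sigma> \<in> carrier_mat (da * dc) (da * dc)" using \<sigma> by (simp add: density_mat_def psd_mat_def)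
  obtain R where R: "\<And>i j. i < da * dc \<Longrightarrow> j < da * dc \<Longrightarrow> \<sigma> $$ (i, j) = (\<Sum>e<da * dc. R i e * cnj (R j e))"
    and tr: "(\<Sum>i<da * dc. \<Sum>e<da * dc. (cmod (R i e))\<^sup>2) = 1"
    using density_mat_factor[OF \<sigma>] by blast
  let ?E = "{..<da * dc}"
  have tr': "(\<Sum>c<dc. \<Sum>a<da. \<Sum>e\<in>?E. (cmod (R (a * dc + c) e))\<^sup>2) = 1"
    using tr unfolding sum_lessThan_mult[of "\<lambda>i. \<Sum>e\<in>?E. (cmod (R i e))\<^sup>2"] by (subst sum.swap)
  define u where "u y = keeper_factor {..<dc} {..<dB} {..<length (KB y)} (\<lambda>(l, \<mu>) c. KB y ! l $$ (\<mu>, c))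
      (\<lambda>c a. R (a * dc + c)) (\<lambda>(\<mu>', \<beta>') (\<mu>, \<beta>). W y (\<beta>' * dB + \<mu>') (\<beta> * dB + \<mu>))" for y
  define v where "v x = storer_factor {..<da} ({..<length (KA x)} \<times> {..<r})
      (\<lambda>((k, t), \<beta>) a. KA x ! k $$ (\<beta> * r + t, a)) (\<lambda>c a. R (a * dc + c))" for x
  let ?I = "{..<d} \<times> {..<d} \<times> ?E \<times> {..<dc} \<times> {..<da}"
  have f: "(\<Sum>\<gamma><d * dB. \<Sum>\<gamma>'<d * dB.
         partial_trace d r dB (apply_local (d * r) dB (KA x) (KB y) \<sigma>) $$ (\<gamma>, \<gamma>') * W y \<gamma>' \<gamma>)
      = (\<Sum>i\<in>?I. cnj (u y i) * v x i)" if "x \<in> bitstrings n" "y \<in> bitstrings n" for x y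
    unfolding u_def v_def
    by (rule local_expectation_Bob[OF _ _ \<sigma>c R]) (use KA KB that in \<open>auto simp: quantum_operation_def\<close>)
  have u: "(\<Sum>i\<in>?I. (cmod (u y i))\<^sup>2) \<le> real d" if y: "y \<in> bitstrings n" for y
  proof -
    let ?h = "\<lambda>(\<mu>, \<beta>). \<beta> * dB + \<mu>"
    have "contraction_on ({..<dB} \<times> {..<d}) ({..<dB} \<times> {..<d}) (\<lambda>i j. W y (?h i) (?h j))"
      by (rule contraction_on_subblock[OF W[OF y]]) (auto simp: inj_on_def mult_add_eq_iff mult_add_less)
    then have Wc: "contraction_on ({..<dB} \<times> {..<d}) ({..<dB} \<times> {..<d})
        (\<lambda>(\<mu>', \<beta>') (\<mu>, \<beta>). W y (\<beta>' * dB + \<mu>') (\<beta> * dB + \<mu>))"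
      by (simp add: split_def)
    show ?thesis
      using keeper_factor_norm[OF finite_lessThan quantum_operation_contraction[OF KB[OF y]] Wc,
          where E = ?E and C = "{..<da}" and R = "\<lambda>c a. R (a * dc + c)"]
      by (simp add: u_def tr')
  qed
  have v: "(\<Sum>i\<in>?I. (cmod (v x i))\<^sup>2) \<le> (if da = 1 then 1 else real d)" if x: "x \<in> bitstrings n" for x
  proof (cases "da = 1")
    case True
    then have da: "{..<da} = {0}" by auto
    from storer_factor_norm_trivial_input[OF partial_isometry_contraction[OF KA[OF x], unfolded da],
        where E = ?E and A = "{..<dc}" and R = "\<lambda>c a. R (a * dc + c)"]
    show ?thesis using tr' True unfolding da by (simp add: v_def da lessThan_Suc)
  next
    case False
    from storer_factor_norm[OF finite_lessThan partial_isometry_contraction[OF KA[OF x]],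
        where E = ?E and A = "{..<dc}" and R = "\<lambda>c a. R (a * dc + c)"]
    show ?thesis using tr' False by (simp add: v_def)
  qed
  \<comment> \<open>The keeper's source must take the first place in \<open>Lindsey\<close>;
    symmetry of the inner product permits exchanging the two sources.\<close>
  have step: "of_real (pmf p x * pmf q y) * ip_sign n x y * (\<Sum>\<gamma><d * dB. \<Sum>\<gamma>'<d * dB.
         partial_trace d r dB (apply_local (d * r) dB (KA x) (KB y) \<sigma>) $$ (\<gamma>, \<gamma>') * W y \<gamma>' \<gamma>)
      = of_real (pmf q y * pmf p x) * ip_sign n y x * (\<Sum>i\<in>?I. cnj (u y i) * v x i)"
    if "x \<in> bitstrings n" "y \<in> bitstrings n" for x y
    by (simp only: f[OF that] mult.commute[of "pmf p x"] ip_sign_commute[of n x])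
  have "(\<Sum>x\<in>bitstrings n. \<Sum>y\<in>bitstrings n. of_real (pmf p x * pmf q y) * ip_sign n x y *
      (\<Sum>\<gamma><d * dB. \<Sum>\<gamma>'<d * dB.
         partial_trace d r dB (apply_local (d * r) dB (KA x) (KB y) \<sigma>) $$ (\<gamma>, \<gamma>') * W y \<gamma>' \<gamma>)) =
    (\<Sum>y\<in>bitstrings n. \<Sum>x\<in>bitstrings n. of_real (pmf q y * pmf p x) * ip_sign n y x *
      (\<Sum>i\<in>?I. cnj (u y i) * v x i))"
    by (rule trans[OF sum.swap]) (intro sum.cong refl step)
  also have "(cmod \<dots>)\<^sup>2 \<le> 2 ^ n * (2 powr - k2 * real d) * (2 powr - k1 * (if da = 1 then 1 else real d))"
    by (rule Lindsey[OF finite_bitstrings _ ip_sign_orthogonal u v sum_pmf_square_le[OF q] sum_pmf_square_le[OF p]])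
      auto
  finally show ?thesis .
qed

section \<open>Extractors with one output bit\<close>

lemma horner_sum_bits_less: "horner_sum of_bool 2 bs < (2 :: nat) ^ length bs"
  by (induction bs) (auto simp: of_bool_def)

lemma ket_bra_carrier [simp]: "ket_bra x \<in> carrier_mat (2 ^ length x) (2 ^ length x)"
  by (simp add: ket_bra_def)

lemma mat_sum_index: "i < d \<Longrightarrow> j < d \<Longrightarrow> mat_sum d f I $$ (i, j) = (\<Sum>s\<in>I. f s $$ (i, j))"
  by (simp add: mat_sum_def)

lemma mat_sum_carrier [simp]: "mat_sum d f I \<in> carrier_mat d d"
  by (simp add: mat_sum_def)

text \<open>The index type and the register label \<open>z\<close> are left open so that one
  analysis covers both versions: the index is a pair of sources, and \<open>z\<close> is its first
  or second component.\<close>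

definition one_bit_extractor_diff ::
  "nat \<Rightarrow> nat \<Rightarrow> ('i \<Rightarrow> real) \<Rightarrow> ('i \<Rightarrow> bool) \<Rightarrow> ('i \<Rightarrow> complex mat) \<Rightarrow> ('i \<Rightarrow> bool list) \<Rightarrow> 'i set \<Rightarrow> complex mat" where
  "one_bit_extractor_diff D N c b \<rho> z I =
     mat_sum (2 * D * N) (\<lambda>i. complex_of_real (c i) \<cdot>\<^sub>m (ket_bra [b i] \<otimes>\<^sub>m \<rho> i \<otimes>\<^sub>m ket_bra (z i))) I
     - maximally_mixed 1 \<otimes>\<^sub>m mat_sum (D * N) (\<lambda>i. complex_of_real (c i) \<cdot>\<^sub>m (\<rho> i \<otimes>\<^sub>m ket_bra (z i))) I"

context
  fixes D n :: nat and I :: "'i set" and c :: "'i \<Rightarrow> real" and b :: "'i \<Rightarrow> bool"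
    and \<rho> :: "'i \<Rightarrow> complex mat" and z :: "'i \<Rightarrow> bool list"
  assumes \<rho>: "\<And>i. i \<in> I \<Longrightarrow> \<rho> i \<in> carrier_mat D D"
    and z: "\<And>i. i \<in> I \<Longrightarrow> z i \<in> bitstrings n"
begin

text \<open>The entries of the output projector minus the maximally mixed bit. This is half the
  Pauli matrix Z with sign -1 for output \<open>True\<close>, which is how the sign of the inner
  product arises.\<close>

definition bit_weight :: "bool \<Rightarrow> nat \<Rightarrow> nat \<Rightarrow> complex" where
  "bit_weight \<beta> s s' = of_bool (s = of_bool \<beta> \<and> s' = of_bool \<beta>) - of_bool (s = s') / 2"

lemma one_bit_extractor_diff_index:
  assumes "s < 2" "s' < 2" "\<gamma> < D" "\<gamma>' < D" "\<xi> < 2 ^ n" "\<xi>' < 2 ^ n"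
  shows "one_bit_extractor_diff D (2 ^ n) c b \<rho> z I $$ ((s * D + \<gamma>) * 2 ^ n + \<xi>, (s' * D + \<gamma>') * 2 ^ n + \<xi>') =
    (\<Sum>i\<in>I. of_real (c i) * bit_weight (b i) s s' * \<rho> i $$ (\<gamma>, \<gamma>') *
       of_bool (\<xi> = horner_sum of_bool 2 (z i) \<and> \<xi>' = horner_sum of_bool 2 (z i)))"
proof -
  let ?N = "2 ^ n :: nat"
  \<comment> \<open>The two terms of the difference bracket the three tensor factors differently;
    this identity reconciles their numberings.\<close>
  have assoc: "(s * D + \<gamma>) * ?N + \<xi> = s * (D * ?N) + (\<gamma> * ?N + \<xi>)" for s \<gamma> \<xi>
    by (simp add: algebra_simps)
  have bit: "ket_bra [\<beta>] \<in> carrier_mat 2 2" for \<beta>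
    using ket_bra_carrier[of "[\<beta>]"] by simp
  have kz: "ket_bra (z i) \<in> carrier_mat ?N ?N" if "i \<in> I" for i
    using z[OF that] by (simp add: ket_bra_def bitstrings_def)
  have kz_index: "ket_bra (z i) $$ (\<xi>, \<xi>') =
      of_bool (\<xi> = horner_sum of_bool 2 (z i) \<and> \<xi>' = horner_sum of_bool 2 (z i))" if "i \<in> I" for i
    using assms z[OF that] by (simp add: ket_bra_def bitstrings_def)
  have bit_index: "ket_bra [\<beta>] $$ (s, s') = of_bool (s = of_bool \<beta> \<and> s' = of_bool \<beta>)" for \<beta>
    using assms by (simp add: ket_bra_def)
  have in_range: "s * D + \<gamma> < 2 * D" "s' * D + \<gamma>' < 2 * D" using assms by (auto intro: mult_add_less)
  have in_range': "\<gamma> * ?N + \<xi> < D * ?N" "\<gamma>' * ?N + \<xi>' < D * ?N" using assms by (auto intro: mult_add_less)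
  have range: "(s * D + \<gamma>) * ?N + \<xi> < 2 * D * ?N" "(s' * D + \<gamma>') * ?N + \<xi>' < 2 * D * ?N"
    using assms in_range by (auto intro: mult_add_less)
  let ?M1 = "mat_sum (2 * D * ?N) (\<lambda>i. complex_of_real (c i) \<cdot>\<^sub>m (ket_bra [b i] \<otimes>\<^sub>m \<rho> i \<otimes>\<^sub>m ket_bra (z i))) I"
  let ?S = "mat_sum (D * ?N) (\<lambda>i. complex_of_real (c i) \<cdot>\<^sub>m (\<rho> i \<otimes>\<^sub>m ket_bra (z i))) I"
  have smult: "(x \<cdot>\<^sub>m A) $$ (i, j) = x * A $$ (i, j)" if "A \<in> carrier_mat d d" "i < d" "j < d"
    for x and A :: "complex mat" and d i j using that by simp
  have M1: "?M1 $$ ((s * D + \<gamma>) * ?N + \<xi>, (s' * D + \<gamma>') * ?N + \<xi>') =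
     (\<Sum>i\<in>I. of_real (c i) * (of_bool (s = of_bool (b i) \<and> s' = of_bool (b i)) * \<rho> i $$ (\<gamma>, \<gamma>') *
       of_bool (\<xi> = horner_sum of_bool 2 (z i) \<and> \<xi>' = horner_sum of_bool 2 (z i))))"
    unfolding mat_sum_index[OF range]
  proof (rule sum.cong[OF refl])
    fix i assume i: "i \<in> I"
    have "(ket_bra [b i] \<otimes>\<^sub>m \<rho> i \<otimes>\<^sub>m ket_bra (z i)) $$ ((s * D + \<gamma>) * ?N + \<xi>, (s' * D + \<gamma>') * ?N + \<xi>') =
        of_bool (s = of_bool (b i) \<and> s' = of_bool (b i)) * \<rho> i $$ (\<gamma>, \<gamma>') *
        of_bool (\<xi> = horner_sum of_bool 2 (z i) \<and> \<xi>' = horner_sum of_bool 2 (z i))"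
      using assms in_range
      by (simp only: tensor_mat_index[OF tensor_mat_carrier[OF bit \<rho>[OF i]] kz[OF i]]
          tensor_mat_index[OF bit \<rho>[OF i]] bit_index kz_index[OF i])
    then show "(complex_of_real (c i) \<cdot>\<^sub>m (ket_bra [b i] \<otimes>\<^sub>m \<rho> i \<otimes>\<^sub>m ket_bra (z i))) $$
        ((s * D + \<gamma>) * ?N + \<xi>, (s' * D + \<gamma>') * ?N + \<xi>') =
      of_real (c i) * (of_bool (s = of_bool (b i) \<and> s' = of_bool (b i)) * \<rho> i $$ (\<gamma>, \<gamma>') *
       of_bool (\<xi> = horner_sum of_bool 2 (z i) \<and> \<xi>' = horner_sum of_bool 2 (z i)))"
      by (simp only: smult[OF tensor_mat_carrier[OF tensor_mat_carrier[OF bit \<rho>[OF i]] kz[OF i]] range])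
  qed
  have S: "?S $$ (\<gamma> * ?N + \<xi>, \<gamma>' * ?N + \<xi>') =
     (\<Sum>i\<in>I. of_real (c i) * (\<rho> i $$ (\<gamma>, \<gamma>') *
       of_bool (\<xi> = horner_sum of_bool 2 (z i) \<and> \<xi>' = horner_sum of_bool 2 (z i))))"
    unfolding mat_sum_index[OF in_range']
  proof (rule sum.cong[OF refl])
    fix i assume i: "i \<in> I"
    show "(complex_of_real (c i) \<cdot>\<^sub>m (\<rho> i \<otimes>\<^sub>m ket_bra (z i))) $$ (\<gamma> * ?N + \<xi>, \<gamma>' * ?N + \<xi>') =
      of_real (c i) * (\<rho> i $$ (\<gamma>, \<gamma>') *
       of_bool (\<xi> = horner_sum of_bool 2 (z i) \<and> \<xi>' = horner_sum of_bool 2 (z i)))"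
      using assms
      by (simp only: smult[OF tensor_mat_carrier[OF \<rho>[OF i] kz[OF i]] in_range']
          tensor_mat_index[OF \<rho>[OF i] kz[OF i]] kz_index[OF i])
  qed
  have mm: "maximally_mixed 1 \<in> carrier_mat 2 2" by (simp add: maximally_mixed_def)
  have mm_index: "maximally_mixed 1 $$ (s, s') = of_bool (s = s') / 2"
    using assms by (simp add: maximally_mixed_def)
  have "(maximally_mixed 1 \<otimes>\<^sub>m ?S) $$ ((s * D + \<gamma>) * ?N + \<xi>, (s' * D + \<gamma>') * ?N + \<xi>') =
      of_bool (s = s') / 2 * ?S $$ (\<gamma> * ?N + \<xi>, \<gamma>' * ?N + \<xi>')"
    unfolding assoc
    using tensor_mat_index[OF mm mat_sum_carrier assms(1) in_range'(1) assms(2) in_range'(2)] mm_index by metis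
  moreover have MMc: "maximally_mixed 1 \<otimes>\<^sub>m ?S \<in> carrier_mat (2 * D * ?N) (2 * D * ?N)"
    using tensor_mat_carrier[OF mm mat_sum_carrier[of "D * ?N"]] by (simp only: mult.assoc)
  have "one_bit_extractor_diff D ?N c b \<rho> z I $$ ((s * D + \<gamma>) * ?N + \<xi>, (s' * D + \<gamma>') * ?N + \<xi>') =
     ?M1 $$ ((s * D + \<gamma>) * ?N + \<xi>, (s' * D + \<gamma>') * ?N + \<xi>') -
     (maximally_mixed 1 \<otimes>\<^sub>m ?S) $$ ((s * D + \<gamma>) * ?N + \<xi>, (s' * D + \<gamma>') * ?N + \<xi>')"
    unfolding one_bit_extractor_diff_def
    by (rule index_minus_mat(1)) (simp_all only: carrier_matD[OF MMc] range)
  ultimately have "one_bit_extractor_diff D ?N c b \<rho> z I $$ ((s * D + \<gamma>) * ?N + \<xi>, (s' * D + \<gamma>') * ?N + \<xi>') =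
     ?M1 $$ ((s * D + \<gamma>) * ?N + \<xi>, (s' * D + \<gamma>') * ?N + \<xi>') - of_bool (s = s') / 2 * ?S $$ (\<gamma> * ?N + \<xi>, \<gamma>' * ?N + \<xi>')"
    by (simp only:)
  also have "\<dots> = (\<Sum>i\<in>I. of_real (c i) * bit_weight (b i) s s' * \<rho> i $$ (\<gamma>, \<gamma>') *
       of_bool (\<xi> = horner_sum of_bool 2 (z i) \<and> \<xi>' = horner_sum of_bool 2 (z i)))"
    unfolding M1 S sum_distrib_left sum_subtractf[symmetric]
    by (intro sum.cong refl) (simp add: bit_weight_def algebra_simps)
  finally show ?thesis .
qed

lemma one_bit_extractor_diff_carrier:
  "one_bit_extractor_diff D (2 ^ n) c b \<rho> z I \<in> carrier_mat (2 * D * 2 ^ n) (2 * D * 2 ^ n)"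
proof -
  have "maximally_mixed 1 \<in> carrier_mat 2 2" by (simp add: maximally_mixed_def)
  from tensor_mat_carrier[OF this mat_sum_carrier[of "D * 2 ^ n"]]
  show ?thesis unfolding one_bit_extractor_diff_def mult.assoc by (rule minus_carrier_mat)
qed

lemma one_bit_extractor_diff_hermitian:
  assumes herm: "\<And>i \<gamma> \<gamma>'. i \<in> I \<Longrightarrow> \<gamma> < D \<Longrightarrow> \<gamma>' < D \<Longrightarrow> \<rho> i $$ (\<gamma>, \<gamma>') = cnj (\<rho> i $$ (\<gamma>', \<gamma>))"
  shows "mat_adjoint (one_bit_extractor_diff D (2 ^ n) c b \<rho> z I) = one_bit_extractor_diff D (2 ^ n) c b \<rho> z I"
    (is "mat_adjoint ?H = ?H")
proof (rule eq_matI)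
  note H = one_bit_extractor_diff_carrier
  have split: "\<exists>s \<gamma> \<xi>. i = (s * D + \<gamma>) * 2 ^ n + \<xi> \<and> s < 2 \<and> \<gamma> < D \<and> \<xi> < 2 ^ n" if "i < 2 * D * 2 ^ n" for i
  proof -
    \<comment> \<open>For \<open>D = 0\<close> there is no index in range; otherwise the digits can
      be recovered by division with remainder.\<close>
    have "0 < D" using that by (cases D) auto
    moreover have q: "i div 2 ^ n < 2 * D" using that by (simp add: less_mult_imp_div_less)
    moreover have "i div 2 ^ n div D < 2" using q by (simp add: less_mult_imp_div_less)
    moreover have "i = (i div 2 ^ n div D * D + i div 2 ^ n mod D) * 2 ^ n + i mod 2 ^ n"
      by (simp only: div_mult_mod_eq)
    ultimately show ?thesis by (metis mod_less_divisor zero_less_numeral zero_less_power)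
  qed
  fix i j assume "i < dim_row ?H" "j < dim_col ?H"
  then have ij: "i < 2 * D * 2 ^ n" "j < 2 * D * 2 ^ n" using H by auto
  obtain s \<gamma> \<xi> where i: "i = (s * D + \<gamma>) * 2 ^ n + \<xi>" "s < 2" "\<gamma> < D" "\<xi> < 2 ^ n" using split[OF ij(1)] by blast
  obtain s' \<gamma>' \<xi>' where j: "j = (s' * D + \<gamma>') * 2 ^ n + \<xi>'" "s' < 2" "\<gamma>' < D" "\<xi>' < 2 ^ n" using split[OF ij(2)] by blast
  have "mat_adjoint ?H $$ (i, j) = cnj (?H $$ (j, i))" using H ij by (subst mat_adjoint_index) auto
  also have "\<dots> = ?H $$ (i, j)"
    unfolding i(1) j(1) one_bit_extractor_diff_index[OF i(2) j(2) i(3) j(3) i(4) j(4)]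
      one_bit_extractor_diff_index[OF j(2) i(2) j(3) i(3) j(4) i(4)] cnj_sum
  proof (rule sum.cong[OF refl])
    fix t assume t: "t \<in> I"
    show "cnj (of_real (c t) * bit_weight (b t) s' s * \<rho> t $$ (\<gamma>', \<gamma>) *
          of_bool (\<xi>' = horner_sum of_bool 2 (z t) \<and> \<xi> = horner_sum of_bool 2 (z t))) =
        of_real (c t) * bit_weight (b t) s s' * \<rho> t $$ (\<gamma>, \<gamma>') *
          of_bool (\<xi> = horner_sum of_bool 2 (z t) \<and> \<xi>' = horner_sum of_bool 2 (z t))"
      using herm[OF t i(3) j(3)] by (auto simp: bit_weight_def)
  qed
  finally show "mat_adjoint ?H $$ (i, j) = ?H $$ (i, j)" .
qed (use one_bit_extractor_diff_carrier in auto)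

text \<open>The register projector forces both register digits to equal the label of
  \<open>z i\<close>, and \<open>bit_weight\<close> vanishes for \<open>s \<noteq> s'\<close>. Hence
  \<open>U\<close> contributes only its diagonal blocks at \<open>(s, z i)\<close>, with opposite
  signs for the two values of \<open>s\<close>.\<close>

lemma trace_one_bit_extractor_diff:
  assumes U: "U \<in> carrier_mat (2 * D * 2 ^ n) (2 * D * 2 ^ n)"
  defines "G \<equiv> \<lambda>s i. \<Sum>\<gamma><D. \<Sum>\<gamma>'<D. \<rho> i $$ (\<gamma>, \<gamma>') *
     U $$ ((s * D + \<gamma>') * 2 ^ n + horner_sum of_bool 2 (z i), (s * D + \<gamma>) * 2 ^ n + horner_sum of_bool 2 (z i))"
  shows "mat_trace (one_bit_extractor_diff D (2 ^ n) c b \<rho> z I * U) =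
    1 / 2 * ((\<Sum>i\<in>I. of_real (c i) * (if b i then - 1 else 1) * G 0 i)
           - (\<Sum>i\<in>I. of_real (c i) * (if b i then - 1 else 1) * G 1 i))"
proof -
  let ?H = "one_bit_extractor_diff D (2 ^ n) c b \<rho> z I"
  let ?N = "2 ^ n :: nat"
  let ?h = "\<lambda>i. horner_sum of_bool 2 (z i) :: nat"
  note H = one_bit_extractor_diff_carrier
  define g where "g i s s' \<gamma> \<gamma>' \<xi> \<xi>' = of_real (c i) * bit_weight (b i) s s' * \<rho> i $$ (\<gamma>, \<gamma>') *
       of_bool (\<xi> = ?h i \<and> \<xi>' = ?h i) * U $$ ((s' * D + \<gamma>') * ?N + \<xi>', (s * D + \<gamma>) * ?N + \<xi>)" for i s s' \<gamma> \<gamma>' \<xi> \<xi>'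
  have "mat_trace (?H * U) = (\<Sum>p<2 * D * ?N. (?H * U) $$ (p, p))"
    using H by (simp add: mat_trace_def)
  also have "\<dots> = (\<Sum>p<2 * D * ?N. \<Sum>q<2 * D * ?N. ?H $$ (p, q) * U $$ (q, p))"
    by (intro sum.cong refl) (rule index_mult_mat_sum[OF H U], auto)
  also have "\<dots> = (\<Sum>s<2. \<Sum>\<gamma><D. \<Sum>\<xi><?N. \<Sum>s'<2. \<Sum>\<gamma>'<D. \<Sum>\<xi>'<?N. \<Sum>i\<in>I. g i s s' \<gamma> \<gamma>' \<xi> \<xi>')"
    unfolding sum_lessThan_mult[of _ "2 * D" ?N] sum_lessThan_mult[of _ 2 D]
    by (intro sum.cong refl) (simp only: one_bit_extractor_diff_index lessThan_iff g_def sum_distrib_right)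
  also have "\<dots> = (\<Sum>(s,\<gamma>,\<xi>,s',\<gamma>',\<xi>',i)\<in>{..<2}\<times>{..<D}\<times>{..<?N}\<times>{..<2}\<times>{..<D}\<times>{..<?N}\<times>I. g i s s' \<gamma> \<gamma>' \<xi> \<xi>')"
    by (simp add: sum.cartesian_product split_def)
  also have "\<dots> = (\<Sum>(i,s,s',\<gamma>,\<gamma>',\<xi>,\<xi>')\<in>I\<times>{..<2}\<times>{..<2}\<times>{..<D}\<times>{..<D}\<times>{..<?N}\<times>{..<?N}. g i s s' \<gamma> \<gamma>' \<xi> \<xi>')"
    by (rule sum.reindex_bij_witness[where
        i = "\<lambda>(i,s,s',\<gamma>,\<gamma>',\<xi>,\<xi>'). (s,\<gamma>,\<xi>,s',\<gamma>',\<xi>',i)" and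
        j = "\<lambda>(s,\<gamma>,\<xi>,s',\<gamma>',\<xi>',i). (i,s,s',\<gamma>,\<gamma>',\<xi>,\<xi>')"]) auto
  also have "\<dots> = (\<Sum>i\<in>I. \<Sum>s<2. \<Sum>s'<2. \<Sum>\<gamma><D. \<Sum>\<gamma>'<D. \<Sum>\<xi><?N. \<Sum>\<xi>'<?N. g i s s' \<gamma> \<gamma>' \<xi> \<xi>')"
    by (simp add: sum.cartesian_product split_def)
  also have "\<dots> = (\<Sum>i\<in>I. 1 / 2 * (of_real (c i) * (if b i then - 1 else 1) * G 0 i - of_real (c i) * (if b i then - 1 else 1) * G 1 i))"
  proof (rule sum.cong[OF refl])
    fix i assume i: "i \<in> I"
    have hN: "?h i < ?N" using horner_sum_bits_less[of "z i"] z[OF i] by (simp add: bitstrings_def)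
    have collapse: "(\<Sum>\<xi><?N. \<Sum>\<xi>'<?N. g i s s' \<gamma> \<gamma>' \<xi> \<xi>') = of_real (c i) * bit_weight (b i) s s' *
        (\<rho> i $$ (\<gamma>, \<gamma>') * U $$ ((s' * D + \<gamma>') * ?N + ?h i, (s * D + \<gamma>) * ?N + ?h i))" for s s' \<gamma> \<gamma>'
    proof -
      have "(\<Sum>\<xi>'<?N. g i s s' \<gamma> \<gamma>' \<xi> \<xi>') = (if \<xi> = ?h i then of_real (c i) * bit_weight (b i) s s' *
        (\<rho> i $$ (\<gamma>, \<gamma>') * U $$ ((s' * D + \<gamma>') * ?N + ?h i, (s * D + \<gamma>) * ?N + ?h i)) else 0)" for \<xi>
      proof -
        have "(\<Sum>\<xi>'<?N. g i s s' \<gamma> \<gamma>' \<xi> \<xi>') = (\<Sum>\<xi>'<?N. if \<xi>' = ?h i then g i s s' \<gamma> \<gamma>' \<xi> (?h i) else 0)"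
          by (intro sum.cong refl) (auto simp: g_def)
        also have "\<dots> = g i s s' \<gamma> \<gamma>' \<xi> (?h i)" using hN by simp
        finally show ?thesis by (auto simp: g_def)
      qed
      then show ?thesis using hN by simp
    qed
    have "(\<Sum>s<2. \<Sum>s'<2. \<Sum>\<gamma><D. \<Sum>\<gamma>'<D. \<Sum>\<xi><?N. \<Sum>\<xi>'<?N. g i s s' \<gamma> \<gamma>' \<xi> \<xi>') =
       (\<Sum>s<2. \<Sum>s'<2. of_real (c i) * bit_weight (b i) s s' * (\<Sum>\<gamma><D. \<Sum>\<gamma>'<D. \<rho> i $$ (\<gamma>, \<gamma>') *
         U $$ ((s' * D + \<gamma>') * ?N + ?h i, (s * D + \<gamma>) * ?N + ?h i)))"
      unfolding collapse sum_distrib_left ..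
    also have "\<dots> = 1 / 2 * (of_real (c i) * (if b i then - 1 else 1) * G 0 i - of_real (c i) * (if b i then - 1 else 1) * G 1 i)"
    proof -
      define G' where "G' s s' = (\<Sum>\<gamma><D. \<Sum>\<gamma>'<D. \<rho> i $$ (\<gamma>, \<gamma>') *
         U $$ ((s' * D + \<gamma>') * ?N + ?h i, (s * D + \<gamma>) * ?N + ?h i))" for s s'
      have G: "G s i = G' s s" for s by (simp only: G_def G'_def)
      have two: "{..<2 :: nat} = {0, 1}" by auto
      show ?thesis
        unfolding G'_def[symmetric] G two by (cases "b i") (simp_all add: bit_weight_def field_simps)
    qed
    finally show "(\<Sum>s<2. \<Sum>s'<2. \<Sum>\<gamma><D. \<Sum>\<gamma>'<D. \<Sum>\<xi><?N. \<Sum>\<xi>'<?N. g i s s' \<gamma> \<gamma>' \<xi> \<xi>') =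
       1 / 2 * (of_real (c i) * (if b i then - 1 else 1) * G 0 i - of_real (c i) * (if b i then - 1 else 1) * G 1 i)" .
  qed
  finally show ?thesis by (simp only: sum_distrib_left[symmetric] sum_subtractf)
qed

text \<open>The dual test \<open>U\<close> is unknown, so the hypothesis has to cover every family
  of contractions indexed by the register. Its blocks for \<open>s = 0\<close> and
  \<open>s = 1\<close> are two such families, each contributing at most \<open>M\<close>; the
  factors 1/2 from \<open>tr_norm\<close> and from \<open>bit_weight\<close> reduce
  \<open>2 * M\<close> to \<open>M / 2\<close>.\<close>

lemma tr_norm_one_bit_extractor_diff:
  assumes herm: "\<And>i \<gamma> \<gamma>'. i \<in> I \<Longrightarrow> \<gamma> < D \<Longrightarrow> \<gamma>' < D \<Longrightarrow> \<rho> i $$ (\<gamma>, \<gamma>') = cnj (\<rho> i $$ (\<gamma>', \<gamma>))"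
    and bound: "\<And>W. (\<And>x. x \<in> bitstrings n \<Longrightarrow> contraction_on {..<D} {..<D} (W x)) \<Longrightarrow>
      cmod (\<Sum>i\<in>I. of_real (c i) * (if b i then - 1 else 1) * (\<Sum>\<gamma><D. \<Sum>\<gamma>'<D. \<rho> i $$ (\<gamma>, \<gamma>') * W (z i) \<gamma>' \<gamma>)) \<le> M"
  shows "tr_norm (one_bit_extractor_diff D (2 ^ n) c b \<rho> z I) \<le> M / 2"
proof -
  let ?H = "one_bit_extractor_diff D (2 ^ n) c b \<rho> z I"
  let ?N = "2 ^ n :: nat"
  let ?h = "\<lambda>x. horner_sum of_bool 2 x :: nat"
  obtain U where U: "U \<in> carrier_mat (2 * D * ?N) (2 * D * ?N)"
    and Uc: "contraction_on {..<2 * D * ?N} {..<2 * D * ?N} (\<lambda>i j. U $$ (i, j))"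
    and tr: "tr_norm ?H = 1 / 2 * Re (mat_trace (?H * U))"
    using tr_norm_dual[OF one_bit_extractor_diff_carrier one_bit_extractor_diff_hermitian[OF herm]] by blast
  define W where "W s x \<gamma>' \<gamma> = U $$ ((s * D + \<gamma>') * ?N + ?h x, (s * D + \<gamma>) * ?N + ?h x)" for s x \<gamma>' \<gamma>
  define T where "T s = (\<Sum>i\<in>I. of_real (c i) * (if b i then - 1 else 1) * (\<Sum>\<gamma><D. \<Sum>\<gamma>'<D. \<rho> i $$ (\<gamma>, \<gamma>') * W s (z i) \<gamma>' \<gamma>))" for s
  have T: "cmod (T s) \<le> M" if s: "s < 2" for s
    unfolding T_def
  proof (rule bound)
    fix x :: "bool list" assume x: "x \<in> bitstrings n"
    then have "?h x < ?N" using horner_sum_bits_less[of x] by (simp add: bitstrings_def)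
    then show "contraction_on {..<D} {..<D} (W s x)"
      unfolding W_def using s
      by (intro contraction_on_subblock[OF Uc, of "\<lambda>\<gamma>. (s * D + \<gamma>) * ?N + ?h x" _ "\<lambda>\<gamma>. (s * D + \<gamma>) * ?N + ?h x"])
        (auto simp: inj_on_def intro!: mult_add_less)
  qed
  have "mat_trace (?H * U) = 1 / 2 * (T 0 - T 1)"
    unfolding trace_one_bit_extractor_diff[OF U] T_def W_def ..
  then have "Re (mat_trace (?H * U)) \<le> cmod (1 / 2 * (T 0 - T 1))" by (metis complex_Re_le_cmod)
  also have "\<dots> = 1 / 2 * cmod (T 0 - T 1)" by (simp add: norm_mult norm_divide)
  also have "\<dots> \<le> 1 / 2 * (M + M)"
    using norm_triangle_ineq4[of "T 0" "T 1"] T[of 0] T[of 1] by simp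
  finally show ?thesis unfolding tr by simp
qed

end

section \<open>Storages\<close>

lemma apply_local_hermitian:
  assumes \<sigma>: "psd_mat (da * dc) \<sigma>"
    and K: "set Ks \<subseteq> carrier_mat dA da" and L: "set Ls \<subseteq> carrier_mat dB dc"
    and ij: "i < dA * dB" "j < dA * dB"
  shows "apply_local dA dB Ks Ls \<sigma> $$ (i, j) = cnj (apply_local dA dB Ks Ls \<sigma> $$ (j, i))"
proof -
  have \<sigma>c: "\<sigma> \<in> carrier_mat (da * dc) (da * dc)" using \<sigma> by (simp add: psd_mat_def)
  obtain R where R: "\<And>i j. i < da * dc \<Longrightarrow> j < da * dc \<Longrightarrow> \<sigma> $$ (i, j) = (\<Sum>e<da * dc. R i e * cnj (R j e))"
    using psd_mat_factor[OF \<sigma>] by blast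
  have "0 < dB" using ij by (cases dB) auto
  then have dm: "i div dB < dA" "i mod dB < dB" "j div dB < dA" "j mod dB < dB"
    using ij by (auto simp: less_mult_imp_div_less)
  show ?thesis
    using apply_local_index[OF K L \<sigma>c R dm] apply_local_index[OF K L \<sigma>c R dm(3,4,1,2)]
    by (simp add: mult.commute)
qed

lemma partial_trace_carrier [simp]: "partial_trace d1 d2 d3 A \<in> carrier_mat (d1 * d3) (d1 * d3)"
  by (simp add: partial_trace_def)

lemma partial_trace_hermitian:
  assumes A: "\<And>i j. i < d1 * d2 * d3 \<Longrightarrow> j < d1 * d2 * d3 \<Longrightarrow> A $$ (i, j) = cnj (A $$ (j, i))"
    and ij: "i < d1 * d3" "j < d1 * d3"
  shows "partial_trace d1 d2 d3 A $$ (i, j) = cnj (partial_trace d1 d2 d3 A $$ (j, i))"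
proof -
  have "0 < d3" using ij by (cases d3) auto
  then have "(i div d3 * d2 + k) * d3 + i mod d3 < d1 * d2 * d3" if "i < d1 * d3" "k < d2" for i k
    using that by (intro mult_add_less) (auto simp: less_mult_imp_div_less)
  then have "A $$ ((i div d3 * d2 + k) * d3 + i mod d3, (j div d3 * d2 + k) * d3 + j mod d3) =
      cnj (A $$ ((j div d3 * d2 + k) * d3 + j mod d3, (i div d3 * d2 + k) * d3 + i mod d3))" if "k < d2" for k
    using ij that by (intro A) auto
  then show ?thesis using ij by (simp add: partial_trace_def)
qed

text \<open>Fixing the sizes \<open>a\<close> and \<open>c\<close> of the shared systems makes it
  possible to single out the case where a party shares nothing, and so to treat both storage models
  together.\<close>

definition local_storage :: "nat \<Rightarrow> nat \<Rightarrow> nat \<Rightarrow> nat \<Rightarrow> nat \<Rightarrow> nat \<Rightarrow> nat \<Rightarrow> state_family \<Rightarrow> bool" where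
  "local_storage n a c b1 b2 r1 r2 \<tau> \<longleftrightarrow>
     (\<exists>\<sigma> KA KB. density_mat (2 ^ (a + c)) \<sigma> \<and>
        (\<forall>x\<in>bitstrings n. quantum_operation (2 ^ a) (2 ^ (b1 + r1)) (KA x)) \<and>
        (\<forall>y\<in>bitstrings n. quantum_operation (2 ^ c) (2 ^ (b2 + r2)) (KB y)) \<and>
        (\<forall>x\<in>bitstrings n. \<forall>y\<in>bitstrings n.
           \<tau> x y = apply_local (2 ^ (b1 + r1)) (2 ^ (b2 + r2)) (KA x) (KB y) \<sigma>))"

lemma entangled_storage_iff: "entangled_storage n b1 b2 r1 r2 \<tau> \<longleftrightarrow> (\<exists>a c. local_storage n a c b1 b2 r1 r2 \<tau>)"
  by (simp add: entangled_storage_def local_storage_def)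

text \<open>The Kraus operators are the columns of a factor of \<open>\<rho>\<close>. For a
  one-dimensional input, completeness is a single scalar equation, namely that \<open>\<rho>\<close>
  has trace 1.\<close>

lemma density_mat_preparation:
  assumes "density_mat d \<rho>"
  shows "\<exists>Ks. quantum_operation 1 d Ks \<and>
    (\<forall>i<d. \<forall>j<d. \<rho> $$ (i, j) = (\<Sum>k<length Ks. Ks ! k $$ (i, 0) * cnj (Ks ! k $$ (j, 0))))"
proof -
  obtain R where R: "\<And>i j. i < d \<Longrightarrow> j < d \<Longrightarrow> \<rho> $$ (i, j) = (\<Sum>e<d. R i e * cnj (R j e))"
    and tr: "(\<Sum>i<d. \<Sum>e<d. (cmod (R i e))\<^sup>2) = 1"
    using density_mat_factor[OF assms] by blast
  define Ks where "Ks = map (\<lambda>e. mat d 1 (\<lambda>(i, _). R i e)) [0..<d]"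
  have len: "length Ks = d" by (simp add: Ks_def)
  have K: "Ks ! k \<in> carrier_mat d 1" if "k < d" for k using that by (simp add: Ks_def)
  have K_index: "Ks ! k $$ (i, 0) = R i k" if "k < d" "i < d" for i k using that by (simp add: Ks_def)
  have "(\<Sum>k<d. (mat_adjoint (Ks ! k) * Ks ! k) $$ (0, 0)) = 1"
  proof -
    have "(\<Sum>k<d. (mat_adjoint (Ks ! k) * Ks ! k) $$ (0, 0)) = (\<Sum>k<d. \<Sum>i<d. cnj (R i k) * R i k)"
    proof (rule sum.cong[OF refl])
      fix k assume "k \<in> {..<d}"
      then have k: "k < d" by simp
      have "(mat_adjoint (Ks ! k) * Ks ! k) $$ (0, 0) = (\<Sum>i<d. mat_adjoint (Ks ! k) $$ (0, i) * Ks ! k $$ (i, 0))"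
        using K[OF k] by (intro index_mult_mat_sum[of _ 1 d _ 1]) auto
      also have "\<dots> = (\<Sum>i<d. cnj (R i k) * R i k)"
        using K[OF k] k by (intro sum.cong refl) (auto simp: K_index)
      finally show "(mat_adjoint (Ks ! k) * Ks ! k) $$ (0, 0) = (\<Sum>i<d. cnj (R i k) * R i k)" .
    qed
    also have "\<dots> = complex_of_real (\<Sum>i<d. \<Sum>e<d. (cmod (R i e))\<^sup>2)"
      unfolding of_real_sum cmod_sq_eq by (rule sum.swap)
    finally show ?thesis by (simp add: tr)
  qed
  then have "mat_sum 1 (\<lambda>k. mat_adjoint (Ks ! k) * Ks ! k) {..<length Ks} = 1\<^sub>m 1"
    unfolding len by (intro eq_matI) (auto simp: mat_sum_def)
  moreover have "set Ks \<subseteq> carrier_mat d 1" by (auto simp: Ks_def)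
  ultimately have "quantum_operation 1 d Ks" by (simp add: quantum_operation_def)
  moreover have "\<rho> $$ (i, j) = (\<Sum>k<length Ks. Ks ! k $$ (i, 0) * cnj (Ks ! k $$ (j, 0)))" if "i < d" "j < d" for i j
    unfolding len R[OF that] by (intro sum.cong refl) (simp add: K_index that)
  ultimately show ?thesis by blast
qed

text \<open>Independent preparations are local operations on a shared system of zero qubits; the trivial
  input dimension is what saves the second factor \<open>2 ^ b\<close> in the non-entangled bound.\<close>

lemma nonentangled_storage_local:
  assumes "nonentangled_storage n b1 b2 r1 r2 \<tau>"
  shows "local_storage n 0 0 b1 b2 r1 r2 \<tau>"
proof -
  let ?dA = "2 ^ (b1 + r1)" and ?dB = "2 ^ (b2 + r2)"
  obtain \<rho>A \<rho>B where \<rho>A: "\<And>x. x \<in> bitstrings n \<Longrightarrow> density_mat ?dA (\<rho>A x)"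
    and \<rho>B: "\<And>y. y \<in> bitstrings n \<Longrightarrow> density_mat ?dB (\<rho>B y)"
    and \<tau>: "\<And>x y. x \<in> bitstrings n \<Longrightarrow> y \<in> bitstrings n \<Longrightarrow> \<tau> x y = \<rho>A x \<otimes>\<^sub>m \<rho>B y"
    using assms unfolding nonentangled_storage_def by blast
  have "\<forall>x\<in>bitstrings n. \<exists>Ks. quantum_operation 1 ?dA Ks \<and>
    (\<forall>i<?dA. \<forall>j<?dA. \<rho>A x $$ (i, j) = (\<Sum>k<length Ks. Ks ! k $$ (i, 0) * cnj (Ks ! k $$ (j, 0))))"
    using density_mat_preparation[OF \<rho>A] by blast
  then obtain KA where KA: "\<forall>x\<in>bitstrings n. quantum_operation 1 ?dA (KA x) \<and>
    (\<forall>i<?dA. \<forall>j<?dA. \<rho>A x $$ (i, j) = (\<Sum>k<length (KA x). KA x ! k $$ (i, 0) * cnj (KA x ! k $$ (j, 0))))"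
    by (rule bchoice[THEN exE])
  have "\<forall>y\<in>bitstrings n. \<exists>Ks. quantum_operation 1 ?dB Ks \<and>
    (\<forall>i<?dB. \<forall>j<?dB. \<rho>B y $$ (i, j) = (\<Sum>k<length Ks. Ks ! k $$ (i, 0) * cnj (Ks ! k $$ (j, 0))))"
    using density_mat_preparation[OF \<rho>B] by blast
  then obtain KB where KB: "\<forall>y\<in>bitstrings n. quantum_operation 1 ?dB (KB y) \<and>
    (\<forall>i<?dB. \<forall>j<?dB. \<rho>B y $$ (i, j) = (\<Sum>k<length (KB y). KB y ! k $$ (i, 0) * cnj (KB y ! k $$ (j, 0))))"
    by (rule bchoice[THEN exE])
  have one: "psd_mat 1 (1\<^sub>m 1)"
    by (rule psd_matI_factor[where E = "{0 :: nat}" and R = "\<lambda>_ _. 1"]) auto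
  then have "density_mat (2 ^ (0 + 0)) (1\<^sub>m 1)" by (simp add: density_mat_def mat_trace_def)
  moreover have "\<tau> x y = apply_local ?dA ?dB (KA x) (KB y) (1\<^sub>m 1)"
    if x: "x \<in> bitstrings n" and y: "y \<in> bitstrings n" for x y
    unfolding \<tau>[OF that]
  proof (rule eq_matI)
    have cA: "\<rho>A x \<in> carrier_mat ?dA ?dA" and cB: "\<rho>B y \<in> carrier_mat ?dB ?dB"
      using \<rho>A[OF x] \<rho>B[OF y] by (auto simp: density_mat_def psd_mat_def)
    have KAc: "set (KA x) \<subseteq> carrier_mat ?dA 1" and KBc: "set (KB y) \<subseteq> carrier_mat ?dB 1"
      using KA KB x y by (auto simp: quantum_operation_def)
    fix i j assume "i < dim_row (apply_local ?dA ?dB (KA x) (KB y) (1\<^sub>m 1))"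
      "j < dim_col (apply_local ?dA ?dB (KA x) (KB y) (1\<^sub>m 1))"
    then have ij: "i < ?dA * ?dB" "j < ?dA * ?dB"
      using carrier_matD[OF apply_local_carrier] by metis+
    define \<alpha> where "\<alpha> = i div ?dB" define \<mu> where "\<mu> = i mod ?dB"
    define \<alpha>' where "\<alpha>' = j div ?dB" define \<mu>' where "\<mu>' = j mod ?dB"
    have dm: "\<alpha> < ?dA" "\<mu> < ?dB" "\<alpha>' < ?dA" "\<mu>' < ?dB"
      using ij by (auto simp: less_mult_imp_div_less \<alpha>_def \<mu>_def \<alpha>'_def \<mu>'_def)
    have i: "i = \<alpha> * ?dB + \<mu>" unfolding \<alpha>_def \<mu>_def by (simp only: div_mult_mod_eq)
    have j: "j = \<alpha>' * ?dB + \<mu>'" unfolding \<alpha>'_def \<mu>'_def by (simp only: div_mult_mod_eq)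
    have out: "local_output 1 1 (KA x) (KB y) (\<lambda>_ _. 1) e k \<alpha> l \<mu> = KA x ! k $$ (\<alpha>, 0) * KB y ! l $$ (\<mu>, 0)" for e k \<alpha> l \<mu>
      by (simp add: local_output_def)
    have "apply_local ?dA ?dB (KA x) (KB y) (1\<^sub>m 1) $$ (i, j) =
       (\<Sum>k<length (KA x). \<Sum>l<length (KB y). \<Sum>e\<in>{0 :: nat}. local_output 1 1 (KA x) (KB y) (\<lambda>_ _. 1) e k \<alpha> l \<mu> *
          cnj (local_output 1 1 (KA x) (KB y) (\<lambda>_ _. 1) e k \<alpha>' l \<mu>'))"
      unfolding i j by (rule apply_local_index[OF KAc KBc _ _ dm]) auto
    also have "\<dots> = (\<Sum>k<length (KA x). KA x ! k $$ (\<alpha>, 0) * cnj (KA x ! k $$ (\<alpha>', 0))) *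
        (\<Sum>l<length (KB y). KB y ! l $$ (\<mu>, 0) * cnj (KB y ! l $$ (\<mu>', 0)))"
      unfolding out sum_product by (intro sum.cong refl) simp
    also have "\<dots> = \<rho>A x $$ (\<alpha>, \<alpha>') * \<rho>B y $$ (\<mu>, \<mu>')"
      using KA KB x y dm by simp
    also have "\<dots> = (\<rho>A x \<otimes>\<^sub>m \<rho>B y) $$ (i, j)"
      unfolding i j by (rule tensor_mat_index[OF cA cB dm(1,2,3,4), symmetric])
    finally show "(\<rho>A x \<otimes>\<^sub>m \<rho>B y) $$ (i, j) = apply_local ?dA ?dB (KA x) (KB y) (1\<^sub>m 1) $$ (i, j)" ..
  next
    have cA: "\<rho>A x \<in> carrier_mat ?dA ?dA" and cB: "\<rho>B y \<in> carrier_mat ?dB ?dB"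
      using \<rho>A[OF x] \<rho>B[OF y] by (auto simp: density_mat_def psd_mat_def)
    note dims = carrier_matD[OF tensor_mat_carrier[OF cA cB]] carrier_matD[OF apply_local_carrier]
    show "dim_row (\<rho>A x \<otimes>\<^sub>m \<rho>B y) = dim_row (apply_local ?dA ?dB (KA x) (KB y) (1\<^sub>m 1))"
      "dim_col (\<rho>A x \<otimes>\<^sub>m \<rho>B y) = dim_col (apply_local ?dA ?dB (KA x) (KB y) (1\<^sub>m 1))"
      unfolding dims by simp_all
  qed
  ultimately show ?thesis
    unfolding local_storage_def using KA KB by (intro exI[of _ "1\<^sub>m 1"] exI[of _ KA] exI[of _ KB]) simp
qed

section \<open>From the signed sums to the extractor property\<close>

text \<open>The target is the square of \<open>2 * \<epsilon>\<close> because the trace norm is half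
  of the bound on the signed sum; its factor 4 is the offset 2 in the hypothesis. The exponent
  \<open>e\<close> is the number of qubits charged to the storer.\<close>

lemma min_entropy_arith:
  fixes \<epsilon> k1 k2 e A B :: real and n :: nat
  assumes \<epsilon>: "\<epsilon> > 0" and le: "k1 + k2 - e \<ge> real n - 2 + 2 * log 2 (inverse \<epsilon>)"
    and AB: "A * B = 2 powr e"
  shows "2 ^ n * (2 powr - k1 * A) * (2 powr - k2 * B) \<le> (2 * \<epsilon>)\<^sup>2"
proof -
  have "2 ^ n * (2 powr - k1 * A) * (2 powr - k2 * B) = 2 powr n * 2 powr - k1 * 2 powr - k2 * (A * B)"
    by (simp add: powr_realpow)
  also have "\<dots> = 2 powr (n - k1 - k2 + e)"
    unfolding AB powr_add[symmetric] by simp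
  also have "\<dots> \<le> 2 powr (2 + 2 * log 2 \<epsilon>)"
    using le \<epsilon> by (intro powr_mono) (simp_all add: log_inverse)
  also have "\<dots> = 4 * (2 powr log 2 \<epsilon>)\<^sup>2"
    by (simp only: powr_add mult_2[of "log 2 \<epsilon>"] power2_eq_square) simp
  also have "\<dots> = (2 * \<epsilon>)\<^sup>2" using \<epsilon> by (simp add: power_mult_distrib)
  finally show ?thesis .
qed

lemma dimension_factor:
  "real (2 ^ b) * (if 2 ^ a = (1 :: nat) then 1 else real (2 ^ b)) = 2 powr (if a = 0 then real b else 2 * real b)"
  by (cases "a = 0") (simp_all add: powr_realpow powr_add[of 2 "real b" "real b", simplified])

lemma inner_product_ext_bitstrings: "inner_product_ext n x y \<in> bitstrings 1"
  by (simp add: inner_product_ext_def bitstrings_def)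

text \<open>Alice keeps everything, so the entropy condition involves only Bob's memory
  \<open>b2\<close>, charged twice, or once if he holds no part of the shared state.\<close>

lemma X_superstrong_local:
  assumes \<epsilon>: "\<epsilon> > 0" and St: "local_storage n a c b1 b2 r1 r2 \<tau>"
    and p: "min_entropy_source n k1 p" and q: "min_entropy_source n k2 q"
    and le: "k1 + k2 - (if c = 0 then real b2 else 2 * real b2) \<ge> real n - 2 + 2 * log 2 (inverse \<epsilon>)"
  defines "\<rho>A \<equiv> \<lambda>x y. alice_keeps_all b1 b2 r1 r2 (\<tau> x y)"
  shows "tr_norm
          (mat_sum (2 ^ (1 + (b1 + r1 + b2) + n))
             (\<lambda>(x, y). complex_of_real (pmf p x * pmf q y) \<cdot>\<^sub>m (ket_bra (inner_product_ext n x y) \<otimes>\<^sub>m \<rho>A x y \<otimes>\<^sub>m ket_bra x))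
             (bitstrings n \<times> bitstrings n)
           - maximally_mixed 1 \<otimes>\<^sub>m
             mat_sum (2 ^ ((b1 + r1 + b2) + n))
               (\<lambda>(x, y). complex_of_real (pmf p x * pmf q y) \<cdot>\<^sub>m (\<rho>A x y \<otimes>\<^sub>m ket_bra x))
               (bitstrings n \<times> bitstrings n)) \<le> \<epsilon>"
    (is "tr_norm ?H \<le> \<epsilon>")
proof -
  let ?dA = "2 ^ (b1 + r1) :: nat" and ?d = "2 ^ b2 :: nat" and ?r = "2 ^ r2 :: nat"
  let ?D = "?dA * ?d"
  let ?I = "bitstrings n \<times> bitstrings n"
  define b where "b = (\<lambda>(x, y). odd (\<Sum>j<n. of_bool (x ! j) * of_bool (y ! j) :: nat))"
  obtain \<sigma> KA KB where \<sigma>: "density_mat (2 ^ a * 2 ^ c) \<sigma>"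
    and KA: "\<And>x. x \<in> bitstrings n \<Longrightarrow> quantum_operation (2 ^ a) ?dA (KA x)"
    and KB: "\<And>y. y \<in> bitstrings n \<Longrightarrow> quantum_operation (2 ^ c) (?d * ?r) (KB y)"
    and \<tau>: "\<And>x y. x \<in> bitstrings n \<Longrightarrow> y \<in> bitstrings n \<Longrightarrow> \<tau> x y = apply_local ?dA (?d * ?r) (KA x) (KB y) \<sigma>"
    using St unfolding local_storage_def power_add by blast
  have \<rho>A: "\<rho>A x y = partial_trace ?D ?r 1 (apply_local ?dA (?d * ?r) (KA x) (KB y) \<sigma>)"
    if "x \<in> bitstrings n" "y \<in> bitstrings n" for x y
    unfolding \<rho>A_def alice_keeps_all_def \<tau>[OF that] power_add ..
  have H: "?H = one_bit_extractor_diff ?D (2 ^ n) (\<lambda>(x, y). pmf p x * pmf q y) b (\<lambda>(x, y). \<rho>A x y) fst ?I"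
    unfolding one_bit_extractor_diff_def
    by (simp add: power_add split_def b_def inner_product_ext_def mult.assoc)
  show ?thesis
    unfolding H
  \<comment> \<open>The choice of \<open>M\<close> compensates for the factor 1/2, so that the
    remaining goal is the signed-sum bound.\<close>
  proof (rule order_trans[OF tr_norm_one_bit_extractor_diff[where M = "2 * \<epsilon>"]])
    show "(case i of (x, y) \<Rightarrow> \<rho>A x y) \<in> carrier_mat ?D ?D" if "i \<in> ?I" for i
      using that partial_trace_carrier[of ?D ?r 1] by (auto simp: \<rho>A)
    show "(case i of (x, y) \<Rightarrow> \<rho>A x y) $$ (\<gamma>, \<gamma>') = cnj ((case i of (x, y) \<Rightarrow> \<rho>A x y) $$ (\<gamma>', \<gamma>))"
      if i: "i \<in> ?I" and g: "\<gamma> < ?D" "\<gamma>' < ?D" for i \<gamma> \<gamma>'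
    proof -
      obtain x y where xy: "i = (x, y)" "x \<in> bitstrings n" "y \<in> bitstrings n" using i by auto
      have "psd_mat (2 ^ a * 2 ^ c) \<sigma>" using \<sigma> by (simp add: density_mat_def)
      then have "apply_local ?dA (?d * ?r) (KA x) (KB y) \<sigma> $$ (i, j) = cnj (apply_local ?dA (?d * ?r) (KA x) (KB y) \<sigma> $$ (j, i))"
        if "i < ?D * ?r * 1" "j < ?D * ?r * 1" for i j
        using KA[OF xy(2)] KB[OF xy(3)] that
        by (intro apply_local_hermitian[of "2 ^ a" "2 ^ c"]) (auto simp: quantum_operation_def mult.assoc)
      from partial_trace_hermitian[OF this, where i = \<gamma> and j = \<gamma>'] show ?thesis using g by (simp add: xy \<rho>A)
    qed
    fix W :: "bool list \<Rightarrow> nat \<Rightarrow> nat \<Rightarrow> complex"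
    assume W: "\<And>x. x \<in> bitstrings n \<Longrightarrow> contraction_on {..<?D} {..<?D} (W x)"
    have "(\<Sum>i\<in>?I. of_real (case i of (x, y) \<Rightarrow> pmf p x * pmf q y) * (if b i then - 1 else 1) *
        (\<Sum>\<gamma><?D. \<Sum>\<gamma>'<?D. (case i of (x, y) \<Rightarrow> \<rho>A x y) $$ (\<gamma>, \<gamma>') * W (fst i) \<gamma>' \<gamma>)) =
      (\<Sum>x\<in>bitstrings n. \<Sum>y\<in>bitstrings n. of_real (pmf p x * pmf q y) * ip_sign n x y *
        (\<Sum>\<gamma><?D. \<Sum>\<gamma>'<?D. partial_trace ?D ?r 1 (apply_local ?dA (?d * ?r) (KA x) (KB y) \<sigma>) $$ (\<gamma>, \<gamma>') * W x \<gamma>' \<gamma>))"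
      unfolding sum.cartesian_product'
      by (intro sum.cong refl) (simp add: b_def ip_sign_def \<rho>A)
    also have "(cmod \<dots>)\<^sup>2 \<le> 2 ^ n * (2 powr - k1 * real ?d) * (2 powr - k2 * (if 2 ^ c = (1 :: nat) then 1 else real ?d))"
      by (rule Alice_sum_bound[OF \<sigma> KA KB W p q])
    also have "\<dots> \<le> (2 * \<epsilon>)\<^sup>2"
      by (rule min_entropy_arith[OF \<epsilon> le]) (rule dimension_factor)
    finally show "cmod (\<Sum>i\<in>?I. of_real (case i of (x, y) \<Rightarrow> pmf p x * pmf q y) * (if b i then - 1 else 1) *
        (\<Sum>\<gamma><?D. \<Sum>\<gamma>'<?D. (case i of (x, y) \<Rightarrow> \<rho>A x y) $$ (\<gamma>, \<gamma>') * W (fst i) \<gamma>' \<gamma>)) \<le> 2 * \<epsilon>"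
      by (rule power2_le_imp_le) (use \<epsilon> in simp)
  qed (use \<epsilon> in auto)
qed

lemma Y_superstrong_local:
  assumes \<epsilon>: "\<epsilon> > 0" and St: "local_storage n a c b1 b2 r1 r2 \<tau>"
    and p: "min_entropy_source n k1 p" and q: "min_entropy_source n k2 q"
    and le: "k1 + k2 - (if a = 0 then real b1 else 2 * real b1) \<ge> real n - 2 + 2 * log 2 (inverse \<epsilon>)"
  defines "\<rho>B \<equiv> \<lambda>x y. bob_keeps_all b1 b2 r1 r2 (\<tau> x y)"
  shows "tr_norm
          (mat_sum (2 ^ (1 + (b1 + b2 + r2) + n))
             (\<lambda>(x, y). complex_of_real (pmf p x * pmf q y) \<cdot>\<^sub>m (ket_bra (inner_product_ext n x y) \<otimes>\<^sub>m \<rho>B x y \<otimes>\<^sub>m ket_bra y))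
             (bitstrings n \<times> bitstrings n)
           - maximally_mixed 1 \<otimes>\<^sub>m
             mat_sum (2 ^ ((b1 + b2 + r2) + n))
               (\<lambda>(x, y). complex_of_real (pmf p x * pmf q y) \<cdot>\<^sub>m (\<rho>B x y \<otimes>\<^sub>m ket_bra y))
               (bitstrings n \<times> bitstrings n)) \<le> \<epsilon>"
    (is "tr_norm ?H \<le> \<epsilon>")
proof -
  let ?dB = "2 ^ (b2 + r2) :: nat" and ?d = "2 ^ b1 :: nat" and ?r = "2 ^ r1 :: nat"
  let ?D = "?d * ?dB"
  let ?I = "bitstrings n \<times> bitstrings n"
  define b where "b = (\<lambda>(x, y). odd (\<Sum>j<n. of_bool (x ! j) * of_bool (y ! j) :: nat))"
  obtain \<sigma> KA KB where \<sigma>: "density_mat (2 ^ a * 2 ^ c) \<sigma>"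
    and KA: "\<And>x. x \<in> bitstrings n \<Longrightarrow> quantum_operation (2 ^ a) (?d * ?r) (KA x)"
    and KB: "\<And>y. y \<in> bitstrings n \<Longrightarrow> quantum_operation (2 ^ c) ?dB (KB y)"
    and \<tau>: "\<And>x y. x \<in> bitstrings n \<Longrightarrow> y \<in> bitstrings n \<Longrightarrow> \<tau> x y = apply_local (?d * ?r) ?dB (KA x) (KB y) \<sigma>"
    using St unfolding local_storage_def power_add by blast
  have \<rho>B: "\<rho>B x y = partial_trace ?d ?r ?dB (apply_local (?d * ?r) ?dB (KA x) (KB y) \<sigma>)"
    if "x \<in> bitstrings n" "y \<in> bitstrings n" for x y
    unfolding \<rho>B_def bob_keeps_all_def \<tau>[OF that] power_add ..
  have H: "?H = one_bit_extractor_diff ?D (2 ^ n) (\<lambda>(x, y). pmf p x * pmf q y) b (\<lambda>(x, y). \<rho>B x y) snd ?I"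
    unfolding one_bit_extractor_diff_def
    by (simp add: power_add split_def b_def inner_product_ext_def mult.assoc)
  show ?thesis
    unfolding H
  proof (rule order_trans[OF tr_norm_one_bit_extractor_diff[where M = "2 * \<epsilon>"]])
    show "(case i of (x, y) \<Rightarrow> \<rho>B x y) \<in> carrier_mat ?D ?D" if "i \<in> ?I" for i
      using that partial_trace_carrier[of ?d ?r ?dB] by (auto simp: \<rho>B)
    show "(case i of (x, y) \<Rightarrow> \<rho>B x y) $$ (\<gamma>, \<gamma>') = cnj ((case i of (x, y) \<Rightarrow> \<rho>B x y) $$ (\<gamma>', \<gamma>))"
      if i: "i \<in> ?I" and g: "\<gamma> < ?D" "\<gamma>' < ?D" for i \<gamma> \<gamma>'
    proof -
      obtain x y where xy: "i = (x, y)" "x \<in> bitstrings n" "y \<in> bitstrings n" using i by auto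
      have "psd_mat (2 ^ a * 2 ^ c) \<sigma>" using \<sigma> by (simp add: density_mat_def)
      then have "apply_local (?d * ?r) ?dB (KA x) (KB y) \<sigma> $$ (i, j) = cnj (apply_local (?d * ?r) ?dB (KA x) (KB y) \<sigma> $$ (j, i))"
        if "i < ?d * ?r * ?dB" "j < ?d * ?r * ?dB" for i j
        using KA[OF xy(2)] KB[OF xy(3)] that
        by (intro apply_local_hermitian[of "2 ^ a" "2 ^ c"]) (auto simp: quantum_operation_def)
      from partial_trace_hermitian[OF this, where i = \<gamma> and j = \<gamma>'] show ?thesis using g by (simp add: xy \<rho>B)
    qed
    fix W :: "bool list \<Rightarrow> nat \<Rightarrow> nat \<Rightarrow> complex"
    assume W: "\<And>y. y \<in> bitstrings n \<Longrightarrow> contraction_on {..<?D} {..<?D} (W y)"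
    have "(\<Sum>i\<in>?I. of_real (case i of (x, y) \<Rightarrow> pmf p x * pmf q y) * (if b i then - 1 else 1) *
        (\<Sum>\<gamma><?D. \<Sum>\<gamma>'<?D. (case i of (x, y) \<Rightarrow> \<rho>B x y) $$ (\<gamma>, \<gamma>') * W (snd i) \<gamma>' \<gamma>)) =
      (\<Sum>x\<in>bitstrings n. \<Sum>y\<in>bitstrings n. of_real (pmf p x * pmf q y) * ip_sign n x y *
        (\<Sum>\<gamma><?D. \<Sum>\<gamma>'<?D. partial_trace ?d ?r ?dB (apply_local (?d * ?r) ?dB (KA x) (KB y) \<sigma>) $$ (\<gamma>, \<gamma>') * W y \<gamma>' \<gamma>))"
      unfolding sum.cartesian_product'
      by (intro sum.cong refl) (simp add: b_def ip_sign_def \<rho>B)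
    also have "(cmod \<dots>)\<^sup>2 \<le> 2 ^ n * (2 powr - k2 * real ?d) * (2 powr - k1 * (if 2 ^ a = (1 :: nat) then 1 else real ?d))"
      by (rule Bob_sum_bound[OF \<sigma> KA KB W p q])
    also have "\<dots> \<le> (2 * \<epsilon>)\<^sup>2"
      by (rule min_entropy_arith[OF \<epsilon> _ dimension_factor]) (use le in simp)
    finally show "cmod (\<Sum>i\<in>?I. of_real (case i of (x, y) \<Rightarrow> pmf p x * pmf q y) * (if b i then - 1 else 1) *
        (\<Sum>\<gamma><?D. \<Sum>\<gamma>'<?D. (case i of (x, y) \<Rightarrow> \<rho>B x y) $$ (\<gamma>, \<gamma>') * W (snd i) \<gamma>' \<gamma>)) \<le> 2 * \<epsilon>"
      by (rule power2_le_imp_le) (use \<epsilon> in simp)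
  qed (use \<epsilon> in auto)
qed

text \<open>Keeping Alice's state charges Bob's memory and vice versa, so \<open>e\<close> must
  dominate both charges; this is the origin of the maximum of \<open>b1\<close> and
  \<open>b2\<close>.\<close>

lemma superstrong_extractor_inner_product:
  assumes \<epsilon>: "\<epsilon> > 0"
    and St: "\<And>r1 r2 \<tau>. St n b1 b2 r1 r2 \<tau> \<Longrightarrow> \<exists>a c. local_storage n a c b1 b2 r1 r2 \<tau> \<and>
       (if a = 0 then real b1 else 2 * real b1) \<le> e \<and> (if c = 0 then real b2 else 2 * real b2) \<le> e"
    and le: "k1 + k2 - e \<ge> real n - 2 + 2 * log 2 (inverse \<epsilon>)"
  shows "superstrong_extractor St b1 b2 n 1 k1 k2 \<epsilon> (inner_product_ext n)"
  unfolding superstrong_extractor_def X_superstrong_extractor_def Y_superstrong_extractor_def Let_def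
proof (intro conjI allI impI ballI inner_product_ext_bitstrings)
  fix p q r1 r2 \<tau>
  assume p: "min_entropy_source n k1 p" and q: "min_entropy_source n k2 q" and "St n b1 b2 r1 r2 \<tau>"
  then obtain a c where loc: "local_storage n a c b1 b2 r1 r2 \<tau>"
    and e: "(if a = 0 then real b1 else 2 * real b1) \<le> e" "(if c = 0 then real b2 else 2 * real b2) \<le> e"
    using St by blast
  have le1: "k1 + k2 - (if c = 0 then real b2 else 2 * real b2) \<ge> real n - 2 + 2 * log 2 (inverse \<epsilon>)"
    and le2: "k1 + k2 - (if a = 0 then real b1 else 2 * real b1) \<ge> real n - 2 + 2 * log 2 (inverse \<epsilon>)"
    using le e by linarith+
  note X_superstrong_local[OF \<epsilon> loc p q le1] Y_superstrong_local[OF \<epsilon> loc p q le2]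
  then show "tr_norm
          (mat_sum (2 ^ (1 + (b1 + r1 + b2) + n))
             (\<lambda>(x, y). complex_of_real (pmf p x * pmf q y) \<cdot>\<^sub>m (ket_bra (inner_product_ext n x y) \<otimes>\<^sub>m
                alice_keeps_all b1 b2 r1 r2 (\<tau> x y) \<otimes>\<^sub>m ket_bra x))
             (bitstrings n \<times> bitstrings n)
           - maximally_mixed 1 \<otimes>\<^sub>m
             mat_sum (2 ^ ((b1 + r1 + b2) + n))
               (\<lambda>(x, y). complex_of_real (pmf p x * pmf q y) \<cdot>\<^sub>m (alice_keeps_all b1 b2 r1 r2 (\<tau> x y) \<otimes>\<^sub>m ket_bra x))
               (bitstrings n \<times> bitstrings n)) \<le> \<epsilon>"
    and "tr_norm
          (mat_sum (2 ^ (1 + (b1 + b2 + r2) + n))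
             (\<lambda>(x, y). complex_of_real (pmf p x * pmf q y) \<cdot>\<^sub>m (ket_bra (inner_product_ext n x y) \<otimes>\<^sub>m
                bob_keeps_all b1 b2 r1 r2 (\<tau> x y) \<otimes>\<^sub>m ket_bra y))
             (bitstrings n \<times> bitstrings n)
           - maximally_mixed 1 \<otimes>\<^sub>m
             mat_sum (2 ^ ((b1 + b2 + r2) + n))
               (\<lambda>(x, y). complex_of_real (pmf p x * pmf q y) \<cdot>\<^sub>m (bob_keeps_all b1 b2 r1 r2 (\<tau> x y) \<otimes>\<^sub>m ket_bra y))
               (bitstrings n \<times> bitstrings n)) \<le> \<epsilon>" .
qed

theorem corollary15:
  fixes n b1 b2 :: nat and k1 k2 \<epsilon> :: real
  assumes "\<epsilon> > 0"
  shows "(k1 + k2 - 2 * real (max b1 b2) \<ge> real n - 2 + 2 * log 2 (inverse \<epsilon>) \<longrightarrow>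
           superstrong_extractor entangled_storage b1 b2 n 1 k1 k2 \<epsilon> (inner_product_ext n)) \<and>
         (k1 + k2 - real (max b1 b2) \<ge> real n - 2 + 2 * log 2 (inverse \<epsilon>) \<longrightarrow>
           superstrong_extractor nonentangled_storage b1 b2 n 1 k1 k2 \<epsilon> (inner_product_ext n))"
proof (intro conjI impI)
  assume le: "k1 + k2 - 2 * real (max b1 b2) \<ge> real n - 2 + 2 * log 2 (inverse \<epsilon>)"
  show "superstrong_extractor entangled_storage b1 b2 n 1 k1 k2 \<epsilon> (inner_product_ext n)"
  proof (rule superstrong_extractor_inner_product[OF assms _ le])
    fix r1 r2 \<tau> assume "entangled_storage n b1 b2 r1 r2 \<tau>"
    then obtain a c where "local_storage n a c b1 b2 r1 r2 \<tau>" unfolding entangled_storage_iff by blast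
    then show "\<exists>a c. local_storage n a c b1 b2 r1 r2 \<tau> \<and>
       (if a = 0 then real b1 else 2 * real b1) \<le> 2 * real (max b1 b2) \<and>
       (if c = 0 then real b2 else 2 * real b2) \<le> 2 * real (max b1 b2)"
      by (intro exI[of _ a] exI[of _ c]) auto
  qed
next
  assume le: "k1 + k2 - real (max b1 b2) \<ge> real n - 2 + 2 * log 2 (inverse \<epsilon>)"
  show "superstrong_extractor nonentangled_storage b1 b2 n 1 k1 k2 \<epsilon> (inner_product_ext n)"
  proof (rule superstrong_extractor_inner_product[OF assms _ le])
    fix r1 r2 \<tau> assume "nonentangled_storage n b1 b2 r1 r2 \<tau>"
    then have "local_storage n 0 0 b1 b2 r1 r2 \<tau>" by (rule nonentangled_storage_local)
    \<comment> \<open>With \<open>a = c = 0\<close> both conditionals select the single charge,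
      which is the gain over the entangled case.\<close>
    then show "\<exists>a c. local_storage n a c b1 b2 r1 r2 \<tau> \<and>
       (if a = 0 then real b1 else 2 * real b1) \<le> real (max b1 b2) \<and>
       (if c = 0 then real b2 else 2 * real b2) \<le> real (max b1 b2)"
      by (intro exI[of _ 0]) auto
  qed
qed

end
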